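(* There is an algorithm that, given any full-rank $\mathbf{A} \in \mathbb{R}^{n \times d}$ with $n \ge d$, any $b \in \mathbb{R}^n$, any $q \in (1,2]$ and any $\varepsilon > 0$, with high probability returns a vector $y \in \mathbb{R}^d$ with $\|\mathbf{A} y - b\|_q \le (1+\varepsilon)\min_{x \in \mathbb{R}^d}\|\mathbf{A} x - b\|_q$ in time $\widetilde{O}_p\big(d^{\frac{p-2}{2p-2}} \cdot \mathcal{T}_{\mathbf{A}}\big)$, where $p = q/(q-1)$.
   Context: $\mathcal{T}_{\mathbf{A}}$ denotes the time to (exactly) solve a linear system in a matrix of the form $\mathbf{A}^\top \mathbf{D} \mathbf{A}$, where $\mathbf{D}$ is a positive diagonal matrix. The notation $\widetilde{O}_p(\cdot)$ hides factors polynomial in $\log n$ and $\log(1/\varepsilon)$ as well as constants depending only on $p$. "With high probability" means with probability at least $1 - n^{-C}$ for any constant $C$. *)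

theory Defs
  imports "HOL-Probability.Probability_Mass_Function" "Jordan_Normal_Form.DL_Rank"
begin

definition lq_norm :: "real \<Rightarrow> real vec \<Rightarrow> real" where
  "lq_norm q v = (\<Sum>i<dim_vec v. \<bar>vec_index v i\<bar> powr q) powr (1 / q)"

definition nonzero_entries :: "real mat \<Rightarrow> (nat \<times> nat) list" where
  "nonzero_entries A =
     filter (\<lambda>e. A $$ e \<noteq> 0) (List.product [0..<dim_row A] [0..<dim_col A])"

definition nnz :: "real mat \<Rightarrow> nat" where
  "nnz A = length (nonzero_entries A)"

text \<open>
  The model of computation is the randomized real RAM with an oracle for the exact solution of
  linear systems in \<open>A\<^sup>T D A\<close>, where \<open>A\<close> is the input matrix and \<open>D\<close> is a positive diagonal matrix.
  It has two memories of unbounded size, one of naturals (also used for addresses and loop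
  counters) and one of exact reals, and it can flip fair coins.  Every instruction takes one unit
  of time, except that an oracle call takes time \<open>T\<close>.

  To keep the unit cost measure honest there is no multiplication of naturals, there are no real
  constants in programs, and reals cannot be rounded to naturals.  Real powers are included since
  \<open>\<bar>x\<bar> powr q\<close> for real \<open>q\<close> has to be evaluated.
\<close>

datatype instr =
    NConst nat nat        \<comment> \<open>\<open>N[a] := k\<close>\<close>
  | NAdd nat nat nat      \<comment> \<open>\<open>N[a] := N[b] + N[c]\<close>\<close>
  | NSub nat nat nat      \<comment> \<open>\<open>N[a] := N[b] - N[c]\<close>, truncated at 0\<close>
  | NLoad nat nat         \<comment> \<open>\<open>N[a] := N[N[b]]\<close>\<close>
  | NStore nat nat        \<comment> \<open>\<open>N[N[a]] := N[b]\<close>\<close>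
  | NJumpLess nat nat nat \<comment> \<open>if \<open>N[a] < N[b]\<close> then goto \<open>l\<close>\<close>
  | Flip nat              \<comment> \<open>\<open>N[a] :=\<close> fair random bit\<close>
  | ROfNat nat nat        \<comment> \<open>\<open>R[a] := N[b]\<close>\<close>
  | RAdd nat nat nat      \<comment> \<open>\<open>R[a] := R[b] + R[c]\<close>\<close>
  | RSub nat nat nat
  | RMul nat nat nat
  | RDiv nat nat nat
  | RPowr nat nat nat     \<comment> \<open>\<open>R[a] := \<bar>R[b]\<bar> powr R[c]\<close>\<close>
  | RLoad nat nat         \<comment> \<open>\<open>R[a] := R[N[b]]\<close>\<close>
  | RStore nat nat        \<comment> \<open>\<open>R[N[a]] := R[b]\<close>\<close>
  | RJumpLess nat nat nat \<comment> \<open>if \<open>R[a] < R[b]\<close> then goto \<open>l\<close>\<close>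
  | Solve nat nat nat     \<comment> \<open>oracle call: \<open>D\<close> at \<open>R[N[a]..]\<close>, right-hand side at \<open>R[N[b]..]\<close>,
                              solution written to \<open>R[N[c]..]\<close>\<close>
  | Halt nat              \<comment> \<open>return the vector at \<open>R[N[a]..]\<close>\<close>

type_synonym program = "instr list"

record config =
  pc :: nat
  nmem :: "nat \<Rightarrow> nat"
  rmem :: "nat \<Rightarrow> real"
  clock :: real
  result :: "real vec option"

definition read_vec :: "(nat \<Rightarrow> real) \<Rightarrow> nat \<Rightarrow> nat \<Rightarrow> real vec" where
  "read_vec R a k = vec k (\<lambda>i. R (a + i))"

definition write_vec :: "(nat \<Rightarrow> real) \<Rightarrow> nat \<Rightarrow> real vec \<Rightarrow> nat \<Rightarrow> real" where
  "write_vec R a x = (\<lambda>i. if a \<le> i \<and> i < a + dim_vec x then vec_index x (i - a) else R i)"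

definition weighted_gram :: "real mat \<Rightarrow> real vec \<Rightarrow> real mat" where
  "weighted_gram A w = transpose_mat A * mat_diag (dim_row A) (vec_index w) * A"

text \<open>For \<open>A\<close> of full column rank and positive \<open>w\<close> the solution is unique.\<close>

definition solve_gram :: "real mat \<Rightarrow> real vec \<Rightarrow> real vec \<Rightarrow> real vec" where
  "solve_gram A w v =
     (THE x. x \<in> carrier_vec (dim_col A) \<and> weighted_gram A w *\<^sub>v x = v)"

definition advance :: "real \<Rightarrow> config \<Rightarrow> config" where
  "advance t c = c\<lparr>pc := Suc (pc c), clock := clock c + t\<rparr>"

definition set_n :: "nat \<Rightarrow> nat \<Rightarrow> config \<Rightarrow> config" where
  "set_n a k c = advance 1 (c\<lparr>nmem := (nmem c)(a := k)\<rparr>)"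

definition set_r :: "nat \<Rightarrow> real \<Rightarrow> config \<Rightarrow> config" where
  "set_r a r c = advance 1 (c\<lparr>rmem := (rmem c)(a := r)\<rparr>)"

definition jump_if :: "bool \<Rightarrow> nat \<Rightarrow> config \<Rightarrow> config" where
  "jump_if P l c = (if P then c\<lparr>pc := l, clock := clock c + 1\<rparr> else advance 1 c)"

text \<open>
  An oracle call whose weights are not all positive blocks: the configuration is repeated forever
  and no result is ever returned.
\<close>

fun exec :: "real mat \<Rightarrow> real \<Rightarrow> instr \<Rightarrow> config \<Rightarrow> config pmf" where
  "exec A T (NConst a k) c = return_pmf (set_n a k c)"
| "exec A T (NAdd a b d) c = return_pmf (set_n a (nmem c b + nmem c d) c)"
| "exec A T (NSub a b d) c = return_pmf (set_n a (nmem c b - nmem c d) c)"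
| "exec A T (NLoad a b) c = return_pmf (set_n a (nmem c (nmem c b)) c)"
| "exec A T (NStore a b) c = return_pmf (set_n (nmem c a) (nmem c b) c)"
| "exec A T (NJumpLess a b l) c = return_pmf (jump_if (nmem c a < nmem c b) l c)"
| "exec A T (Flip a) c = map_pmf (\<lambda>h. set_n a (if h then 1 else 0) c) (bernoulli_pmf (1/2))"
| "exec A T (ROfNat a b) c = return_pmf (set_r a (real (nmem c b)) c)"
| "exec A T (RAdd a b d) c = return_pmf (set_r a (rmem c b + rmem c d) c)"
| "exec A T (RSub a b d) c = return_pmf (set_r a (rmem c b - rmem c d) c)"
| "exec A T (RMul a b d) c = return_pmf (set_r a (rmem c b * rmem c d) c)"
| "exec A T (RDiv a b d) c = return_pmf (set_r a (rmem c b / rmem c d) c)"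
| "exec A T (RPowr a b d) c = return_pmf (set_r a (\<bar>rmem c b\<bar> powr rmem c d) c)"
| "exec A T (RLoad a b) c = return_pmf (set_r a (rmem c (nmem c b)) c)"
| "exec A T (RStore a b) c = return_pmf (set_r (nmem c a) (rmem c b) c)"
| "exec A T (RJumpLess a b l) c = return_pmf (jump_if (rmem c a < rmem c b) l c)"
| "exec A T (Solve a b d) c =
     (let w = read_vec (rmem c) (nmem c a) (dim_row A);
          v = read_vec (rmem c) (nmem c b) (dim_col A)
      in return_pmf
           (if \<forall>i<dim_row A. vec_index w i > 0
            then advance T (c\<lparr>rmem := write_vec (rmem c) (nmem c d) (solve_gram A w v)\<rparr>)
            else c))"
| "exec A T (Halt a) c =
     return_pmf (advance 1 (c\<lparr>result := Some (read_vec (rmem c) (nmem c a) (dim_col A))\<rparr>))"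

definition step :: "real mat \<Rightarrow> real \<Rightarrow> program \<Rightarrow> config \<Rightarrow> config pmf" where
  "step A T P c =
     (if result c = None \<and> pc c < length P then exec A T (P ! pc c) c else return_pmf c)"

fun run :: "real mat \<Rightarrow> real \<Rightarrow> program \<Rightarrow> nat \<Rightarrow> config \<Rightarrow> config pmf" where
  "run A T P 0 c = return_pmf c"
| "run A T P (Suc k) c = bind_pmf (run A T P k c) (step A T P)"

text \<open>
  The input occupies the odd addresses; the even ones are initially 0, so that a program has as many
  directly addressable work registers as it needs.  The matrix is given in sparse form, as the list
  of its nonzero entries.
\<close>

definition list_mem :: "'a::zero list \<Rightarrow> nat \<Rightarrow> 'a" where
  "list_mem xs a = (if odd a \<and> a div 2 < length xs then xs ! (a div 2) else 0)"

definition input_config :: "real mat \<Rightarrow> real vec \<Rightarrow> real \<Rightarrow> real \<Rightarrow> config" where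
  "input_config A b q \<epsilon> =
     \<lparr>pc = 0,
      nmem = list_mem (dim_row A # dim_col A # nnz A #
                concat (map (\<lambda>(i, j). [i, j]) (nonzero_entries A))),
      rmem = list_mem (q # \<epsilon> # map (\<lambda>e. A $$ e) (nonzero_entries A) @ list_of_vec b),
      clock = 0,
      result = None\<rparr>"

text \<open>
  With probability at least \<open>\<delta>\<close>, the program returns a vector satisfying \<open>Q\<close> within time \<open>t\<close>.
  A configuration with a result is never left, so for \<open>T \<ge> 1\<close>, where every instruction takes at
  least one unit of time, the event has the same probability for all large numbers \<open>k\<close> of steps.
\<close>

definition returns_within ::
  "real mat \<Rightarrow> real \<Rightarrow> program \<Rightarrow> config \<Rightarrow> real \<Rightarrow> real \<Rightarrow> (real vec \<Rightarrow> bool) \<Rightarrow> bool" where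
  "returns_within A T P c t \<delta> Q \<longleftrightarrow>
     (\<exists>k. measure_pmf.prob (run A T P k c)
            {c'. clock c' \<le> t \<and> (\<exists>y. result c' = Some y \<and> Q y)} \<ge> \<delta>)"

end

theory Submission
  imports Defs
begin

text \<open>
  Let \<open>cost x\<close> be the \<open>q\<close>-th power of the norm of the residual \<open>A x - b\<close>. The algorithm starts at the least squares solution,
  which is optimal up to a factor \<open>n\<close>, and maintains a bound \<open>G\<close> on the gap to the optimum; each phase decreases
  \<open>G\<close> by a factor that depends only on \<open>q\<close>, so that logarithmically many phases suffice.

  In a phase with residual \<open>z\<close>, the Bregman divergence of \<open>\<bar>t\<bar> powr q\<close> at \<open>z i\<close> is comparable to a Huber-like function that is
  quadratic with weight \<open>u i powr (q - 2)\<close> below the scale \<open>u i \<ge> \<bar>z i\<bar>\<close> and of order \<open>q\<close> above it. The resulting problem is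
  solved by accelerated gradient descent with respect to the quadratic form with these weights, each step being
  one linear system. If the scales dominate \<open>sqrt (\<kappa> * l i)\<close>, where \<open>l i\<close> is the leverage score divided by the weight,
  then minimizers are bounded by about \<open>G / \<kappa>\<close>, which is of order \<open>d\<close>, times the scales, and about
  \<open>d powr (1 - q / 2) = d powr ((p - 2) / (2 * p - 2))\<close> steps suffice; the sum of the enlarged scales stays small
  because leverage scores sum to \<open>d\<close>.

  Such scales are Lewis weights in disguise. They are found by fixed point iteration, a contraction in the logarithm, in
  which the leverage scores are overestimated up to logarithmic factors by solving systems with
  random sign right-hand sides: by Paley--Zygmund a sample is large with constant probability, and by Hoeffding's
  inequality it is never too large.
\<close>

section \<open>Failure bounds for runs of the machine\<close>

text \<open>The upper and the lower model of a step differ by a constant factor in their Huber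
  parts. Scaling a step by \<open>s\<close> shrinks its linear part by \<open>s\<close>, but its
  Huber part by \<open>s powr q\<close>; hence for small \<open>s\<close> the scaled optimal step
  still gains a fixed fraction of the gap even in the upper model. This superlinearity forces
  \<open>1 < q\<close> and fixes \<open>s\<close> and the contraction factor
  \<open>1 - s / 2\<close>.

  The exponent of \<open>d\<close> comes from a bound that feeds on itself. Let \<open>K\<close> be
  the largest ratio of a coordinate of the optimal step to its scale. The quadratic form exceeds the
  Huber energy by at most a factor of order \<open>K powr (2 - q)\<close>, while leverage scores
  bound \<open>K ^ 2\<close> by this quadratic form times \<open>1 / \<kappa>\<close>. Dividing,
  \<open>K powr q\<close> is of order \<open>d\<close>, and acceleration pays only the square root
  of \<open>K powr (2 - q)\<close>.

  The fixed point iteration needs a start at a finite ratio from its first iterate. A floor for the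
  scales provides this, low enough that all \<open>n\<close> floors together cost only a small
  fraction of the gap.

  The machine neither takes logarithms nor rounds, so iteration bounds remain real registers with
  which counters are compared.\<close>

lemma run_Suc_front: "run A T P (Suc k) c = bind_pmf (step A T P c) (run A T P k)"
proof (induction k)
  case 0
  show ?case by (simp add: bind_return_pmf bind_return_pmf')
next
  case (Suc k)
  have "run A T P (Suc (Suc k)) c = bind_pmf (run A T P (Suc k) c) (step A T P)" by simp
  also have "\<dots> = bind_pmf (step A T P c) (\<lambda>c'. bind_pmf (run A T P k c') (step A T P))"
    by (simp only: Suc.IH bind_assoc_pmf)
  finally show ?case by simp
qed

lemma prob_bind_bernoulli_half:
  "measure_pmf.prob (bind_pmf (bernoulli_pmf (1/2)) f) X
    = (measure_pmf.prob (f True) X + measure_pmf.prob (f False) X) / 2"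
proof -
  have "ennreal (measure_pmf.prob (bind_pmf (bernoulli_pmf (1/2)) f) X)
      = ennreal ((measure_pmf.prob (f True) X + measure_pmf.prob (f False) X) / 2)"
  proof -
    have h: "ennreal x * inverse 2 = ennreal (x / 2)" if "0 \<le> x" for x
      using that by (simp add: divide_ennreal_def[symmetric] ennreal_divide_numeral)
    have "ennreal (measure_pmf.prob (bind_pmf (bernoulli_pmf (1/2)) f) X)
      = (\<Sum>x\<in>UNIV. ennreal (measure_pmf.prob (f x) X) * inverse 2)"
      by (simp add: measure_pmf.emeasure_eq_measure[symmetric] nn_integral_measure_pmf_finite)
    also have "\<dots> = ennreal (measure_pmf.prob (f True) X / 2) + ennreal (measure_pmf.prob (f False) X / 2)"
      by (simp add: UNIV_bool h)
    also have "\<dots> = ennreal ((measure_pmf.prob (f True) X + measure_pmf.prob (f False) X) / 2)"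
      by (simp add: ennreal_plus[symmetric] add_divide_distrib del: ennreal_plus)
    finally show ?thesis .
  qed
  then show ?thesis by (subst (asm) ennreal_inj) auto
qed

text \<open>\<open>reach A T P F c t \<delta>\<close> bounds by \<open>\<delta>\<close> the probability that the run from \<open>c\<close> does not return a
  vector in \<open>F\<close> within additional time \<open>t\<close>.\<close>

inductive reach :: "real mat \<Rightarrow> real \<Rightarrow> program \<Rightarrow> (real vec \<Rightarrow> bool) \<Rightarrow> config \<Rightarrow> real \<Rightarrow> real \<Rightarrow> bool"
  for A T P F where
  reach_fail: "1 \<le> \<delta> \<Longrightarrow> reach A T P F c t \<delta>"
| reach_done: "result c = Some y \<Longrightarrow> F y \<Longrightarrow> 0 \<le> t \<Longrightarrow> 0 \<le> \<delta> \<Longrightarrow> reach A T P F c t \<delta>"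
| reach_step: "result c = None \<Longrightarrow> pc c < length P \<Longrightarrow> exec A T (P ! pc c) c = return_pmf c' \<Longrightarrow>
    clock c' + t' \<le> clock c + t \<Longrightarrow> reach A T P F c' t' \<delta> \<Longrightarrow> reach A T P F c t \<delta>"
| reach_flip: "result c = None \<Longrightarrow> pc c < length P \<Longrightarrow> P ! pc c = Flip a \<Longrightarrow>
    t' + 1 \<le> t \<Longrightarrow> reach A T P F (set_n a 0 c) t' \<delta>0 \<Longrightarrow> reach A T P F (set_n a 1 c) t' \<delta>1 \<Longrightarrow>
    (\<delta>0 + \<delta>1) / 2 \<le> \<delta> \<Longrightarrow> reach A T P F c t \<delta>"

definition good_at :: "(real vec \<Rightarrow> bool) \<Rightarrow> real \<Rightarrow> config set" where
  "good_at F t = {c. clock c \<le> t \<and> (\<exists>y. result c = Some y \<and> F y)}"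

lemma good_at_mono: "s \<le> t \<Longrightarrow> good_at F s \<subseteq> good_at F t"
  by (auto simp: good_at_def)

lemma run_result: "result c = Some y \<Longrightarrow> run A T P k c = return_pmf c"
  by (induction k) (simp_all add: step_def bind_return_pmf)

text \<open>Asserting the bound for all large numbers of steps lets the two branches of a coin flip
  share one number of steps; waiting does no harm because a configuration with a result is never
  left.\<close>

lemma reach_sound:
  assumes "reach A T P F c t \<delta>"
  shows "\<exists>k0. \<forall>k\<ge>k0. 1 - \<delta> \<le> measure_pmf.prob (run A T P k c) (good_at F (clock c + t))"
  using assms
proof (induction rule: reach.induct)
  case (reach_fail \<delta> c t)
  have "1 - \<delta> \<le> measure_pmf.prob (run A T P k c) (good_at F (clock c + t))" for k
    using reach_fail measure_nonneg[of "measure_pmf (run A T P k c)" "good_at F (clock c + t)"] by linarith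
  then show ?case by blast
next
  case (reach_done c y t \<delta>)
  then have "c \<in> good_at F (clock c + t)" by (simp add: good_at_def)
  then have "measure_pmf.prob (run A T P k c) (good_at F (clock c + t)) = 1" for k
    using run_result[OF reach_done(1), of A T P k] by simp
  then show ?case using reach_done(4) by (metis diff_le_eq le_add_same_cancel1)
next
  case (reach_step c c' t' t \<delta>)
  from reach_step.IH obtain k0 where
    k0: "\<forall>k\<ge>k0. 1 - \<delta> \<le> measure_pmf.prob (run A T P k c') (good_at F (clock c' + t'))" ..
  have "1 - \<delta> \<le> measure_pmf.prob (run A T P k c) (good_at F (clock c + t))" if "k \<ge> Suc k0" for k
  proof -
    obtain j where k: "k = Suc j" using \<open>k \<ge> Suc k0\<close> by (cases k) auto
    then have j: "j \<ge> k0" using \<open>k \<ge> Suc k0\<close> by simp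
    have "run A T P k c = run A T P j c'"
      using reach_step(1-3) unfolding k run_Suc_front by (simp add: step_def bind_return_pmf)
    moreover have "measure_pmf.prob (run A T P j c') (good_at F (clock c' + t'))
       \<le> measure_pmf.prob (run A T P j c') (good_at F (clock c + t))"
      using reach_step(4) good_at_mono by (intro measure_pmf.finite_measure_mono) auto
    ultimately show ?thesis using k0 j by fastforce
  qed
  then show ?case by blast
next
  case (reach_flip c a t' t \<delta>0 \<delta>1 \<delta>)
  from reach_flip.IH(1) obtain k0 where
    k0: "\<forall>k\<ge>k0. 1 - \<delta>0 \<le> measure_pmf.prob (run A T P k (set_n a 0 c)) (good_at F (clock (set_n a 0 c) + t'))"
    ..
  from reach_flip.IH(2) obtain k1 where
    k1: "\<forall>k\<ge>k1. 1 - \<delta>1 \<le> measure_pmf.prob (run A T P k (set_n a 1 c)) (good_at F (clock (set_n a 1 c) + t'))"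
    ..
  have "1 - \<delta> \<le> measure_pmf.prob (run A T P k c) (good_at F (clock c + t))" if "k \<ge> Suc (max k0 k1)" for k
  proof -
    have j0: "k \<ge> Suc (max k0 k1)" by (fact that)
    then obtain j where k: "k = Suc j" by (cases k) auto
    then have j: "j \<ge> k0" "j \<ge> k1" using j0 by simp_all
    let ?S = "good_at F (clock c + t)"
    have "run A T P k c = bind_pmf (bernoulli_pmf (1/2)) (\<lambda>h. run A T P j (set_n a (if h then 1 else 0) c))"
      using reach_flip(1-3) unfolding k run_Suc_front by (simp add: step_def bind_map_pmf)
    then have e: "measure_pmf.prob (run A T P k c) ?S
       = (measure_pmf.prob (run A T P j (set_n a 1 c)) ?S + measure_pmf.prob (run A T P j (set_n a 0 c)) ?S) / 2"
      by (simp add: prob_bind_bernoulli_half)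
    have m: "measure_pmf.prob (run A T P j (set_n a h c)) (good_at F (clock (set_n a h c) + t'))
       \<le> measure_pmf.prob (run A T P j (set_n a h c)) ?S" for h
      using reach_flip(4) by (intro measure_pmf.finite_measure_mono good_at_mono) (auto simp: set_n_def advance_def)
    have "1 - \<delta>0 \<le> measure_pmf.prob (run A T P j (set_n a 0 c)) ?S"
      using k0[rule_format, OF j(1)] m by (rule order_trans)
    moreover have "1 - \<delta>1 \<le> measure_pmf.prob (run A T P j (set_n a 1 c)) ?S"
      using k1[rule_format, OF j(2)] m by (rule order_trans)
    ultimately show ?thesis using reach_flip(7) unfolding e
      by (simp only: le_divide_eq divide_le_eq) simp
  qed
  then show ?case by blast
qed

lemma reach_returns_within:
  assumes "reach A T P F c t \<delta>" "clock c = 0"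
  shows "returns_within A T P c t (1 - \<delta>) F"
  using reach_sound[OF assms(1)] assms(2) unfolding returns_within_def good_at_def by auto

section \<open>Structured commands\<close>

lemma reach_mono:
  assumes "reach A T P F c t \<delta>" "t \<le> t'" "\<delta> \<le> \<delta>'"
  shows "reach A T P F c t' \<delta>'"
  using assms
proof (induction arbitrary: t' \<delta>' rule: reach.induct)
  case (reach_fail \<delta> c t)
  then show ?case by (intro reach.reach_fail) simp
next
  case (reach_done c y t \<delta>)
  then show ?case by (intro reach.reach_done) auto
next
  case (reach_step c c' s' s \<delta>)
  show ?case
    by (rule reach.reach_step[OF reach_step(1-3), where t' = s']) (use reach_step in auto)
next
  case (reach_flip c a s' s \<delta>0 \<delta>1 \<delta>)
  show ?case
    by (rule reach.reach_flip[OF reach_flip(1-3), where t' = s' and ?\<delta>0.0 = \<delta>0 and ?\<delta>1.0 = \<delta>1]) (use reach_flip in auto)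
qed

type_synonym nmemory = "nat \<Rightarrow> nat"
type_synonym rmemory = "nat \<Rightarrow> real"

text \<open>\<open>DoLess\<close> tests after its body and compares naturals, which suits
  traversals: vectors and the list of nonzero entries are never empty. \<open>WhileLess\<close>
  tests first and compares real registers, because iteration bounds are computed as reals.\<close>

datatype com =
    Code "instr list"
  | Seq com com (infixr ";;" 60)
  | DoLess nat nat com
  | WhileLess nat nat com

fun com_len :: "com \<Rightarrow> nat" where
  "com_len (Code is) = length is"
| "com_len (c1 ;; c2) = com_len c1 + com_len c2"
| "com_len (DoLess a b c) = com_len c + 1"
| "com_len (WhileLess a b c) = com_len c + 5"

text \<open>The first jump of \<open>WhileLess\<close> that leaves the loop is unconditional: it compares the constants
  0 and 1 in the scratch registers 0 and 2.\<close>

fun compile :: "nat \<Rightarrow> com \<Rightarrow> instr list" where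
  "compile l (Code is) = is"
| "compile l (c1 ;; c2) = compile l c1 @ compile (l + com_len c1) c2"
| "compile l (DoLess a b c) = compile l c @ [NJumpLess a b l]"
| "compile l (WhileLess a b c) =
    [RJumpLess a b (l + 4), NConst 0 0, NConst 2 1, NJumpLess 0 2 (l + 5 + com_len c)]
    @ compile (l + 4) c @ [RJumpLess a b (l + 4)]"

lemma length_compile [simp]: "length (compile l c) = com_len c"
  by (induction c arbitrary: l) auto

definition code_at :: "program \<Rightarrow> nat \<Rightarrow> instr list \<Rightarrow> bool" where
  "code_at P l is \<longleftrightarrow> (\<exists>xs ys. P = xs @ is @ ys \<and> length xs = l)"

lemma code_at_append: "code_at P l (is @ js) \<longleftrightarrow> code_at P l is \<and> code_at P (l + length is) js"
proof
  assume "code_at P l (is @ js)"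
  then obtain xs ys where "P = xs @ (is @ js) @ ys" "length xs = l" unfolding code_at_def by blast
  then have "P = xs @ is @ (js @ ys)" "P = (xs @ is) @ js @ ys" "length xs = l" "length (xs @ is) = l + length is"
    by simp_all
  then show "code_at P l is \<and> code_at P (l + length is) js" unfolding code_at_def by blast
next
  assume "code_at P l is \<and> code_at P (l + length is) js"
  then obtain xs ys xs' ys' where 1: "P = xs @ is @ ys" "length xs = l" "P = xs' @ js @ ys'" "length xs' = l + length is"
    unfolding code_at_def by blast
  have "xs' = take (l + length is) P" using 1(3,4) by simp
  also have "\<dots> = xs @ is" using 1(1,2) by simp
  finally have "P = xs @ (is @ js) @ ys'" using 1(3) by simp
  then show "code_at P l (is @ js)" unfolding code_at_def using 1(2) by blast
qed

lemma code_at_nth: "code_at P l is \<Longrightarrow> k < length is \<Longrightarrow> l + k < length P \<and> P ! (l + k) = is ! k"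
  unfolding code_at_def by (auto simp: nth_append)

lemma code_at_Cons: "code_at P l (i # is) \<longleftrightarrow> l < length P \<and> P ! l = i \<and> code_at P (Suc l) is"
proof -
  have "code_at P l (i # is) \<longleftrightarrow> code_at P l [i] \<and> code_at P (Suc l) is"
    using code_at_append[of P l "[i]" "is"] by simp
  moreover have "code_at P l [i] \<longleftrightarrow> l < length P \<and> P ! l = i"
  proof
    show "code_at P l [i] \<Longrightarrow> l < length P \<and> P ! l = i" using code_at_nth[of P l "[i]" 0] by simp
    assume "l < length P \<and> P ! l = i"
    then have "P = take l P @ [i] @ drop (Suc l) P" "length (take l P) = l" by (auto simp: id_take_nth_drop)
    then show "code_at P l [i]" unfolding code_at_def by blast
  qed
  ultimately show ?thesis by blast
qed

fun effect :: "instr \<Rightarrow> nmemory \<times> rmemory \<Rightarrow> nmemory \<times> rmemory" where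
  "effect (NConst a k) (N, R) = (N(a := k), R)"
| "effect (NAdd a b d) (N, R) = (N(a := N b + N d), R)"
| "effect (NSub a b d) (N, R) = (N(a := N b - N d), R)"
| "effect (NLoad a b) (N, R) = (N(a := N (N b)), R)"
| "effect (NStore a b) (N, R) = (N(N a := N b), R)"
| "effect (ROfNat a b) (N, R) = (N, R(a := real (N b)))"
| "effect (RAdd a b d) (N, R) = (N, R(a := R b + R d))"
| "effect (RSub a b d) (N, R) = (N, R(a := R b - R d))"
| "effect (RMul a b d) (N, R) = (N, R(a := R b * R d))"
| "effect (RDiv a b d) (N, R) = (N, R(a := R b / R d))"
| "effect (RPowr a b d) (N, R) = (N, R(a := \<bar>R b\<bar> powr R d))"
| "effect (RLoad a b) (N, R) = (N, R(a := R (N b)))"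
| "effect (RStore a b) (N, R) = (N, R(N a := R b))"
| "effect _ s = s"

fun plain :: "instr \<Rightarrow> bool" where
  "plain (NJumpLess a b l) = False"
| "plain (RJumpLess a b l) = False"
| "plain (Flip a) = False"
| "plain (Solve a b c) = False"
| "plain (Halt a) = False"
| "plain _ = True"

fun effects :: "instr list \<Rightarrow> nmemory \<times> rmemory \<Rightarrow> nmemory \<times> rmemory" where
  "effects [] s = s"
| "effects (i # is) s = effects is (effect i s)"

lemma effects_append: "effects (is @ js) s = effects js (effects is s)"
  by (induction "is" arbitrary: s) auto

lemma exec_plain:
  assumes "plain i"
  shows "exec A T i c = return_pmf (advance 1
    (c\<lparr>nmem := fst (effect i (nmem c, rmem c)), rmem := snd (effect i (nmem c, rmem c))\<rparr>))"
  using assms by (cases i) (simp_all add: set_n_def set_r_def)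

text \<open>Continuation style: whatever failure bound holds after the command, from every
  configuration satisfying \<open>Post\<close>, is inherited by its start at the cost of time
  \<open>t\<close>. Sequencing then needs no reasoning about distributions, and the command may
  stand at any address of any program.\<close>

definition triple :: "real mat \<Rightarrow> real \<Rightarrow> (nmemory \<Rightarrow> rmemory \<Rightarrow> bool) \<Rightarrow> com \<Rightarrow>
    (nmemory \<Rightarrow> rmemory \<Rightarrow> bool) \<Rightarrow> real \<Rightarrow> bool" where
  "triple A T Pre com Post t \<longleftrightarrow> (\<forall>P l F c t2 \<delta>.
     code_at P l (compile l com) \<longrightarrow> pc c = l \<longrightarrow> result c = None \<longrightarrow> Pre (nmem c) (rmem c) \<longrightarrow>
     (\<forall>c'. pc c' = l + com_len com \<longrightarrow> result c' = None \<longrightarrow> Post (nmem c') (rmem c') \<longrightarrow> reach A T P F c' t2 \<delta>) \<longrightarrow>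
     reach A T P F c (t + t2) \<delta>)"

lemma tripleI:
  assumes "\<And>P F c t2 \<delta>. code_at P (pc c) (compile (pc c) com) \<Longrightarrow> result c = None \<Longrightarrow> Pre (nmem c) (rmem c) \<Longrightarrow>
     (\<And>c'. pc c' = pc c + com_len com \<Longrightarrow> result c' = None \<Longrightarrow> Post (nmem c') (rmem c') \<Longrightarrow> reach A T P F c' t2 \<delta>) \<Longrightarrow>
     reach A T P F c (t + t2) \<delta>"
  shows "triple A T Pre com Post t"
  unfolding triple_def using assms by blast

lemma tripleD:
  assumes "triple A T Pre com Post t" "code_at P l (compile l com)" "pc c = l" "result c = None" "Pre (nmem c) (rmem c)"
    "\<And>c'. pc c' = l + com_len com \<Longrightarrow> result c' = None \<Longrightarrow> Post (nmem c') (rmem c') \<Longrightarrow> reach A T P F c' t2 \<delta>"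
    "t + t2 \<le> t'"
  shows "reach A T P F c t' \<delta>"
proof -
  have "reach A T P F c (t + t2) \<delta>" using assms(1-6) unfolding triple_def by blast
  then show ?thesis by (rule reach_mono) (use assms(7) in auto)
qed

lemma triple_code:
  assumes "list_all plain is"
  shows "triple A T (\<lambda>N R. Q (fst (effects is (N, R))) (snd (effects is (N, R)))) (Code is) Q (real (length is))"
proof (rule tripleI)
  fix P F and c :: config and t2 \<delta>
  assume "code_at P (pc c) (compile (pc c) (Code is))" "result c = None"
    "Q (fst (effects is (nmem c, rmem c))) (snd (effects is (nmem c, rmem c)))"
    and k: "\<And>c'. pc c' = pc c + com_len (Code is) \<Longrightarrow> result c' = None \<Longrightarrow> Q (nmem c') (rmem c') \<Longrightarrow> reach A T P F c' t2 \<delta>"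
  then show "reach A T P F c (real (length is) + t2) \<delta>"
    using assms
  proof (induction "is" arbitrary: c)
    case Nil
    then show ?case by simp
  next
    case (Cons i "is")
    let ?c = "advance 1 (c\<lparr>nmem := fst (effect i (nmem c, rmem c)), rmem := snd (effect i (nmem c, rmem c))\<rparr>)"
    have i: "pc c < length P" "P ! pc c = i" "code_at P (Suc (pc c)) is"
      using Cons.prems(1) by (simp_all add: code_at_Cons)
    have "reach A T P F ?c (real (length is) + t2) \<delta>"
    proof (rule Cons.IH)
      show "code_at P (pc ?c) (compile (pc ?c) (Code is))" using i by (simp add: advance_def)
      show "result ?c = None" using Cons.prems(2) by (simp add: advance_def)
      show "Q (fst (effects is (nmem ?c, rmem ?c))) (snd (effects is (nmem ?c, rmem ?c)))"
        using Cons.prems(3) by (simp add: advance_def)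
      show "list_all plain is" using Cons.prems by simp
      show "reach A T P F c' t2 \<delta>" if "pc c' = pc ?c + com_len (Code is)" "result c' = None" "Q (nmem c') (rmem c')" for c'
        using Cons.prems(4)[of c'] that by (simp add: advance_def)
    qed
    from reach_step[OF Cons.prems(2) i(1) _ _ this, of "real (length (i # is)) + t2"]
    show ?case using exec_plain[of i A T c] Cons.prems(5) i(2) by (simp add: advance_def)
  qed
qed

lemma triple_codeI:
  assumes "list_all plain is" "real (length is) \<le> t"
    "\<And>N R. Pre N R \<Longrightarrow> Q (fst (effects is (N, R))) (snd (effects is (N, R)))"
  shows "triple A T Pre (Code is) Q t"
proof (rule tripleI)
  fix P F and c :: config and t2 \<delta>
  assume a: "code_at P (pc c) (compile (pc c) (Code is))" "result c = None" "Pre (nmem c) (rmem c)"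
    "\<And>c'. pc c' = pc c + com_len (Code is) \<Longrightarrow> result c' = None \<Longrightarrow> Q (nmem c') (rmem c') \<Longrightarrow> reach A T P F c' t2 \<delta>"
  show "reach A T P F c (t + t2) \<delta>"
    by (rule tripleD[OF triple_code[OF assms(1), of A T Q] a(1) refl a(2) assms(3)[OF a(3)] a(4)])
      (use assms(2) in auto)
qed

lemma triple_seq:
  assumes "triple A T Pre c1 Mid t1" "triple A T Mid c2 Post t2" "t1 + t2 \<le> t"
  shows "triple A T Pre (c1 ;; c2) Post t"
proof (rule tripleI)
  fix P F and c :: config and s \<delta>
  assume a: "code_at P (pc c) (compile (pc c) (c1 ;; c2))" "result c = None" "Pre (nmem c) (rmem c)"
    and k: "\<And>c'. pc c' = pc c + com_len (c1 ;; c2) \<Longrightarrow> result c' = None \<Longrightarrow> Post (nmem c') (rmem c') \<Longrightarrow> reach A T P F c' s \<delta>"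
  have ca: "code_at P (pc c) (compile (pc c) c1)" "code_at P (pc c + com_len c1) (compile (pc c + com_len c1) c2)"
    using a(1) by (simp_all add: code_at_append)
  show "reach A T P F c (t + s) \<delta>"
  proof (rule tripleD[OF assms(1) ca(1) refl a(2,3)])
    fix c' :: config assume c': "pc c' = pc c + com_len c1" "result c' = None" "Mid (nmem c') (rmem c')"
    show "reach A T P F c' (t2 + s) \<delta>"
      by (rule tripleD[OF assms(2) ca(2) c' k]) (auto simp: add.assoc)
  qed (use assms(3) in auto)
qed

lemma triple_conseq:
  assumes "triple A T Pre com Post t" "\<And>N R. Pre' N R \<Longrightarrow> Pre N R" "\<And>N R. Post N R \<Longrightarrow> Post' N R" "t \<le> t'"
  shows "triple A T Pre' com Post' t'"
proof (rule tripleI)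
  fix P F and c :: config and s \<delta>
  assume a: "code_at P (pc c) (compile (pc c) com)" "result c = None" "Pre' (nmem c) (rmem c)"
    and k: "\<And>c'. pc c' = pc c + com_len com \<Longrightarrow> result c' = None \<Longrightarrow> Post' (nmem c') (rmem c') \<Longrightarrow> reach A T P F c' s \<delta>"
  show "reach A T P F c (t' + s) \<delta>"
    by (rule tripleD[OF assms(1) a(1) refl a(2) assms(2)[OF a(3)] k]) (use assms(3,4) in auto)
qed

lemma reach_njump:
  assumes "pc c < length P" "P ! pc c = NJumpLess a b l" "result c = None"
    "reach A T P F (c\<lparr>pc := (if nmem c a < nmem c b then l else Suc (pc c)), clock := clock c + 1\<rparr>) t \<delta>"
    "t + 1 \<le> t'"
  shows "reach A T P F c t' \<delta>"
  by (rule reach_step[OF assms(3,1) _ _ assms(4)]) (use assms(2,5) in \<open>simp_all add: jump_if_def advance_def\<close>)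

lemma reach_rjump:
  assumes "pc c < length P" "P ! pc c = RJumpLess a b l" "result c = None"
    "reach A T P F (c\<lparr>pc := (if rmem c a < rmem c b then l else Suc (pc c)), clock := clock c + 1\<rparr>) t \<delta>"
    "t + 1 \<le> t'"
  shows "reach A T P F c t' \<delta>"
  by (rule reach_step[OF assms(3,1) _ _ assms(4)]) (use assms(2,5) in \<open>simp_all add: jump_if_def advance_def\<close>)

lemma triple_do:
  assumes body: "\<And>k. k < m \<Longrightarrow> triple A T (I k) com (I (Suc k)) t"
    and cond: "\<And>k N R. I (Suc k) N R \<Longrightarrow> N a < N b \<longleftrightarrow> Suc k < m"
    and "0 < m" "0 \<le> t" "real m * (t + 1) \<le> t'"
  shows "triple A T (I 0) (DoLess a b com) (I m) t'"
proof (rule tripleI)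
  fix P F and c :: config and s \<delta>
  assume a: "code_at P (pc c) (compile (pc c) (DoLess a b com))" "result c = None" "I 0 (nmem c) (rmem c)"
    and k: "\<And>c'. pc c' = pc c + com_len (DoLess a b com) \<Longrightarrow> result c' = None \<Longrightarrow> I m (nmem c') (rmem c') \<Longrightarrow> reach A T P F c' s \<delta>"
  define l where "l = pc c"
  have ca: "code_at P l (compile l com)" "l + com_len com < length P" "P ! (l + com_len com) = NJumpLess a b l"
    using a(1) unfolding l_def by (simp_all add: code_at_append code_at_Cons)
  have "reach A T P F c (real (m - j) * (t + 1) + s) \<delta>"
    if "j < m" "pc c = l" "result c = None" "I j (nmem c) (rmem c)" for j c
    using that
  proof (induction "m - j" arbitrary: j c)
    case 0
    then show ?case by simp
  next
    case (Suc x)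
    have ms: "real (m - j) = real (m - Suc j) + 1" using Suc.prems(1) by linarith
    show ?case
    proof (rule tripleD[OF body[OF Suc.prems(1)] ca(1) Suc.prems(2-4), where ?t2.0 = "real (m - Suc j) * (t + 1) + s + 1"])
      fix c' :: config assume c': "pc c' = l + com_len com" "result c' = None" "I (Suc j) (nmem c') (rmem c')"
      let ?c = "c'\<lparr>pc := (if nmem c' a < nmem c' b then l else Suc (pc c')), clock := clock c' + 1\<rparr>"
      have "reach A T P F ?c (real (m - Suc j) * (t + 1) + s) \<delta>"
      proof (cases "Suc j < m")
        case True
        show ?thesis by (rule Suc.hyps(1)) (use Suc.hyps True c' cond[OF c'(3)] in auto)
      next
        case False
        then have "Suc j = m" using Suc.prems(1) by simp
        then show ?thesis using k[of ?c] c' cond[OF c'(3)] by (auto simp: l_def)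
      qed
      then show "reach A T P F c' (real (m - Suc j) * (t + 1) + s + 1) \<delta>"
        by (rule reach_njump[rotated 3]) (use c' ca in auto)
    qed (simp add: ms algebra_simps)
  qed
  from this[OF \<open>0 < m\<close> l_def[symmetric] a(2,3)]
  show "reach A T P F c (t' + s) \<delta>" by (rule reach_mono) (use assms(5) in auto)
qed

section \<open>Vector programs and their memory layout\<close>

datatype binop = Plus | Minus | Times | Divide | Power

fun binop_sem :: "binop \<Rightarrow> real \<Rightarrow> real \<Rightarrow> real" where
  "binop_sem Plus x y = x + y"
| "binop_sem Minus x y = x - y"
| "binop_sem Times x y = x * y"
| "binop_sem Divide x y = x / y"
| "binop_sem Power x y = \<bar>x\<bar> powr y"

fun binop_instr :: "binop \<Rightarrow> nat \<Rightarrow> nat \<Rightarrow> nat \<Rightarrow> instr" where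
  "binop_instr Plus = RAdd"
| "binop_instr Minus = RSub"
| "binop_instr Times = RMul"
| "binop_instr Divide = RDiv"
| "binop_instr Power = RPowr"

datatype exp =
    Const nat
  | Scal nat
  | Comp nat   \<comment> \<open>the current component of a vector\<close>
  | DimRow | DimCol | InQ | InEps
  | Bin binop exp exp

text \<open>Memory layout: the scalar variable \<open>a < 40\<close> is the real register \<open>2 * a\<close>, the evaluation stack
  occupies the even real registers from 80 to 198, the even natural registers below 40 are scratch, and
  the natural register \<open>40 + 2 * j\<close> points to the vector variable \<open>j < 16\<close>.\<close>

fun exp_code :: "nat \<Rightarrow> exp \<Rightarrow> instr list" where
  "exp_code k (Const c) = [NConst 4 c, ROfNat (80 + 2 * k) 4]"
| "exp_code k (Scal a) = [NConst 4 (2 * a), RLoad (80 + 2 * k) 4]"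
| "exp_code k (Comp j) = [NAdd 4 0 (40 + 2 * j), RLoad (80 + 2 * k) 4]"
| "exp_code k DimRow = [ROfNat (80 + 2 * k) 1]"
| "exp_code k DimCol = [ROfNat (80 + 2 * k) 3]"
| "exp_code k InQ = [NConst 4 1, RLoad (80 + 2 * k) 4]"
| "exp_code k InEps = [NConst 4 3, RLoad (80 + 2 * k) 4]"
| "exp_code k (Bin f e1 e2) = exp_code k e1 @ exp_code (Suc k) e2
     @ [binop_instr f (80 + 2 * k) (80 + 2 * k) (80 + 2 * Suc k)]"

fun exp_wf :: "nat \<Rightarrow> exp \<Rightarrow> bool" where
  "exp_wf k (Scal a) \<longleftrightarrow> k < 60 \<and> a < 40"
| "exp_wf k (Comp j) \<longleftrightarrow> k < 60 \<and> j < 16"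
| "exp_wf k (Bin f e1 e2) \<longleftrightarrow> exp_wf k e1 \<and> exp_wf (Suc k) e2"
| "exp_wf k _ \<longleftrightarrow> k < 60"

fun exp_scalar :: "exp \<Rightarrow> bool" where
  "exp_scalar (Comp j) = False"
| "exp_scalar (Bin f e1 e2) = (exp_scalar e1 \<and> exp_scalar e2)"
| "exp_scalar _ = True"

fun exp_nodes :: "exp \<Rightarrow> nat" where
  "exp_nodes (Bin f e1 e2) = exp_nodes e1 + exp_nodes e2 + 1"
| "exp_nodes _ = 1"

lemma length_exp_code: "length (exp_code k e) \<le> 2 * exp_nodes e"
  by (induction k e rule: exp_code.induct) auto

lemma plain_binop: "plain (binop_instr f a b c)"
  by (cases f) auto

lemma plain_exp_code: "list_all plain (exp_code k e)"
  by (induction k e rule: exp_code.induct) (auto simp: plain_binop)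

lemma effect_binop: "effect (binop_instr f a b c) (N, R) = (N, R(a := binop_sem f (R b) (R c)))"
  by (cases f) auto

type_synonym scalars = "nat \<Rightarrow> real"
type_synonym vectors = "nat \<Rightarrow> nat \<Rightarrow> real"

datatype prim =
    SAssign nat exp
  | VAssign nat exp
  | SSum nat nat
  | MatMul nat nat
  | TransMul nat nat
  | SolveGram nat nat nat
  | LoadRhs nat

fun vassign_code :: "nat \<Rightarrow> exp \<Rightarrow> com" where
  "vassign_code a e = Code [NConst 0 0, NConst 2 1] ;;
     DoLess 0 1 (Code (exp_code 0 e @ [NAdd 4 0 (40 + 2 * a), RStore 4 80, NAdd 0 0 2]))"

text \<open>One pass over the nonzero entries serves for the matrix and its transpose. Registers 6
  and 8 move through the addresses of row and column numbers, register 10 through those of the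
  values; \<open>x\<close> and \<open>y\<close> select which index is the target and which the
  source.\<close>

fun mul_code :: "nat \<Rightarrow> nat \<Rightarrow> nat \<Rightarrow> nat \<Rightarrow> com" where
  "mul_code x y a b = vassign_code a (Const 0) ;;
     Code [NConst 0 0, NConst 2 1, NConst 6 7, NConst 8 9, NConst 10 5, NConst 16 4, NConst 18 2] ;;
     DoLess 0 5 (Code [NLoad 12 x, NLoad 14 y, RLoad 80 10, NAdd 14 14 (40 + 2 * b), RLoad 82 14, RMul 80 80 82,
       NAdd 12 12 (40 + 2 * a), RLoad 82 12, RAdd 82 82 80, RStore 12 82,
       NAdd 6 6 16, NAdd 8 8 16, NAdd 10 10 18, NAdd 0 0 2])"

fun prim_code :: "prim \<Rightarrow> com" where
  "prim_code (SAssign a e) = Code (exp_code 0 e @ [NConst 4 (2 * a), RStore 4 80])"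
| "prim_code (VAssign a e) = vassign_code a e"
| "prim_code (SSum a b) = Code [NConst 0 0, NConst 2 1, ROfNat 80 0] ;;
     DoLess 0 1 (Code [NAdd 4 0 (40 + 2 * b), RLoad 82 4, RAdd 80 80 82, NAdd 0 0 2]) ;;
     Code [NConst 4 (2 * a), RStore 4 80]"
| "prim_code (MatMul a b) = mul_code 6 8 a b"
| "prim_code (TransMul a b) = mul_code 8 6 a b"
| "prim_code (SolveGram a b c) = Code [Solve (40 + 2 * a) (40 + 2 * b) (40 + 2 * c)]"
| "prim_code (LoadRhs a) = Code [NConst 0 0, NConst 2 1, NConst 8 2, NConst 6 5, NAdd 6 6 5, NAdd 6 6 5] ;;
     DoLess 0 1 (Code [RLoad 80 6, NAdd 4 0 (40 + 2 * a), RStore 4 80, NAdd 6 6 8, NAdd 0 0 2])"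

fun prims :: "prim list \<Rightarrow> com" where
  "prims [] = Code []"
| "prims (p # ps) = prim_code p ;; prims ps"

definition rand_code :: "nat \<Rightarrow> com" where
  "rand_code a = Code [NConst 0 0, NConst 2 1] ;;
     DoLess 0 1 (Code [Flip 6] ;;
       Code [ROfNat 80 6, ROfNat 82 2, RAdd 80 80 80, RSub 80 80 82, NAdd 4 0 (40 + 2 * a), RStore 4 80, NAdd 0 0 2])"

locale regression =
  fixes A :: "real mat" and b :: "real vec" and q \<epsilon> T :: real and n d :: nat
  assumes A: "A \<in> carrier_mat n d" and b: "b \<in> carrier_vec n" and d: "1 \<le> d" "d \<le> n"
    and rank: "vec_space.rank n A = d" and q: "1 < q" "q \<le> 2" and eps: "0 < \<epsilon>"
    and T: "real (nnz A + n) \<le> T"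
begin

abbreviation "es \<equiv> nonzero_entries A"

text \<open>Above the real input, which lies below \<open>5 + 2 * length es + 2 * n\<close>, and
  above the real scratch registers, which lie below 200.\<close>

definition base :: nat where "base = 2 * length es + 2 * n + 200"

definition sim :: "nmemory \<Rightarrow> rmemory \<Rightarrow> scalars \<Rightarrow> vectors \<Rightarrow> bool" where
  "sim N R S V \<longleftrightarrow> N 1 = n \<and> N 3 = d \<and> N 5 = length es \<and>
     (\<forall>e<length es. N (7 + 4 * e) = fst (es ! e) \<and> N (9 + 4 * e) = snd (es ! e) \<and> R (5 + 2 * e) = A $$ (es ! e)) \<and>
     R 1 = q \<and> R 3 = \<epsilon> \<and> (\<forall>i<n. R (5 + 2 * length es + 2 * i) = vec_index b i) \<and>
     (\<forall>j<16. N (40 + 2 * j) = base + j * n) \<and>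
     (\<forall>a<40. R (2 * a) = S a) \<and>
     (\<forall>j<16. \<forall>i<n. R (base + j * n + i) = V j i)"

lemma sim_scratch_nat: "sim N R S V \<Longrightarrow> even a \<Longrightarrow> a < 40 \<Longrightarrow> sim (N(a := x)) R S V"
  unfolding sim_def by (auto; presburger)

lemma sim_scratch_real: "sim N R S V \<Longrightarrow> even a \<Longrightarrow> 80 \<le> a \<Longrightarrow> a < 200 \<Longrightarrow> sim N (R(a := x)) S V"
  unfolding sim_def base_def by (auto; presburger)

lemma sim_scalar:
  assumes "sim N R S V" "a < 40"
  shows "sim N (R(2 * a := x)) (S(a := x)) V"
proof -
  have "5 + 2 * e \<noteq> 2 * a" "5 + 2 * length es + 2 * e \<noteq> 2 * a" "1 \<noteq> 2 * a" "3 \<noteq> 2 * a" for e by presburger+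
  moreover have "base + j * n + i \<noteq> 2 * a" for j i using assms(2) by (simp add: base_def)
  ultimately show ?thesis using assms(1) unfolding sim_def by simp
qed

lemma array_inj:
  assumes "i < n" "k < n" "base + j * n + i = base + m * n + (k::nat)"
  shows "j = m \<and> i = k"
proof -
  have e: "j * n + i = m * n + k" using assms(3) by simp
  have "j = m" using arg_cong[OF e, of "\<lambda>x. x div n"] assms(1,2) by simp
  with e show ?thesis by simp
qed

lemma sim_store:
  assumes "sim N R S V" "j < 16" "k < n"
  shows "sim N (R(base + j * n + k := x)) S (V(j := (V j)(k := x)))"
proof -
  let ?a = "base + j * n + k"
  have "5 + 2 * e \<noteq> ?a" if "e < length es" for e using that by (simp add: base_def)
  moreover have "5 + 2 * length es + 2 * i \<noteq> ?a" if "i < n" for i using that by (simp add: base_def)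
  moreover have "1 \<noteq> ?a" "3 \<noteq> ?a" by (simp_all add: base_def)
  moreover have "2 * a \<noteq> ?a" if "a < 40" for a using that by (simp add: base_def)
  moreover have "(R(?a := x)) (base + m * n + i) = (V(j := (V j)(k := x))) m i" if "m < 16" "i < n" for m i
    using assms that array_inj[of i k m j] by (auto simp: sim_def)
  ultimately show ?thesis using assms(1) unfolding sim_def by (simp only: fun_upd_other) auto
qed

lemma simD:
  assumes "sim N R S V"
  shows "N (Suc 0) = n" "N 3 = d" "N 5 = length es" "R (Suc 0) = q" "R 3 = \<epsilon>"
    "j < 16 \<Longrightarrow> N (40 + 2 * j) = base + j * n"
    "a < 40 \<Longrightarrow> R (2 * a) = S a"
    "j < 16 \<Longrightarrow> i < n \<Longrightarrow> R (base + j * n + i) = V j i"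
    "e < length es \<Longrightarrow> N (7 + 4 * e) = fst (es ! e)"
    "e < length es \<Longrightarrow> N (9 + 4 * e) = snd (es ! e)"
    "e < length es \<Longrightarrow> R (5 + 2 * e) = A $$ (es ! e)"
    "i < n \<Longrightarrow> R (5 + 2 * length es + 2 * i) = vec_index b i"
  using assms by (auto simp: sim_def)

fun exp_val :: "scalars \<Rightarrow> (nat \<Rightarrow> real) \<Rightarrow> exp \<Rightarrow> real" where
  "exp_val S v (Const c) = real c"
| "exp_val S v (Scal a) = S a"
| "exp_val S v (Comp j) = v j"
| "exp_val S v DimRow = real n"
| "exp_val S v DimCol = real d"
| "exp_val S v InQ = q"
| "exp_val S v InEps = \<epsilon>"
| "exp_val S v (Bin f e1 e2) = binop_sem f (exp_val S v e1) (exp_val S v e2)"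

text \<open>For the induction, the code has to preserve the stack below position \<open>k\<close>
  and all natural registers but 4: the second operand must destroy neither the value of the first
  nor the component index in register 0.\<close>

lemma exp_code_correct:
  assumes "sim N R S V" "exp_wf k e" "exp_scalar e \<or> N 0 < n" "effects (exp_code k e) (N, R) = (N', R')"
  shows "sim N' R' S V \<and> (\<forall>a. a \<noteq> 4 \<longrightarrow> N' a = N a) \<and> (\<forall>j<k. R' (80 + 2 * j) = R (80 + 2 * j)) \<and>
    R' (80 + 2 * k) = exp_val S (\<lambda>j. V j (N 0)) e"
  using assms
proof (induction k e arbitrary: N R N' R' rule: exp_code.induct)
  case (1 k c)
  then show ?case by (auto intro!: sim_scratch_nat sim_scratch_real)
next
  case (2 k a)
  then show ?case by (auto intro!: sim_scratch_nat sim_scratch_real simp: simD)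
next
  case (3 k j)
  then have "R (N 0 + (base + j * n)) = V j (N 0)" using simD(8)[of N R S V j "N 0"] by (simp add: ac_simps)
  with 3 show ?case by (auto intro!: sim_scratch_nat sim_scratch_real simp: simD)
next
  case (4 k)
  then show ?case by (auto intro!: sim_scratch_nat sim_scratch_real simp: simD)
next
  case (5 k)
  then show ?case by (auto intro!: sim_scratch_nat sim_scratch_real simp: simD)
next
  case (6 k)
  then show ?case by (auto intro!: sim_scratch_nat sim_scratch_real simp: simD)
next
  case (7 k)
  then show ?case by (auto intro!: sim_scratch_nat sim_scratch_real simp: simD)
next
  case (8 k f e1 e2)
  obtain N1 R1 where 1: "effects (exp_code k e1) (N, R) = (N1, R1)" by fastforce
  obtain N2 R2 where 2: "effects (exp_code (Suc k) e2) (N1, R1) = (N2, R2)" by fastforce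
  have i1: "sim N1 R1 S V \<and> (\<forall>a. a \<noteq> 4 \<longrightarrow> N1 a = N a) \<and> (\<forall>j<k. R1 (80 + 2 * j) = R (80 + 2 * j)) \<and>
    R1 (80 + 2 * k) = exp_val S (\<lambda>j. V j (N 0)) e1"
    by (rule "8.IH"(1)[OF "8.prems"(1) _ _ 1]) (use "8.prems"(2,3) in auto)
  have i2: "sim N2 R2 S V \<and> (\<forall>a. a \<noteq> 4 \<longrightarrow> N2 a = N1 a) \<and> (\<forall>j<Suc k. R2 (80 + 2 * j) = R1 (80 + 2 * j)) \<and>
    R2 (80 + 2 * Suc k) = exp_val S (\<lambda>j. V j (N1 0)) e2"
    by (rule "8.IH"(2)[OF _ _ _ 2]) (use "8.prems"(2,3) i1 in auto)
  have "exp_wf k' e \<Longrightarrow> k' < 60" for k' e by (induction k' e rule: exp_wf.induct) auto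
  from this[of "Suc k" e2] have k: "Suc k < 60" using "8.prems"(2) by simp
  have e: "N' = N2" "R' = R2(80 + 2 * k := binop_sem f (R2 (80 + 2 * k)) (R2 (80 + 2 * Suc k)))"
    using "8.prems"(4) 1 2 by (simp_all add: effects_append effect_binop)
  have 3: "R2 (80 + 2 * k) = exp_val S (\<lambda>j. V j (N 0)) e1" "R2 (80 + 2 * Suc k) = exp_val S (\<lambda>j. V j (N 0)) e2"
    using i1 i2 by simp_all
  have "sim N' R' S V" unfolding e using i2 k by (intro sim_scratch_real) auto
  moreover have "\<forall>a. a \<noteq> 4 \<longrightarrow> N' a = N a" unfolding e using i1 i2 by simp
  moreover have "\<forall>j<k. R' (80 + 2 * j) = R (80 + 2 * j)" unfolding e using i1 i2 by simp
  moreover have "R' (80 + 2 * k) = exp_val S (\<lambda>j. V j (N 0)) (Bin f e1 e2)" unfolding e using 3 by simp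
  ultimately show ?case by blast
qed

end

section \<open>Weighted normal equations\<close>

context regression begin

definition mulA :: "(nat \<Rightarrow> real) \<Rightarrow> nat \<Rightarrow> real" where
  "mulA x i = (\<Sum>j<d. A $$ (i, j) * x j)"

definition mulT :: "(nat \<Rightarrow> real) \<Rightarrow> nat \<Rightarrow> real" where
  "mulT y j = (\<Sum>i<n. A $$ (i, j) * y i)"

lemma mult_mat_vec_eq_mulA: "x \<in> carrier_vec d \<Longrightarrow> i < n \<Longrightarrow> vec_index (A *\<^sub>v x) i = mulA (vec_index x) i"
  using A by (auto simp: mulA_def scalar_prod_def atLeast0LessThan)

lemma mulT_mulA: "(\<Sum>j<d. mulT y j * x j) = (\<Sum>i<n. y i * mulA x i)"
  unfolding mulT_def mulA_def sum_distrib_left sum_distrib_right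
  by (subst sum.swap) (simp add: mult_ac)

lemma mulA_linear: "mulA (\<lambda>j. s * x j + t * y j) i = s * mulA x i + t * mulA y i"
  unfolding mulA_def sum_distrib_left sum.distrib[symmetric] by (rule sum.cong) (auto simp: algebra_simps)

lemma mulA_cong: "(\<And>j. j < d \<Longrightarrow> x j = y j) \<Longrightarrow> mulA x i = mulA y i"
  unfolding mulA_def by (rule sum.cong) auto

text \<open>Linear independence concerns the set of columns, so the columns must first be shown
  distinct: with a repetition, a maximal independent set of columns would have fewer than
  \<open>d\<close> elements.\<close>

lemma mult_mat_vec_inj:
  assumes x: "x \<in> carrier_vec d" and 0: "A *\<^sub>v x = 0\<^sub>v n"
  shows "x = 0\<^sub>v d"
proof -
  interpret vec_space "TYPE(real)" n .
  have dist: "distinct (cols A)"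
  proof (rule ccontr)
    assume nd: "\<not> distinct (cols A)"
    have ind: "{} \<subseteq> set (cols A) \<and> lin_indpt {}"
      by (simp add: lin_dep_def)
    obtain S where S: "maximal S (\<lambda>T. T \<subseteq> set (cols A) \<and> lin_indpt T)"
      using maximal_exists_superset[of "set (cols A)" "\<lambda>T. T \<subseteq> set (cols A) \<and> lin_indpt T" "{}"] ind
      by auto
    have "card S = d" using rank_card_indpt[OF A S] rank by simp
    moreover have "S \<subseteq> set (cols A)" using S by (simp add: maximal_def)
    then have "card S \<le> card (set (cols A))" by (simp add: card_mono)
    moreover have "card (set (cols A)) < length (cols A)"
      using nd card_length[of "cols A"] by (metis card_distinct nat_less_le)
    ultimately show False using A by simp
  qed
  show ?thesis
  proof (rule ccontr)
    assume "x \<noteq> 0\<^sub>v d"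
    then have "lin_dep (set (cols A))" using lin_depI[OF A x _ 0 dist] by simp
    then show False using full_rank_lin_indpt[OF A rank dist] by simp
  qed
qed

lemma mulA_inj:
  assumes "\<And>i. i < n \<Longrightarrow> mulA x i = 0" "j < d"
  shows "x j = 0"
proof -
  have "A *\<^sub>v vec d x = 0\<^sub>v n"
  proof (rule eq_vecI)
    fix i assume "i < dim_vec (0\<^sub>v n :: real vec)"
    then show "vec_index (A *\<^sub>v vec d x) i = vec_index (0\<^sub>v n) i"
      using assms(1)[of i] by (simp add: mult_mat_vec_eq_mulA) (simp add: mulA_def)
  qed (use A in simp)
  then have "vec d x = 0\<^sub>v d" by (intro mult_mat_vec_inj) auto
  then have "vec_index (vec d x) j = 0" using assms(2) by simp
  then show ?thesis using assms(2) by simp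
qed

text \<open>An injective matrix with at least one column is nonzero. This justifies loops over the
  entries that run their body before the first test.\<close>

lemma es_nonempty: "0 < length es"
proof (rule ccontr)
  assume "\<not> 0 < length es"
  then have "A $$ (i, j) = 0" if "i < n" "j < d" for i j
    using that A by (auto simp: nonzero_entries_def filter_empty_conv)
  then have "mulA (\<lambda>_. 1) i = 0" if "i < n" for i using that by (simp add: mulA_def)
  from mulA_inj[OF this, of 0] d show False by simp
qed

definition gram :: "(nat \<Rightarrow> real) \<Rightarrow> nat \<Rightarrow> nat \<Rightarrow> real" where
  "gram w j k = (\<Sum>i<n. A $$ (i, j) * w i * A $$ (i, k))"

lemma gram_mult: "(\<Sum>k<d. gram w j k * x k) = mulT (\<lambda>i. w i * mulA x i) j"
  unfolding gram_def mulT_def mulA_def sum_distrib_left sum_distrib_right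
  by (subst sum.swap) (simp add: mult_ac)

lemma weighted_gram_carrier: "weighted_gram A w \<in> carrier_mat d d"
  using A by (auto simp: weighted_gram_def)

lemma weighted_gram_index:
  assumes "w \<in> carrier_vec n" "j < d" "k < d"
  shows "weighted_gram A w $$ (j, k) = gram (vec_index w) j k"
proof -
  let ?X = "transpose_mat A * mat_diag n (vec_index w)"
  have X: "?X \<in> carrier_mat d n" using A by simp
  have "?X $$ (j, i) = A $$ (i, j) * w $ i" if "i < n" for i
    using mat_diag_mult_right[of "transpose_mat A" d n "vec_index w"] A that assms by simp
  then have x: "?X $$ (j, i) * A $$ (i, k) = A $$ (i, j) * w $ i * A $$ (i, k)" if "i < n" for i
    using that by simp
  have "weighted_gram A w $$ (j, k) = Matrix.row ?X j \<bullet> col A k"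
    unfolding weighted_gram_def using X A assms carrier_matD[OF A] carrier_matD[OF X] by (simp only: index_mult_mat)
  also have "\<dots> = (\<Sum>i<n. ?X $$ (j, i) * A $$ (i, k))"
    unfolding scalar_prod_def using carrier_matD[OF A] carrier_matD[OF X] assms
    by (auto simp: atLeast0LessThan simp del: index_mult_mat intro!: sum.cong)
  also have "\<dots> = gram (vec_index w) j k" unfolding gram_def using x by (intro sum.cong) auto
  finally show ?thesis .
qed

text \<open>Pairing a kernel vector \<open>x\<close> with its image gives a vanishing sum of
  \<open>w i * (mulA x i) ^ 2\<close>, so \<open>mulA x\<close> vanishes and injectivity
  applies.\<close>

lemma weighted_gram_inverse:
  assumes w: "w \<in> carrier_vec n" and pos: "\<And>i. i < n \<Longrightarrow> 0 < w $ i"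
  obtains B where "B \<in> carrier_mat d d" "B * weighted_gram A w = 1\<^sub>m d" "weighted_gram A w * B = 1\<^sub>m d"
proof -
  let ?M = "weighted_gram A w"
  have "x = 0\<^sub>v d" if x: "x \<in> carrier_vec d" and 0: "?M *\<^sub>v x = 0\<^sub>v d" for x
  proof -
    have "mulT (\<lambda>i. w $ i * mulA (vec_index x) i) j = 0" if "j < d" for j
    proof -
      have "0 = vec_index (?M *\<^sub>v x) j" using 0 that by simp
      also have "\<dots> = (\<Sum>k<d. gram (vec_index w) j k * x $ k)"
        using that x weighted_gram_carrier[of w] weighted_gram_index[OF w]
        by (auto simp: scalar_prod_def atLeast0LessThan intro!: sum.cong)
      finally show ?thesis by (simp add: gram_mult)
    qed
    then have "0 = (\<Sum>j<d. mulT (\<lambda>i. w $ i * mulA (vec_index x) i) j * x $ j)" by simp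
    also have "\<dots> = (\<Sum>i<n. w $ i * (mulA (vec_index x) i)\<^sup>2)"
      by (simp add: mulT_mulA power2_eq_square mult.assoc)
    finally have s: "(\<Sum>i<n. w $ i * (mulA (vec_index x) i)\<^sup>2) = 0" by simp
    have "mulA (vec_index x) i = 0" if "i < n" for i
    proof -
      have "w $ i * (mulA (vec_index x) i)\<^sup>2 = 0"
        using s that pos by (subst (asm) sum_nonneg_eq_0_iff) (auto simp: less_imp_le)
      then show ?thesis using pos[OF that] by simp
    qed
    then have "x $ j = 0" if "j < d" for j using mulA_inj[of "vec_index x"] that by blast
    then show ?thesis using x by auto
  qed
  then have "det ?M \<noteq> 0" using det_0_iff_vec_prod_zero_field[OF weighted_gram_carrier[of w]] by blast
  from det_non_zero_imp_unit[OF weighted_gram_carrier[of w] this, of "()"]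
  show ?thesis using that by (auto simp: Units_def ring_mat_simps)
qed

definition sol :: "(nat \<Rightarrow> real) \<Rightarrow> (nat \<Rightarrow> real) \<Rightarrow> nat \<Rightarrow> real" where
  "sol w v j = (if j < d then vec_index (solve_gram A (vec n w) (vec d v)) j else 0)"

lemma solve_gram_eq:
  assumes w: "w \<in> carrier_vec n" and pos: "\<And>i. i < n \<Longrightarrow> 0 < w $ i" and v: "v \<in> carrier_vec d"
    and B: "B \<in> carrier_mat d d" "B * weighted_gram A w = 1\<^sub>m d" "weighted_gram A w * B = 1\<^sub>m d"
  shows "solve_gram A w v = B *\<^sub>v v"
proof -
  let ?M = "weighted_gram A w"
  note M = weighted_gram_carrier[of w]
  have "?M *\<^sub>v (B *\<^sub>v v) = v" using assoc_mult_mat_vec[OF M B(1) v, symmetric] B(3) v by simp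
  moreover have "x = B *\<^sub>v v" if "x \<in> carrier_vec d" "?M *\<^sub>v x = v" for x
    using assoc_mult_mat_vec[OF B(1) M that(1)] B(2) that by simp
  ultimately show ?thesis unfolding solve_gram_def using A B(1) v
    by (intro the_equality) auto
qed

lemma solve_gram_carrier:
  assumes w: "w \<in> carrier_vec n" and pos: "\<And>i. i < n \<Longrightarrow> 0 < w $ i" and v: "v \<in> carrier_vec d"
  shows "solve_gram A w v \<in> carrier_vec d"
  using weighted_gram_inverse[OF w pos] solve_gram_eq[OF w pos v] v by (metis mult_mat_vec_carrier)

lemma sol_linear_form:
  assumes pos: "\<And>i. i < n \<Longrightarrow> 0 < w i"
  obtains B where
    "\<And>v j. j < d \<Longrightarrow> sol w v j = (\<Sum>k<d. B j k * v k)"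
    "\<And>j k. j < d \<Longrightarrow> k < d \<Longrightarrow> (\<Sum>l<d. B j l * gram w l k) = (if j = k then 1 else 0)"
    "\<And>j k. j < d \<Longrightarrow> k < d \<Longrightarrow> (\<Sum>l<d. gram w j l * B l k) = (if j = k then 1 else 0)"
proof -
  have w: "vec n w \<in> carrier_vec n" by simp
  have pos': "\<And>i. i < n \<Longrightarrow> 0 < vec n w $ i" using pos by simp
  have gc: "gram (vec_index (vec n w)) j k = gram w j k" for j k
    unfolding gram_def by (rule sum.cong) auto
  obtain B where B: "B \<in> carrier_mat d d" "B * weighted_gram A (vec n w) = 1\<^sub>m d" "weighted_gram A (vec n w) * B = 1\<^sub>m d"
    by (rule weighted_gram_inverse[OF w pos'])
  note M = weighted_gram_carrier[of "vec n w"]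
  show ?thesis
  proof (rule that[of "\<lambda>j k. B $$ (j, k)"])
    fix v j assume j: "j < d"
    have "solve_gram A (vec n w) (vec d v) = B *\<^sub>v vec d v" by (rule solve_gram_eq[OF w pos' _ B]) auto
    then show "sol w v j = (\<Sum>k<d. B $$ (j, k) * v k)"
      using j B(1) by (auto simp: sol_def scalar_prod_def atLeast0LessThan)
  next
    fix j k assume jk: "j < d" "k < d"
    have "(\<Sum>l<d. B $$ (j, l) * gram w l k) = (B * weighted_gram A (vec n w)) $$ (j, k)"
      using jk B(1) M weighted_gram_index[OF w] gc by (auto simp: scalar_prod_def atLeast0LessThan intro!: sum.cong)
    then show "(\<Sum>l<d. B $$ (j, l) * gram w l k) = (if j = k then 1 else 0)" using B(2) jk by simp
    have "(\<Sum>l<d. gram w j l * B $$ (l, k)) = (weighted_gram A (vec n w) * B) $$ (j, k)"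
      using jk B(1) M weighted_gram_index[OF w] gc by (auto simp: scalar_prod_def atLeast0LessThan intro!: sum.cong)
    then show "(\<Sum>l<d. gram w j l * B $$ (l, k)) = (if j = k then 1 else 0)" using B(3) jk by simp
  qed
qed

lemma mulT_sol:
  assumes pos: "\<And>i. i < n \<Longrightarrow> 0 < w i" and j: "j < d"
  shows "mulT (\<lambda>i. w i * mulA (sol w v) i) j = v j"
proof -
  obtain B where B: "\<And>v j. j < d \<Longrightarrow> sol w v j = (\<Sum>k<d. B j k * v k)"
    "\<And>j k. j < d \<Longrightarrow> k < d \<Longrightarrow> (\<Sum>l<d. B j l * gram w l k) = (if j = k then 1 else 0)"
    "\<And>j k. j < d \<Longrightarrow> k < d \<Longrightarrow> (\<Sum>l<d. gram w j l * B l k) = (if j = k then 1 else 0)"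
    by (rule sol_linear_form[where w = w]) (use pos in auto)
  have "mulT (\<lambda>i. w i * mulA (sol w v) i) j = (\<Sum>l<d. gram w j l * (\<Sum>k<d. B l k * v k))"
    unfolding gram_mult[symmetric] using B(1) by simp
  also have "\<dots> = (\<Sum>k<d. (\<Sum>l<d. gram w j l * B l k) * v k)"
    unfolding sum_distrib_left sum_distrib_right by (subst sum.swap) (simp add: mult_ac)
  also have "\<dots> = (\<Sum>k<d. (if j = k then 1 else 0) * v k)" using B(3) j by simp
  also have "\<dots> = (\<Sum>k<d. if j = k then v k else 0)" by (rule sum.cong) auto
  also have "\<dots> = v j" using j by simp
  finally show ?thesis .
qed

lemma sol_inner:
  assumes pos: "\<And>i. i < n \<Longrightarrow> 0 < w i"
  shows "(\<Sum>i<n. w i * mulA (sol w v) i * mulA x i) = (\<Sum>j<d. v j * x j)"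
  using mulT_mulA[of "\<lambda>i. w i * mulA (sol w v) i" x] mulT_sol[OF pos] by simp

text \<open>In other words, \<open>mulA (sol w (mulT g))\<close> is the orthogonal projection of
  \<open>g / w\<close> onto the range of the matrix, in the inner product with weights
  \<open>w\<close>.\<close>

lemma sol_mulT_inner:
  assumes pos: "\<And>i. i < n \<Longrightarrow> 0 < w i"
  shows "(\<Sum>i<n. w i * mulA (sol w (mulT g)) i * mulA x i) = (\<Sum>i<n. g i * mulA x i)"
  using sol_inner[OF pos] mulT_mulA by simp

text \<open>\<open>lev w i\<close> is \<open>a\<^sub>i\<^sup>T (A\<^sup>T W A)\<^sup>-\<^sup>1 a\<^sub>i\<close>, that is, the leverage score divided by the weight.\<close>

definition dir :: "(nat \<Rightarrow> real) \<Rightarrow> nat \<Rightarrow> nat \<Rightarrow> real" where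
  "dir w i = sol w (\<lambda>j. A $$ (i, j))"

definition lev :: "(nat \<Rightarrow> real) \<Rightarrow> nat \<Rightarrow> real" where
  "lev w i = mulA (dir w i) i"

context
  fixes w :: "nat \<Rightarrow> real"
  assumes pos: "\<And>i. i < n \<Longrightarrow> 0 < w i"
begin

text \<open>\<open>dir w i\<close> is the Riesz representer of evaluation at row \<open>i\<close> in
  the weighted inner product, and \<open>lev w i\<close> is its squared norm. The facts on leverage
  scores below rest on this and Cauchy-Schwarz.\<close>

lemma dir_inner: "(\<Sum>k<n. w k * mulA (dir w i) k * mulA x k) = mulA x i"
  unfolding dir_def using sol_inner[OF pos] by (simp add: mulA_def)

lemma lev_eq: "(\<Sum>k<n. w k * (mulA (dir w i) k)\<^sup>2) = lev w i"
  using dir_inner[of i "dir w i"] by (simp add: lev_def power2_eq_square mult.assoc)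

lemma lev_nonneg: "0 \<le> lev w i"
  unfolding lev_eq[symmetric] using pos by (intro sum_nonneg) (auto simp: less_imp_le)

lemma mulA_le_lev: "(mulA x i)\<^sup>2 \<le> lev w i * (\<Sum>k<n. w k * (mulA x k)\<^sup>2)"
proof -
  let ?f = "\<lambda>k. sqrt (w k) * mulA (dir w i) k" and ?g = "\<lambda>k. sqrt (w k) * mulA x k"
  have "w k * mulA (dir w i) k * mulA x k = ?f k * ?g k" if "k < n" for k
  proof -
    have "?f k * ?g k = (sqrt (w k) * sqrt (w k)) * mulA (dir w i) k * mulA x k" by (simp only: ac_simps)
    then show ?thesis using pos[OF that] by simp
  qed
  then have "mulA x i = (\<Sum>k<n. ?f k * ?g k)" unfolding dir_inner[of i x, symmetric] by (intro sum.cong) auto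
  then have "(mulA x i)\<^sup>2 \<le> (\<Sum>k<n. (?f k)\<^sup>2) * (\<Sum>k<n. (?g k)\<^sup>2)"
    using Cauchy_Schwarz_ineq_sum[of ?f ?g "{..<n}"] by simp
  moreover have "(\<Sum>k<n. (sqrt (w k) * mulA y k)\<^sup>2) = (\<Sum>k<n. w k * (mulA y k)\<^sup>2)" for y
    by (rule sum.cong) (use pos in \<open>auto simp: power_mult_distrib less_imp_le\<close>)
  ultimately show ?thesis by (simp add: lev_eq)
qed

text \<open>The term \<open>k = i\<close> of the sum in \<open>lev_eq\<close> is already
  \<open>w i * (lev w i) ^ 2\<close>.\<close>

lemma weight_lev_le_1:
  assumes "i < n"
  shows "w i * lev w i \<le> 1"
proof -
  have "w i * (lev w i)\<^sup>2 \<le> (\<Sum>k<n. w k * (mulA (dir w i) k)\<^sup>2)"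
    unfolding lev_def using assms pos
    by (intro member_le_sum[of i "{..<n}" "\<lambda>k. w k * (mulA (dir w i) k)\<^sup>2"]) (auto simp: less_imp_le)
  then have "w i * (lev w i)\<^sup>2 \<le> lev w i" by (simp only: lev_eq)
  then have "(w i * lev w i) * lev w i \<le> 1 * lev w i" by (simp add: power2_eq_square mult.assoc)
  then show ?thesis using lev_nonneg[of i] by (cases "lev w i = 0") (auto simp del: mult_1 simp: mult_le_cancel_right)
qed

text \<open>The sum is the trace of the inverse Gram matrix times the Gram matrix, that is, of the
  identity of size \<open>d\<close>.\<close>

lemma sum_weight_lev: "(\<Sum>i<n. w i * lev w i) = real d"
proof -
  obtain B where B: "\<And>v j. j < d \<Longrightarrow> sol w v j = (\<Sum>k<d. B j k * v k)"
    "\<And>j k. j < d \<Longrightarrow> k < d \<Longrightarrow> (\<Sum>l<d. B j l * gram w l k) = (if j = k then 1 else 0)"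
    "\<And>j k. j < d \<Longrightarrow> k < d \<Longrightarrow> (\<Sum>l<d. gram w j l * B l k) = (if j = k then 1 else 0)"
    by (rule sol_linear_form[where w = w]) (use pos in auto)
  have "(\<Sum>i<n. w i * lev w i) = (\<Sum>i<n. \<Sum>j<d. \<Sum>k<d. w i * A $$ (i, j) * B j k * A $$ (i, k))"
    unfolding lev_def mulA_def dir_def using B(1)
    by (simp add: sum_distrib_left mult.assoc)
  also have "\<dots> = (\<Sum>j<d. \<Sum>i<n. \<Sum>k<d. w i * A $$ (i, j) * B j k * A $$ (i, k))" by (rule sum.swap)
  also have "\<dots> = (\<Sum>j<d. \<Sum>k<d. \<Sum>i<n. w i * A $$ (i, j) * B j k * A $$ (i, k))"
    by (rule sum.cong[OF refl], rule sum.swap)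
  also have "\<dots> = (\<Sum>j<d. \<Sum>k<d. B j k * gram w k j)"
    unfolding gram_def sum_distrib_left by (intro sum.cong refl) (simp add: mult_ac)
  also have "\<dots> = (\<Sum>j<d. 1)" using B(2) by simp
  finally show ?thesis by simp
qed

end

text \<open>The representer for \<open>w'\<close> is inserted into the Cauchy-Schwarz bound for
  \<open>w\<close>; one factor \<open>lev w' i\<close> cancels.\<close>

lemma lev_mono:
  assumes "\<And>i. i < n \<Longrightarrow> 0 < w i" "\<And>i. i < n \<Longrightarrow> 0 < w' i" "\<And>i. i < n \<Longrightarrow> w i \<le> c * w' i" "0 \<le> c"
  shows "lev w' i \<le> c * lev w i"
proof -
  let ?p = "dir w' i"
  have "(lev w' i)\<^sup>2 \<le> lev w i * (\<Sum>k<n. w k * (mulA ?p k)\<^sup>2)"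
    unfolding lev_def[of w'] by (rule mulA_le_lev) (rule assms(1))
  also have "\<dots> \<le> lev w i * (\<Sum>k<n. c * (w' k * (mulA ?p k)\<^sup>2))"
    using assms(3) lev_nonneg[OF assms(1)]
    by (intro mult_left_mono sum_mono) (auto simp: mult.assoc[symmetric] intro: mult_right_mono)
  also have "\<dots> = (c * lev w i) * lev w' i"
    by (simp add: sum_distrib_left[symmetric] lev_eq[OF assms(2)])
  finally have "lev w' i * lev w' i \<le> (c * lev w i) * lev w' i" by (simp add: power2_eq_square)
  moreover have "0 \<le> lev w' i" "0 \<le> lev w i" using lev_nonneg[OF assms(2)] lev_nonneg[OF assms(1)] by auto
  ultimately show ?thesis using assms(4) by (cases "lev w' i = 0") (auto simp: mult_le_cancel_right)
qed

text \<open>Each coordinate of one solve with random signs is a Rademacher sum, and by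
  \<open>lev_eq\<close> the squares of its coefficients add up to \<open>lev w i\<close>. A single
  linear system thus samples the leverage of all rows at once.\<close>

lemma sol_signs:
  assumes "\<And>i. i < n \<Longrightarrow> 0 < w i"
  shows "mulA (sol w (mulT (\<lambda>k. sqrt (w k) * \<xi> k))) i = (\<Sum>k<n. (sqrt (w k) * mulA (dir w i) k) * \<xi> k)"
  using sol_mulT_inner[where w = w, OF assms, where g = "\<lambda>k. sqrt (w k) * \<xi> k" and x = "dir w i"] dir_inner[where w = w, OF assms, where i = i and x = "sol w (mulT (\<lambda>k. sqrt (w k) * \<xi> k))"]
  by (simp add: mult_ac)

end

section \<open>Correctness of the vector operations\<close>

context regression begin

lemma n_pos: "0 < n" using d by simp

lemma T_ge: "real (length es) + real n \<le> T" "1 \<le> T"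
  using T n_pos by (simp_all add: nnz_def)

lemma sim_cong:
  "sim N R S V \<Longrightarrow> (\<And>a. a < 40 \<Longrightarrow> S a = S' a) \<Longrightarrow> (\<And>j i. j < 16 \<Longrightarrow> i < n \<Longrightarrow> V j i = V' j i) \<Longrightarrow> sim N R S' V'"
  unfolding sim_def by simp

lemma sim_store':
  assumes "sim N R S V" "addr = base + j * n + k" "V' = V(j := (V j)(k := x))" "j < 16" "k < n"
  shows "sim N (R(addr := x)) S V'"
  using sim_store[OF assms(1,4,5)] assms(2,3) by simp

lemma vassign_correct:
  assumes "a < 16" "exp_wf 0 e" "exp_nodes e \<le> 100"
  shows "triple A T (\<lambda>N R. sim N R S V) (vassign_code a e)
    (\<lambda>N R. sim N R S (V(a := \<lambda>i. exp_val S (\<lambda>j. V j i) e))) (300 * T)"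
proof -
  let ?V = "\<lambda>k. V(a := \<lambda>i. if i < k then exp_val S (\<lambda>j. V j i) e else V a i)"
  define I where "I k N R \<longleftrightarrow> N 0 = k \<and> N 2 = 1 \<and> sim N R S (?V k)" for k N R
  let ?body = "exp_code 0 e @ [NAdd 4 0 (40 + 2 * a), RStore 4 80, NAdd 0 0 2]"
  have init: "triple A T (\<lambda>N R. sim N R S V) (Code [NConst 0 0, NConst 2 1]) (I 0) 2"
    by (rule triple_codeI) (auto simp: I_def intro!: sim_scratch_nat)
  have body: "triple A T (I k) (Code ?body) (I (Suc k)) 203" if k: "k < n" for k
  proof (rule triple_codeI)
    show "list_all plain ?body" using plain_exp_code by simp
    show "real (length ?body) \<le> 203" using length_exp_code[of 0 e] assms(3) by simp
    fix N R assume I: "I k N R"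
    obtain N1 R1 where e1: "effects (exp_code 0 e) (N, R) = (N1, R1)" by fastforce
    have 1: "sim N1 R1 S (?V k) \<and> (\<forall>a. a \<noteq> 4 \<longrightarrow> N1 a = N a) \<and> (\<forall>j<0. R1 (80 + 2 * j) = R (80 + 2 * j)) \<and>
        R1 (80 + 2 * 0) = exp_val S (\<lambda>j. ?V k j (N 0)) e"
      by (rule exp_code_correct[OF _ assms(2) _ e1]) (use I k in \<open>auto simp: I_def\<close>)
    \<comment> \<open>Component \<open>k\<close> of the target is still the old one, so the
      expression may mention the vector being assigned.\<close>
    have "(\<lambda>j. ?V k j k) = (\<lambda>j. V j k)" by auto
    with 1 I have 2: "sim N1 R1 S (?V k)" "N1 0 = k" "N1 2 = 1" "R1 80 = exp_val S (\<lambda>j. V j k) e"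
      by (auto simp: I_def)
    have "sim (N1(4 := k + (base + a * n), 0 := Suc k)) (R1(k + (base + a * n) := R1 80)) S (?V (Suc k))"
      by (intro sim_scratch_nat sim_store'[OF 2(1), where j = a and k = k])
        (use assms(1) k 2 in \<open>auto simp: fun_eq_iff less_Suc_eq\<close>)
    then show "I (Suc k) (fst (effects ?body (N, R))) (snd (effects ?body (N, R)))"
      using 2 simD(6)[OF 2(1) assms(1)] by (simp add: effects_append e1 I_def)
  qed
  have loop: "triple A T (I 0) (DoLess 0 1 (Code ?body)) (I n) (real n * 204)"
    by (rule triple_do[where I = I and m = n, OF body]) (auto simp: I_def n_pos simD)
  have fin: "sim N R S (V(a := \<lambda>i. exp_val S (\<lambda>j. V j i) e))" if "I n N R" for N R
  proof -
    have "sim N R S (?V n)" using that by (simp add: I_def)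
    then show ?thesis by (rule sim_cong) auto
  qed
  show ?thesis unfolding vassign_code.simps
    by (rule triple_seq[OF init triple_conseq[OF loop _ fin order_refl]]) (use T_ge in auto)
qed

lemma ssum_correct:
  assumes "a < 40" "b' < 16"
  shows "triple A T (\<lambda>N R. sim N R S V) (prim_code (SSum a b'))
    (\<lambda>N R. sim N R (S(a := \<Sum>i<n. V b' i)) V) (300 * T)"
proof -
  define I where "I k N R \<longleftrightarrow> N 0 = k \<and> N 2 = 1 \<and> R 80 = (\<Sum>i<k. V b' i) \<and> sim N R S V" for k N R
  let ?body = "[NAdd 4 0 (40 + 2 * b'), RLoad 82 4, RAdd 80 80 82, NAdd 0 0 2]"
  have init: "triple A T (\<lambda>N R. sim N R S V) (Code [NConst 0 0, NConst 2 1, ROfNat 80 0]) (I 0) 3"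
    by (rule triple_codeI) (auto simp: I_def intro!: sim_scratch_nat sim_scratch_real)
  have body: "triple A T (I k) (Code ?body) (I (Suc k)) 4" if k: "k < n" for k
  proof (rule triple_codeI)
    fix N R assume I: "I k N R"
    then have s: "sim N R S V" by (simp add: I_def)
    have "R (k + (base + b' * n)) = V b' k" using simD(8)[OF s assms(2) k] by (simp add: ac_simps)
    then show "I (Suc k) (fst (effects ?body (N, R))) (snd (effects ?body (N, R)))"
      using I simD(6)[OF s assms(2)] by (auto simp: I_def intro!: sim_scratch_nat sim_scratch_real)
  qed auto
  have loop: "triple A T (I 0) (DoLess 0 1 (Code ?body)) (I n) (real n * 5)"
    by (rule triple_do[where I = I and m = n, OF body]) (auto simp: I_def n_pos simD)
  have fin: "triple A T (I n) (Code [NConst 4 (2 * a), RStore 4 80]) (\<lambda>N R. sim N R (S(a := \<Sum>i<n. V b' i)) V) 2"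
  proof (rule triple_codeI)
    fix N R assume "I n N R"
    then have s: "sim N R S V" "R 80 = (\<Sum>i<n. V b' i)" by (simp_all add: I_def)
    have "sim (N(4 := 2 * a)) (R(2 * a := R 80)) (S(a := R 80)) V"
      by (intro sim_scratch_nat sim_scalar s assms) auto
    then show "sim (fst (effects [NConst 4 (2 * a), RStore 4 80] (N, R)))
        (snd (effects [NConst 4 (2 * a), RStore 4 80] (N, R))) (S(a := \<Sum>i<n. V b' i)) V"
      using s(2) by simp
  qed auto
  show ?thesis unfolding prim_code.simps
    by (rule triple_seq[OF init triple_seq[OF loop fin order_refl]]) (use T_ge in auto)
qed

lemma load_correct:
  assumes "a < 16"
  shows "triple A T (\<lambda>N R. sim N R S V) (prim_code (LoadRhs a))
    (\<lambda>N R. sim N R S (V(a := vec_index b))) (300 * T)"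
proof -
  let ?V = "\<lambda>k. V(a := \<lambda>i. if i < k then vec_index b i else V a i)"
  define I where "I k N R \<longleftrightarrow> N 0 = k \<and> N 2 = 1 \<and> N 8 = 2 \<and> N 6 = 5 + 2 * length es + 2 * k \<and> sim N R S (?V k)" for k N R
  let ?body = "[RLoad 80 6, NAdd 4 0 (40 + 2 * a), RStore 4 80, NAdd 6 6 8, NAdd 0 0 2]"
  have init: "triple A T (\<lambda>N R. sim N R S V)
      (Code [NConst 0 0, NConst 2 1, NConst 8 2, NConst 6 5, NAdd 6 6 5, NAdd 6 6 5]) (I 0) 6"
    by (rule triple_codeI) (auto simp: I_def simD intro!: sim_scratch_nat)
  have body: "triple A T (I k) (Code ?body) (I (Suc k)) 5" if k: "k < n" for k
  proof (rule triple_codeI)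
    fix N R assume I: "I k N R"
    then have s: "sim N R S (?V k)" by (simp add: I_def)
    have "sim (N(4 := k + (base + a * n), 6 := N 6 + 2, 0 := Suc k))
        (R(80 := vec_index b k, k + (base + a * n) := vec_index b k)) S (?V (Suc k))"
      by (intro sim_scratch_nat sim_store'[OF sim_scratch_real[OF s], where j = a and k = k])
        (use assms k in \<open>auto simp: fun_eq_iff less_Suc_eq\<close>)
    then show "I (Suc k) (fst (effects ?body (N, R))) (snd (effects ?body (N, R)))"
      using I simD(6)[OF s assms] simD(12)[OF s k] by (simp add: I_def)
  qed auto
  have loop: "triple A T (I 0) (DoLess 0 1 (Code ?body)) (I n) (real n * 6)"
    by (rule triple_do[where I = I and m = n, OF body]) (auto simp: I_def n_pos simD)
  have fin: "sim N R S (V(a := vec_index b))" if "I n N R" for N R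
  proof -
    have "sim N R S (?V n)" using that by (simp add: I_def)
    then show ?thesis by (rule sim_cong) auto
  qed
  show ?thesis unfolding prim_code.simps
    by (rule triple_seq[OF init triple_conseq[OF loop _ fin order_refl]]) (use T_ge in auto)
qed

lemma mul_correct:
  fixes r c :: "nat \<Rightarrow> nat"
  assumes xy: "(x = 6 \<and> y = 8 \<and> r = (\<lambda>e. fst (es ! e)) \<and> c = (\<lambda>e. snd (es ! e))) \<or>
      (x = 8 \<and> y = 6 \<and> r = (\<lambda>e. snd (es ! e)) \<and> c = (\<lambda>e. fst (es ! e)))"
    and ab: "a < 16" "b' < 16" "a \<noteq> b'"
    and rc: "\<And>e. e < length es \<Longrightarrow> r e < n" "\<And>e. e < length es \<Longrightarrow> c e < n"
  shows "triple A T (\<lambda>N R. sim N R S V) (mul_code x y a b')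
    (\<lambda>N R. sim N R S (V(a := \<lambda>i. \<Sum>e<length es. if r e = i then A $$ (es ! e) * V b' (c e) else 0))) (400 * T)"
proof -
  let ?V = "\<lambda>k. V(a := \<lambda>i. \<Sum>e<k. if r e = i then A $$ (es ! e) * V b' (c e) else 0)"
  define I where "I k N R \<longleftrightarrow> N 0 = k \<and> N 2 = 1 \<and> N 6 = 7 + 4 * k \<and> N 8 = 9 + 4 * k \<and> N 10 = 5 + 2 * k \<and>
    N 16 = 4 \<and> N 18 = 2 \<and> sim N R S (?V k)" for k N R
  let ?body = "[NLoad 12 x, NLoad 14 y, RLoad 80 10, NAdd 14 14 (40 + 2 * b'), RLoad 82 14, RMul 80 80 82,
       NAdd 12 12 (40 + 2 * a), RLoad 82 12, RAdd 82 82 80, RStore 12 82,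
       NAdd 6 6 16, NAdd 8 8 16, NAdd 10 10 18, NAdd 0 0 2]"
  have zero: "triple A T (\<lambda>N R. sim N R S V) (vassign_code a (Const 0)) (\<lambda>N R. sim N R S (?V 0)) (300 * T)"
    using vassign_correct[of a "Const 0" S V] ab by simp
  have init: "triple A T (\<lambda>N R. sim N R S (?V 0))
      (Code [NConst 0 0, NConst 2 1, NConst 6 7, NConst 8 9, NConst 10 5, NConst 16 4, NConst 18 2]) (I 0) 7"
    by (rule triple_codeI) (auto simp: I_def intro!: sim_scratch_nat)
  have body: "triple A T (I k) (Code ?body) (I (Suc k)) 14" if k: "k < length es" for k
  proof (rule triple_codeI)
    fix N R assume I: "I k N R"
    then have s: "sim N R S (?V k)" by (simp add: I_def)
    have xy': "N (N x) = r k" "N (N y) = c k" "x \<noteq> 12" "y \<noteq> 12" "x \<noteq> 14" "y \<noteq> 14"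
      using xy I simD(9,10)[OF s k] by (auto simp: I_def)
    have v: "R (5 + 2 * k) = A $$ (es ! k)" "R (c k + (base + b' * n)) = V b' (c k)"
      "R (r k + (base + a * n)) = ?V k a (r k)"
      using simD(11)[OF s k] simD(8)[OF s ab(2) rc(2)[OF k]] simD(8)[OF s ab(1) rc(1)[OF k]] ab(3)
      by (simp_all add: ac_simps)
    have p: "N (40 + 2 * b') = base + b' * n" "N (40 + 2 * a) = base + a * n" using simD(6)[OF s] ab by auto
    have ne: "80 \<noteq> c k + (base + b' * n)" "80 \<noteq> r k + (base + a * n)" "82 \<noteq> r k + (base + a * n)"
      by (simp_all add: base_def)
    have "?V (Suc k) = (?V k)(a := (?V k a)(r k := ?V k a (r k) + A $$ (es ! k) * V b' (c k)))"
      by (auto simp: fun_eq_iff)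
    note st = sim_store'[OF _ _ this ab(1) rc(1)[OF k], of _ _ _ "r k + (base + a * n)"]
    let ?w = "?V k a (r k) + A $$ (es ! k) * V b' (c k)"
    have J: "N 0 = k" "N 2 = 1" "N 6 = 7 + 4 * k" "N 8 = 9 + 4 * k" "N 10 = 5 + 2 * k" "N 16 = 4" "N 18 = 2"
      using I by (simp_all add: I_def)
    \<comment> \<open>Row and column numbers lie at odd addresses, so loading the first of them into
      scratch register 12 does not disturb the second load.\<close>
    have "odd (N y)" using xy J by auto
    then have ny: "N y \<noteq> 12" by auto
    have N': "fst (effects ?body (N, R)) = N(14 := c k + (base + b' * n), 12 := r k + (base + a * n),
        6 := 7 + 4 * Suc k, 8 := 9 + 4 * Suc k, 10 := 5 + 2 * Suc k, 0 := Suc k)"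
      using J xy' ny p by (auto simp: fun_eq_iff)
    have R': "snd (effects ?body (N, R)) = R(80 := A $$ (es ! k) * V b' (c k), 82 := ?w, r k + (base + a * n) := ?w)"
      using J xy' ny p v ne by (auto simp: fun_eq_iff)
    have "sim (fst (effects ?body (N, R))) (snd (effects ?body (N, R))) S (?V (Suc k))"
      unfolding N' R' by (intro sim_scratch_nat st sim_scratch_real s) auto
    moreover have "\<forall>a v. (a, v) \<in> {(0, Suc k), (2, 1), (6, 7 + 4 * Suc k), (8, 9 + 4 * Suc k), (10, 5 + 2 * Suc k), (16, 4), (18, 2)}
        \<longrightarrow> fst (effects ?body (N, R)) a = v"
      unfolding N' using J by simp
    ultimately show "I (Suc k) (fst (effects ?body (N, R))) (snd (effects ?body (N, R)))"
      unfolding I_def by blast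
  qed auto
  have loop: "triple A T (I 0) (DoLess 0 5 (Code ?body)) (I (length es)) (real (length es) * 15)"
    by (rule triple_do[where I = I and m = "length es", OF body]) (use es_nonempty in \<open>auto simp: I_def simD\<close>)
  have "triple A T (\<lambda>N R. sim N R S V) (mul_code x y a b') (I (length es)) (400 * T)"
    unfolding mul_code.simps
    by (rule triple_seq[OF zero triple_seq[OF init loop order_refl]]) (use T_ge in auto)
  then show ?thesis by (rule triple_conseq) (auto simp: I_def)
qed

end

section \<open>Random signs\<close>

text \<open>The mean over all sign patterns of length \<open>m\<close>, peeling off the first bit as
  the machine flips it first.\<close>

fun avg :: "nat \<Rightarrow> (bool list \<Rightarrow> real) \<Rightarrow> real" where
  "avg 0 f = f []"
| "avg (Suc m) f = (avg m (\<lambda>bs. f (False # bs)) + avg m (\<lambda>bs. f (True # bs))) / 2"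

definition sign :: "bool list \<Rightarrow> nat \<Rightarrow> real" where
  "sign bs i = (if bs ! i then 1 else - 1)"

lemma avg_mono: "(\<And>bs. length bs = m \<Longrightarrow> f bs \<le> g bs) \<Longrightarrow> avg m f \<le> avg m g"
proof (induction m arbitrary: f g)
  case (Suc m)
  have "avg m (\<lambda>bs. f (x # bs)) \<le> avg m (\<lambda>bs. g (x # bs))" for x
    by (rule Suc.IH) (simp add: Suc.prems)
  from this[of False] this[of True] show ?case by simp
qed simp

lemma avg_const [simp]: "avg m (\<lambda>_. c) = c"
  by (induction m) auto

lemma avg_add: "avg m (\<lambda>bs. f bs + g bs) = avg m f + avg m g"
  by (induction m arbitrary: f g) (auto simp: field_simps)

lemma avg_cmult: "avg m (\<lambda>bs. c * f bs) = c * avg m f"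
  by (induction m arbitrary: f) (auto simp: field_simps)

lemma avg_sum: "finite I \<Longrightarrow> avg m (\<lambda>bs. \<Sum>i\<in>I. f i bs) = (\<Sum>i\<in>I. avg m (f i))"
  by (induction I rule: finite_induct) (auto simp: avg_add)

lemma avg_Suc: "avg (Suc m) f = avg m (\<lambda>bs. (f (False # bs) + f (True # bs)) / 2)"
proof -
  have "avg m (\<lambda>bs. (f (False # bs) + f (True # bs)) / 2) = avg m (\<lambda>bs. (1/2) * (f (False # bs) + f (True # bs)))"
    by (rule arg_cong[where f = "avg m"]) auto
  then show ?thesis by (simp only: avg_cmult avg_add) simp
qed

definition rad :: "nat \<Rightarrow> (nat \<Rightarrow> real) \<Rightarrow> bool list \<Rightarrow> real" where
  "rad m c bs = (\<Sum>i<m. c i * sign bs i)"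

lemma rad_Cons: "rad (Suc m) c (x # bs) = (if x then c 0 else - c 0) + rad m (\<lambda>i. c (Suc i)) bs"
  unfolding rad_def by (subst sum.lessThan_Suc_shift) (auto simp: sign_def)

lemma avg_rad_2: "avg m (\<lambda>bs. (rad m c bs)\<^sup>2) = (\<Sum>i<m. (c i)\<^sup>2)"
proof (induction m arbitrary: c)
  case 0
  show ?case by (simp add: rad_def)
next
  case (Suc m)
  have e: "((rad (Suc m) c (False # bs))\<^sup>2 + (rad (Suc m) c (True # bs))\<^sup>2) / 2 = (c 0)\<^sup>2 + (rad m (\<lambda>i. c (Suc i)) bs)\<^sup>2" for bs
    by (simp add: rad_Cons power2_eq_square algebra_simps)
  show ?case unfolding avg_Suc e avg_add Suc.IH by (subst sum.lessThan_Suc_shift) simp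
qed

text \<open>Averaging over the first sign removes the odd powers of \<open>c 0\<close>; its fourth
  power is then enlarged to \<open>3 * (c 0) ^ 4\<close> in order to complete the square.\<close>

lemma avg_rad_4: "avg m (\<lambda>bs. (rad m c bs) ^ 4) \<le> 3 * (\<Sum>i<m. (c i)\<^sup>2)\<^sup>2"
proof (induction m arbitrary: c)
  case 0
  show ?case by (simp add: rad_def)
next
  case (Suc m)
  let ?c = "\<lambda>i. c (Suc i)"
  have e: "((rad (Suc m) c (False # bs)) ^ 4 + (rad (Suc m) c (True # bs)) ^ 4) / 2
      = (rad m ?c bs) ^ 4 + (6 * (c 0)\<^sup>2 * (rad m ?c bs)\<^sup>2 + (c 0) ^ 4)" for bs
    by (simp add: rad_Cons power2_eq_square power4_eq_xxxx algebra_simps)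
  have "avg (Suc m) (\<lambda>bs. (rad (Suc m) c bs) ^ 4) = avg m (\<lambda>bs. (rad m ?c bs) ^ 4) + (6 * (c 0)\<^sup>2 * (\<Sum>i<m. (?c i)\<^sup>2) + (c 0) ^ 4)"
    unfolding avg_Suc e avg_add avg_cmult avg_rad_2 by simp
  also have "\<dots> \<le> 3 * (\<Sum>i<m. (?c i)\<^sup>2)\<^sup>2 + (6 * (c 0)\<^sup>2 * (\<Sum>i<m. (?c i)\<^sup>2) + 3 * (c 0) ^ 4)"
  proof -
    have "0 \<le> (c 0) ^ 4" by simp
    then show ?thesis using Suc.IH[of ?c] by linarith
  qed
  also have "\<dots> = 3 * ((c 0)\<^sup>2 + (\<Sum>i<m. (?c i)\<^sup>2))\<^sup>2"
    by (simp add: power2_eq_square power4_eq_xxxx algebra_simps)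
  finally show ?case by (subst sum.lessThan_Suc_shift) simp
qed

text \<open>For nonnegative \<open>y\<close> the product of \<open>cosh y\<close> and
  \<open>exp (- (y ^ 2) / 2)\<close> is nonincreasing, because
  \<open>sinh y \<le> y * cosh y\<close>.\<close>

lemma exp_add_exp_le: "(exp (- x) + exp x) / 2 \<le> exp (x\<^sup>2 / 2)" for x :: real
proof -
  have nn: "(exp (- x) + exp x) / 2 \<le> exp (x\<^sup>2 / 2)" if x: "0 \<le> x" for x :: real
  proof -
    have sh: "exp y - exp (- y) \<le> 2 * y * ((exp y + exp (- y)) / 2)" if "0 \<le> y" for y :: real
    proof -
      let ?f = "\<lambda>y. y * (exp y + exp (- y)) - (exp y - exp (- y)) :: real"
      have "?f 0 \<le> ?f y"
      proof (rule DERIV_nonneg_imp_nondecreasing[OF that])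
        fix s :: real assume s: "0 \<le> s" "s \<le> y"
        have "(?f has_real_derivative s * (exp s - exp (- s))) (at s)"
          by (auto intro!: derivative_eq_intros simp: algebra_simps)
        moreover have "0 \<le> s * (exp s - exp (- s))" using s by (intro mult_nonneg_nonneg) auto
        ultimately show "\<exists>z. (?f has_real_derivative z) (at s) \<and> 0 \<le> z" by blast
      qed
      then show ?thesis by simp
    qed
    let ?g = "\<lambda>y. - ((exp y + exp (- y)) * exp (- (y\<^sup>2 / 2))) :: real"
    have "?g 0 \<le> ?g x"
    proof (rule DERIV_nonneg_imp_nondecreasing[OF x])
      fix s :: real assume s: "0 \<le> s" "s \<le> x"
      have "(?g has_real_derivative (s * (exp s + exp (- s)) - (exp s - exp (- s))) * exp (- (s\<^sup>2 / 2))) (at s)"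
        by (auto intro!: derivative_eq_intros simp: algebra_simps)
      moreover have "0 \<le> (s * (exp s + exp (- s)) - (exp s - exp (- s))) * exp (- (s\<^sup>2 / 2))"
        using sh[OF s(1)] by (intro mult_nonneg_nonneg) auto
      ultimately show "\<exists>z. (?g has_real_derivative z) (at s) \<and> 0 \<le> z" by blast
    qed
    then have "(exp x + exp (- x)) * exp (- (x\<^sup>2 / 2)) \<le> 2" by simp
    then have "(exp x + exp (- x)) * exp (- (x\<^sup>2 / 2)) * exp (x\<^sup>2 / 2) \<le> 2 * exp (x\<^sup>2 / 2)"
      by (intro mult_right_mono) auto
    moreover have "exp (- (x\<^sup>2 / 2)) * exp (x\<^sup>2 / 2) = 1" by (simp add: mult_exp_exp)
    ultimately show ?thesis by (simp add: mult.assoc)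
  qed
  show ?thesis
  proof (cases "0 \<le> x")
    case False
    then show ?thesis using nn[of "- x"] by (simp add: add.commute)
  qed (rule nn)
qed

lemma avg_exp_rad: "avg m (\<lambda>bs. exp (rad m c bs)) \<le> exp ((\<Sum>i<m. (c i)\<^sup>2) / 2)"
proof (induction m arbitrary: c)
  case 0
  show ?case by (simp add: rad_def)
next
  case (Suc m)
  let ?c = "\<lambda>i. c (Suc i)"
  have e: "(exp (rad (Suc m) c (False # bs)) + exp (rad (Suc m) c (True # bs))) / 2
      = ((exp (- c 0) + exp (c 0)) / 2) * exp (rad m ?c bs)" for bs
    by (simp only: rad_Cons exp_add if_True if_False) (simp add: algebra_simps)
  have "avg (Suc m) (\<lambda>bs. exp (rad (Suc m) c bs)) = ((exp (- c 0) + exp (c 0)) / 2) * avg m (\<lambda>bs. exp (rad m ?c bs))"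
    unfolding avg_Suc e avg_cmult ..
  also have "\<dots> \<le> exp ((c 0)\<^sup>2 / 2) * exp ((\<Sum>i<m. (?c i)\<^sup>2) / 2)"
  proof (rule mult_mono[OF exp_add_exp_le Suc.IH])
    have "avg m (\<lambda>_. 0) \<le> avg m (\<lambda>bs. exp (rad m ?c bs))" by (rule avg_mono) simp
    then show "0 \<le> avg m (\<lambda>bs. exp (rad m ?c bs))" by simp
  qed simp
  also have "\<dots> = exp (((c 0)\<^sup>2 + (\<Sum>i<m. (?c i)\<^sup>2)) / 2)" by (simp add: exp_add[symmetric] add_divide_distrib)
  finally show ?case by (subst sum.lessThan_Suc_shift) simp
qed

lemma rad_zero: "(\<Sum>i<m. (c i)\<^sup>2) = 0 \<Longrightarrow> rad m c bs = 0"
  unfolding rad_def by (subst (asm) sum_nonneg_eq_0_iff) auto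

text \<open>Paley--Zygmund in the form of a pointwise quadratic minorant of the indicator function.\<close>

lemma rad_small_prob:
  "avg m (\<lambda>bs. if (rad m c bs)\<^sup>2 < (\<Sum>i<m. (c i)\<^sup>2) / 2 then 1 else 0) \<le> 9 / 10"
proof (cases "(\<Sum>i<m. (c i)\<^sup>2) = 0")
  case True
  then show ?thesis using rad_zero[OF True] by simp
next
  case False
  define s where "s = (\<Sum>i<m. (c i)\<^sup>2)"
  have s: "0 < s" using False sum_nonneg[of "{..<m}" "\<lambda>i. (c i)\<^sup>2"] unfolding s_def by (simp add: less_le)
  \<comment> \<open>With \<open>y = x ^ 2 / s\<close> the right-hand side is
    \<open>(y - 6) ^ 2 / 30\<close>: nonnegative, and above 1 for \<open>y < 1/2\<close>. As
    \<open>y\<close> has mean 1 and second moment at most 3, its mean is at most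
    \<open>6/5 - 2/5 + 1/10 = 9/10\<close>.\<close>
  have pw: "(if x\<^sup>2 < s / 2 then 1 else 0) \<le> 6/5 + (- (2/5) / s) * x\<^sup>2 + (1 / (30 * s\<^sup>2)) * x ^ 4" for x
  proof -
    define y where "y = x\<^sup>2 / s"
    have y: "0 \<le> y" "x\<^sup>2 = y * s" using s by (auto simp: y_def)
    have "x ^ 4 = (y * s)\<^sup>2" unfolding y(2)[symmetric] by (simp flip: power_mult)
    then have r: "6/5 + (- (2/5) / s) * x\<^sup>2 + (1 / (30 * s\<^sup>2)) * x ^ 4 = 6/5 - (2/5) * y + y\<^sup>2 / 30"
      using s y by (simp add: power_mult_distrib)
    show ?thesis
    proof (cases "x\<^sup>2 < s / 2")
      case True
      then have "y < 1/2" using s by (simp add: y_def divide_less_eq)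
      moreover have "0 \<le> y\<^sup>2 / 30" by simp
      ultimately have "1 \<le> 6/5 - (2/5) * y + y\<^sup>2 / 30" by linarith
      then show ?thesis unfolding r using True by simp
    next
      case False
      have "0 \<le> (y - 6)\<^sup>2" by simp
      then have "0 \<le> 6/5 - (2/5) * y + y\<^sup>2 / 30" by (simp add: power2_eq_square algebra_simps)
      then show ?thesis unfolding r using False by simp
    qed
  qed
  have "avg m (\<lambda>bs. if (rad m c bs)\<^sup>2 < s / 2 then 1 else 0)
      \<le> avg m (\<lambda>bs. 6/5 + (- (2/5) / s) * (rad m c bs)\<^sup>2 + (1 / (30 * s\<^sup>2)) * (rad m c bs) ^ 4)"
    by (rule avg_mono) (rule pw)
  also have "\<dots> = 6/5 + (- (2/5) / s) * s + (1 / (30 * s\<^sup>2)) * avg m (\<lambda>bs. (rad m c bs) ^ 4)"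
    unfolding avg_add avg_cmult avg_rad_2 s_def by simp
  also have "\<dots> \<le> 6/5 + (- (2/5) / s) * s + (1 / (30 * s\<^sup>2)) * (3 * s\<^sup>2)"
    using avg_rad_4[of m c] s by (intro add_left_mono mult_left_mono) (auto simp: s_def)
  also have "\<dots> = 9 / 10" using s by simp
  finally show ?thesis unfolding s_def .
qed

lemma rad_large_prob:
  assumes "0 < \<rho>"
  shows "avg m (\<lambda>bs. if \<rho> * (\<Sum>i<m. (c i)\<^sup>2) < (rad m c bs)\<^sup>2 then 1 else 0) \<le> 2 * exp (- \<rho> / 2)"
proof (cases "(\<Sum>i<m. (c i)\<^sup>2) = 0")
  case True
  then show ?thesis using rad_zero[OF True] by simp
next
  case False
  define s where "s = (\<Sum>i<m. (c i)\<^sup>2)"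
  have s: "0 < s" using False sum_nonneg[of "{..<m}" "\<lambda>i. (c i)\<^sup>2"] unfolding s_def by (simp add: less_le)
  \<comment> \<open>The optimal Chernoff parameter: on the event \<open>\<bar>t * x\<bar>\<close> is
    at least \<open>\<rho>\<close>, while the exponential moment is at most
    \<open>exp (\<rho> / 2)\<close>, so \<open>exp (- \<rho> / 2)\<close> remains for each of the
    two tails.\<close>
  define t where "t = sqrt (\<rho> / s)"
  have t: "0 < t" "t\<^sup>2 * s = \<rho>" using s assms by (simp_all add: t_def)
  have rs: "t * rad m c bs = rad m (\<lambda>i. t * c i) bs" "- t * rad m c bs = rad m (\<lambda>i. - t * c i) bs" for bs
    by (simp_all add: rad_def sum_distrib_left mult.assoc sum_negf)
  have pw: "(if \<rho> * s < x\<^sup>2 then 1 else 0) \<le> exp (- \<rho>) * (exp (t * x) + exp (- t * x))" for x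
  proof (cases "\<rho> * s < x\<^sup>2")
    case True
    then have 1: "t\<^sup>2 * (\<rho> * s) < t\<^sup>2 * x\<^sup>2" using t(1) by (intro mult_strict_left_mono) auto
    have 2: "t\<^sup>2 * (\<rho> * s) = \<rho> * (t\<^sup>2 * s)" by (simp only: ac_simps)
    have "\<rho>\<^sup>2 < (t * x)\<^sup>2"
      using 1 unfolding 2 t(2) by (simp only: power_mult_distrib power2_eq_square[of \<rho>])
    then have "\<rho> \<le> \<bar>t * x\<bar>" using abs_le_square_iff[of \<rho> "t * x"] assms by simp
    then have "exp \<rho> \<le> exp (t * x) + exp (- t * x)"
    proof (cases "0 \<le> t * x")
      case True
      then have "exp \<rho> \<le> exp (t * x)" using \<open>\<rho> \<le> \<bar>t * x\<bar>\<close> by simp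
      then show ?thesis using exp_ge_zero[of "- t * x"] by linarith
    next
      case False
      then have "exp \<rho> \<le> exp (- t * x)" using \<open>\<rho> \<le> \<bar>t * x\<bar>\<close> by simp
      then show ?thesis using exp_ge_zero[of "t * x"] by linarith
    qed
    then have "exp (- \<rho>) * exp \<rho> \<le> exp (- \<rho>) * (exp (t * x) + exp (- t * x))" by (intro mult_left_mono) auto
    then show ?thesis using True by (simp add: mult_exp_exp)
  next
    case False
    then show ?thesis by (simp add: add_nonneg_nonneg)
  qed
  have sq: "(\<Sum>i<m. (t * c i)\<^sup>2) = \<rho>" "(\<Sum>i<m. (- t * c i)\<^sup>2) = \<rho>"
    using t(2) by (simp_all add: power_mult_distrib sum_distrib_left[symmetric] s_def)
  have "avg m (\<lambda>bs. if \<rho> * s < (rad m c bs)\<^sup>2 then 1 else 0)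
      \<le> avg m (\<lambda>bs. exp (- \<rho>) * (exp (t * rad m c bs) + exp (- t * rad m c bs)))"
    by (rule avg_mono) (rule pw)
  also have "\<dots> = exp (- \<rho>) * (avg m (\<lambda>bs. exp (rad m (\<lambda>i. t * c i) bs)) + avg m (\<lambda>bs. exp (rad m (\<lambda>i. - t * c i) bs)))"
    unfolding avg_cmult avg_add rs ..
  also have "\<dots> \<le> exp (- \<rho>) * (exp (\<rho> / 2) + exp (\<rho> / 2))"
    using avg_exp_rad[of m "\<lambda>i. t * c i"] avg_exp_rad[of m "\<lambda>i. - t * c i"] sq
    by (intro mult_left_mono add_mono) auto
  also have "\<dots> = 2 * exp (- \<rho> / 2)" by (simp add: distrib_left mult_exp_exp)
  finally show ?thesis unfolding s_def .
qed

section \<open>Accelerated gradient descent in one coordinate\<close>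

text \<open>Nesterov's energy argument works row by row, since objective, quadratic form and energy
  are sums over rows. Only the last bracket on the right has no sign for a single row; it is the
  defect of \<open>v'\<close> as a gradient step and vanishes after summation.\<close>

lemma agd_coordinate:
  fixes \<psi> :: "real \<Rightarrow> real"
  assumes th: "\<theta> = 2 / (real j + 2)" and y: "y = (1 - \<theta>) * x + \<theta> * v" and x': "x' = (1 - \<theta>) * x + \<theta> * v'"
    and smooth: "\<psi> x' \<le> \<psi> y + g * (x' - y) + w / 2 * (x' - y)\<^sup>2"
    and cx: "\<psi> y + g * (x - y) \<le> \<psi> x" and cs: "\<psi> y + g * (s - y) \<le> \<psi> s" and w: "0 \<le> w"
  shows "(real j + 1) * (real j + 2) / 4 * (\<psi> x' - \<psi> s) + w / 2 * (s - v')\<^sup>2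
    \<le> real j * (real j + 1) / 4 * (\<psi> x - \<psi> s) + w / 2 * (s - v)\<^sup>2
      + ((real j + 1) / 2 * g * (v' - s) - w * (v - v') * (v' - s))"
proof -
  \<comment> \<open>The relations \<open>a' * \<theta> = \<alpha>\<close> and
    \<open>a' * (1 - \<theta>) = a\<close> make the first-order terms at \<open>x\<close> and
    \<open>v\<close> cancel at \<open>y\<close>; \<open>\<alpha> * \<theta> \<le> 1\<close> lets the
    term in \<open>(v' - v) ^ 2\<close> pay for the curvature.\<close>
  define a' a \<alpha> where "a' = (real j + 1) * (real j + 2) / 4" and "a = real j * (real j + 1) / 4" and "\<alpha> = (real j + 1) / 2"
  have j2: "real j + 2 \<noteq> 0" by linarith
  have th1: "\<theta> * (real j + 2) = 2" unfolding th using j2 by (rule nonzero_eq_divide_eq[THEN iffD1, OF _ refl])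
  have "a' * \<theta> = (real j + 1) * (\<theta> * (real j + 2)) / 4" by (simp add: a'_def)
  then have A: "a' * \<theta> = \<alpha>" unfolding th1 by (simp add: \<alpha>_def)
  have aa: "a' - \<alpha> = a" by (simp add: a'_def a_def \<alpha>_def field_simps)
  have A2: "a' * (1 - \<theta>) = a" using A aa by (simp add: algebra_simps)
  have at: "\<alpha> * \<theta> \<le> 1" unfolding \<alpha>_def th by (simp add: field_simps)
  have nn: "0 \<le> a'" "0 \<le> a" "0 \<le> \<alpha>" by (auto simp: a'_def a_def \<alpha>_def)
  have d: "x' - y = \<theta> * (v' - v)" unfolding x' y by (simp add: algebra_simps)
  have "a' * \<psi> x' \<le> a' * (\<psi> y + g * (x' - y) + w / 2 * (x' - y)\<^sup>2)"
    using smooth nn(1) by (rule mult_left_mono)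
  also have "\<dots> = a' * \<psi> y + a' * \<theta> * (g * (v' - v)) + (a' * \<theta>) * \<theta> * (w / 2 * (v' - v)\<^sup>2)"
    unfolding d by (simp add: power2_eq_square algebra_simps)
  also have "\<dots> \<le> a' * \<psi> y + \<alpha> * (g * (v' - v)) + w / 2 * (v' - v)\<^sup>2"
    unfolding A using mult_right_mono[OF at, of "w / 2 * (v' - v)\<^sup>2"] w by simp
  finally have 1: "a' * \<psi> x' \<le> a' * \<psi> y + \<alpha> * (g * (v' - v)) + w / 2 * (v' - v)\<^sup>2" .
  have 2: "a * (\<psi> y + g * (x - y)) \<le> a * \<psi> x" using cx nn(2) by (rule mult_left_mono)
  have 3: "\<alpha> * (\<psi> y + g * (s - y)) \<le> \<alpha> * \<psi> s" using cs nn(3) by (rule mult_left_mono)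
  have "a * (x - y) + \<alpha> * (v - y) = 0"
  proof -
    have "a * (x - y) + \<alpha> * (v - y) = a' * ((1 - \<theta>) * x + \<theta> * v - y)"
      unfolding A2[symmetric] A[symmetric] by (simp add: algebra_simps)
    then show ?thesis using y by simp
  qed
  then have "g * (a * (x - y) + \<alpha> * (v - y)) = 0" by simp
  then have 4: "a * (g * (x - y)) + \<alpha> * (g * (v - y)) = 0" by (simp add: algebra_simps)
  have 5: "w / 2 * (v' - v)\<^sup>2 = w / 2 * (s - v)\<^sup>2 - w / 2 * (s - v')\<^sup>2 - w * (v - v') * (v' - s)"
    by (simp add: power2_eq_square algebra_simps)
  have 6: "\<alpha> * (g * (v' - v)) = \<alpha> * g * (v' - s) + \<alpha> * (g * (s - y)) - \<alpha> * (g * (v - y))"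
    by (simp add: algebra_simps)
  have 7: "a' * \<psi> y = a * \<psi> y + \<alpha> * \<psi> y" "a' * \<psi> s = a * \<psi> s + \<alpha> * \<psi> s" using aa by (simp_all add: algebra_simps)
  have 8: "a * (\<psi> y + g * (x - y)) = a * \<psi> y + a * (g * (x - y))" "\<alpha> * (\<psi> y + g * (s - y)) = \<alpha> * \<psi> y + \<alpha> * (g * (s - y))"
    by (simp_all add: algebra_simps)
  have arith: "P - Ps + W3 \<le> X - Xs + W2 + (e4 - W4)"
    if "P \<le> Y + e1 + W1" "Ya + e2 \<le> X" "Yb + e3 \<le> Sb" "e2 + e5 = 0" "W1 = W2 - W3 - W4" "e1 = e4 + e3 - e5"
      "Y = Ya + Yb" "Ps = Xs + Sb" for P Ps W1 W2 W3 W4 X Xs e1 e2 e3 e4 e5 Y Ya Yb Sb :: real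
    using that by linarith
  have 9: "a' * (\<psi> x' - \<psi> s) = a' * \<psi> x' - a' * \<psi> s" "a * (\<psi> x - \<psi> s) = a * \<psi> x - a * \<psi> s"
    by (rule right_diff_distrib)+
  have "a' * (\<psi> x' - \<psi> s) + w / 2 * (s - v')\<^sup>2 \<le> a * (\<psi> x - \<psi> s) + w / 2 * (s - v)\<^sup>2
      + (\<alpha> * g * (v' - s) - w * (v - v') * (v' - s))"
    unfolding 9 by (rule arith[OF 1 2[unfolded 8(1)] 3[unfolded 8(2)] 4 5 6 7])
  then show ?thesis by (simp only: a'_def a_def \<alpha>_def)
qed

section \<open>Quantitative weakest preconditions\<close>

context regression begin

text \<open>Vectors of dimension \<open>d\<close> are stored in arrays of length \<open>n\<close>, of which only the first \<open>d\<close>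
  components matter.\<close>

fun prim_sem :: "prim \<Rightarrow> scalars \<times> vectors \<Rightarrow> scalars \<times> vectors" where
  "prim_sem (SAssign a e) (S, V) = (S(a := exp_val S (\<lambda>_. 0) e), V)"
| "prim_sem (VAssign a e) (S, V) = (S, V(a := \<lambda>i. exp_val S (\<lambda>j. V j i) e))"
| "prim_sem (SSum a b') (S, V) = (S(a := \<Sum>i<n. V b' i), V)"
| "prim_sem (MatMul a b') (S, V) = (S, V(a := mulA (V b')))"
| "prim_sem (TransMul a b') (S, V) = (S, V(a := \<lambda>j. if j < d then mulT (V b') j else 0))"
| "prim_sem (SolveGram a b' c) (S, V) = (S, V(c := \<lambda>j. if j < d then sol (V a) (V b') j else V c j))"
| "prim_sem (LoadRhs a) (S, V) = (S, V(a := vec_index b))"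

fun prim_ok :: "prim \<Rightarrow> scalars \<times> vectors \<Rightarrow> bool" where
  "prim_ok (SAssign a e) s \<longleftrightarrow> a < 40 \<and> exp_wf 0 e \<and> exp_scalar e \<and> exp_nodes e \<le> 100"
| "prim_ok (VAssign a e) s \<longleftrightarrow> a < 16 \<and> exp_wf 0 e \<and> exp_nodes e \<le> 100"
| "prim_ok (SSum a b') s \<longleftrightarrow> a < 40 \<and> b' < 16"
| "prim_ok (MatMul a b') s \<longleftrightarrow> a < 16 \<and> b' < 16 \<and> a \<noteq> b'"
| "prim_ok (TransMul a b') s \<longleftrightarrow> a < 16 \<and> b' < 16 \<and> a \<noteq> b'"
| "prim_ok (SolveGram a b' c) s \<longleftrightarrow> a < 16 \<and> b' < 16 \<and> c < 16 \<and> (\<forall>i<n. 0 < snd s a i)"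
| "prim_ok (LoadRhs a) s \<longleftrightarrow> a < 16"

lemma es_sum:
  "(\<Sum>e<length es. g (es ! e)) = (\<Sum>i<n. \<Sum>j<d. if A $$ (i, j) = 0 then 0 else g (i, j))"
proof -
  have dist: "distinct es" unfolding nonzero_entries_def by (intro distinct_filter distinct_product) auto
  have set: "set es = {p \<in> {..<n} \<times> {..<d}. A $$ p \<noteq> 0}"
    unfolding nonzero_entries_def using A by auto
  have "(\<Sum>e<length es. g (es ! e)) = sum_list (map g es)"
    by (simp add: sum_list_sum_nth atLeast0LessThan)
  also have "\<dots> = sum g (set es)" using dist by (simp add: sum_list_distinct_conv_sum_set)
  also have "\<dots> = (\<Sum>p\<in>{..<n} \<times> {..<d}. if A $$ p = 0 then 0 else g p)"
    unfolding set by (rule sum.mono_neutral_cong_left) auto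
  finally show ?thesis by (simp add: sum.cartesian_product)
qed

lemma es_bounds: "e < length es \<Longrightarrow> fst (es ! e) < n \<and> snd (es ! e) < d"
proof -
  assume "e < length es"
  then have "es ! e \<in> set es" by simp
  then show ?thesis using A by (auto simp: nonzero_entries_def)
qed

lemma matmul_correct:
  assumes "a < 16" "b' < 16" "a \<noteq> b'"
  shows "triple A T (\<lambda>N R. sim N R S V) (mul_code 6 8 a b') (\<lambda>N R. sim N R S (V(a := mulA (V b')))) (400 * T)"
proof -
  have "(\<Sum>e<length es. if fst (es ! e) = i then A $$ (es ! e) * x (snd (es ! e)) else 0) = mulA x i" if i: "i < n" for x i
  proof -
    have "(\<Sum>e<length es. if fst (es ! e) = i then A $$ (es ! e) * x (snd (es ! e)) else 0)
        = (\<Sum>k<n. \<Sum>j<d. if A $$ (k, j) = 0 then 0 else if k = i then A $$ (k, j) * x j else 0)"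
      using es_sum[of "\<lambda>p. if fst p = i then A $$ p * x (snd p) else 0"] by (simp cong: if_cong)
    also have "\<dots> = (\<Sum>k<n. if k = i then mulA x k else 0)"
      unfolding mulA_def by (intro sum.cong refl) (auto intro!: sum.cong sum.neutral)
    finally show ?thesis using i by simp
  qed
  then have s: "sim N R S (V(a := mulA (V b')))"
    if "sim N R S (V(a := \<lambda>i. \<Sum>e<length es. if fst (es ! e) = i then A $$ (es ! e) * V b' (snd (es ! e)) else 0))" for N R
    using that by (elim sim_cong) auto
  show ?thesis
    by (rule triple_conseq[OF mul_correct[where r = "\<lambda>e. fst (es ! e)" and c = "\<lambda>e. snd (es ! e)"] _ s])
      (use assms es_bounds d in \<open>auto intro: less_le_trans\<close>)
qed

lemma transmul_correct:
  assumes "a < 16" "b' < 16" "a \<noteq> b'"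
  shows "triple A T (\<lambda>N R. sim N R S V) (mul_code 8 6 a b')
    (\<lambda>N R. sim N R S (V(a := \<lambda>j. if j < d then mulT (V b') j else 0))) (400 * T)"
proof -
  have "(\<Sum>e<length es. if snd (es ! e) = i then A $$ (es ! e) * x (fst (es ! e)) else 0) = (if i < d then mulT x i else 0)" for x i
  proof -
    have "(\<Sum>e<length es. if snd (es ! e) = i then A $$ (es ! e) * x (fst (es ! e)) else 0)
        = (\<Sum>k<n. \<Sum>j<d. if A $$ (k, j) = 0 then 0 else if j = i then A $$ (k, j) * x k else 0)"
      using es_sum[of "\<lambda>p. if snd p = i then A $$ p * x (fst p) else 0"] by (simp cong: if_cong)
    also have "\<dots> = (\<Sum>k<n. \<Sum>j<d. if j = i then A $$ (k, j) * x k else 0)"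
      by (intro sum.cong refl) auto
    also have "\<dots> = (\<Sum>k<n. if i < d then A $$ (k, i) * x k else 0)"
      by (intro sum.cong refl) simp
    finally show ?thesis by (simp add: mulT_def)
  qed
  then have s: "sim N R S (V(a := \<lambda>j. if j < d then mulT (V b') j else 0))"
    if "sim N R S (V(a := \<lambda>i. \<Sum>e<length es. if snd (es ! e) = i then A $$ (es ! e) * V b' (fst (es ! e)) else 0))" for N R
    using that by simp
  show ?thesis
    by (rule triple_conseq[OF mul_correct[where r = "\<lambda>e. snd (es ! e)" and c = "\<lambda>e. fst (es ! e)"] _ s])
      (use assms es_bounds d in \<open>auto intro: less_le_trans\<close>)
qed

lemma solve_correct:
  assumes "a < 16" "b' < 16" "c' < 16" "\<forall>i<n. 0 < V a i"
  shows "triple A T (\<lambda>N R. sim N R S V) (Code [Solve (40 + 2 * a) (40 + 2 * b') (40 + 2 * c')])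
    (\<lambda>N R. sim N R S (V(c' := \<lambda>j. if j < d then sol (V a) (V b') j else V c' j))) T"
proof (rule tripleI)
  fix P F and c :: config and t2 \<delta>
  assume at: "code_at P (pc c) (compile (pc c) (Code [Solve (40 + 2 * a) (40 + 2 * b') (40 + 2 * c')]))"
    and r: "result c = None" and s: "sim (nmem c) (rmem c) S V"
    and k: "\<And>c''. pc c'' = pc c + com_len (Code [Solve (40 + 2 * a) (40 + 2 * b') (40 + 2 * c')]) \<Longrightarrow> result c'' = None \<Longrightarrow>
      sim (nmem c'') (rmem c'') S (V(c' := \<lambda>j. if j < d then sol (V a) (V b') j else V c' j)) \<Longrightarrow> reach A T P F c'' t2 \<delta>"
  have p: "pc c < length P" "P ! pc c = Solve (40 + 2 * a) (40 + 2 * b') (40 + 2 * c')"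
    using at by (simp_all add: code_at_Cons)
  let ?x = "solve_gram A (vec n (V a)) (vec d (V b'))"
  have x: "dim_vec ?x = d" using solve_gram_carrier[of "vec n (V a)" "vec d (V b')"] assms(4) by auto
  have w: "read_vec (rmem c) (nmem c (40 + 2 * a)) (dim_row A) = vec n (V a)"
    using A assms(1) s by (intro eq_vecI) (auto simp: read_vec_def simD)
  have v: "read_vec (rmem c) (nmem c (40 + 2 * b')) (dim_col A) = vec d (V b')"
    using A assms(2) s d by (intro eq_vecI) (auto simp: read_vec_def simD)
  let ?R = "write_vec (rmem c) (base + c' * n) ?x"
  let ?c = "advance T (c\<lparr>rmem := ?R\<rparr>)"
  have e: "exec A T (P ! pc c) c = return_pmf ?c"
    using p(2) w v A assms(3,4) s by (simp add: simD)
  have out: "?R adr = rmem c adr" if "adr < base" for adr using that by (simp add: write_vec_def)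
  have "sim (nmem c) ?R S (V(c' := \<lambda>j. if j < d then sol (V a) (V b') j else V c' j))"
  proof -
    have "?R (base + j * n + i) = (V(c' := \<lambda>j. if j < d then sol (V a) (V b') j else V c' j)) j i" if "j < 16" "i < n" for j i
    proof (cases "base + c' * n \<le> base + j * n + i \<and> base + j * n + i < base + c' * n + d")
      case True
      define k where "k = base + j * n + i - (base + c' * n)"
      have "base + j * n + i = base + c' * n + k" "k < d" using True by (auto simp: k_def)
      then have "j = c'" "i = k" using array_inj[of i k j c'] that d by auto
      then show ?thesis using \<open>k < d\<close> x by (simp add: write_vec_def sol_def)
    next
      case False
      then have "\<not> (j = c' \<and> i < d)" by auto
      then show ?thesis using False s that x by (auto simp: write_vec_def simD)
    qed
    moreover have "\<And>e. e < length es \<Longrightarrow> ?R (5 + 2 * e) = rmem c (5 + 2 * e)"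
      "\<And>i. i < n \<Longrightarrow> ?R (5 + 2 * length es + 2 * i) = rmem c (5 + 2 * length es + 2 * i)"
      "?R 1 = rmem c 1" "?R 3 = rmem c 3" "\<And>a. a < 40 \<Longrightarrow> ?R (2 * a) = rmem c (2 * a)"
      by (rule out, simp add: base_def)+
    ultimately show ?thesis using s unfolding sim_def by simp
  qed
  then have "reach A T P F ?c t2 \<delta>" using r by (intro k) (simp_all add: advance_def)
  from reach_step[OF r p(1) e _ this, of "T + t2"]
  show "reach A T P F c (T + t2) \<delta>" by (simp add: advance_def)
qed

lemma sassign_correct:
  assumes "a < 40" "exp_wf 0 e" "exp_scalar e" "exp_nodes e \<le> 100"
  shows "triple A T (\<lambda>N R. sim N R S V) (prim_code (SAssign a e))
    (\<lambda>N R. sim N R (S(a := exp_val S (\<lambda>_. 0) e)) V) (300 * T)"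
proof -
  let ?is = "exp_code 0 e @ [NConst 4 (2 * a), RStore 4 80]"
  have ev: "exp_scalar e \<Longrightarrow> exp_val S v e = exp_val S v' e" for v v' by (induction e) auto
  show ?thesis unfolding prim_code.simps
  proof (rule triple_codeI)
    show "list_all plain ?is" using plain_exp_code by simp
    show "real (length ?is) \<le> 300 * T" using length_exp_code[of 0 e] assms(4) T_ge by simp
    fix N R assume s: "sim N R S V"
    obtain N1 R1 where e1: "effects (exp_code 0 e) (N, R) = (N1, R1)" by fastforce
    have 1: "sim N1 R1 S V \<and> (\<forall>a. a \<noteq> 4 \<longrightarrow> N1 a = N a) \<and> (\<forall>j<0. R1 (80 + 2 * j) = R (80 + 2 * j)) \<and>
        R1 (80 + 2 * 0) = exp_val S (\<lambda>j. V j (N 0)) e"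
      by (rule exp_code_correct[OF s assms(2) _ e1]) (use assms in auto)
    then have "sim (N1(4 := 2 * a)) (R1(2 * a := R1 80)) (S(a := R1 80)) V"
      using assms by (intro sim_scratch_nat sim_scalar) auto
    moreover have "R1 80 = exp_val S (\<lambda>_. 0) e" using 1 ev[OF assms(3)] by simp
    ultimately show "sim (fst (effects ?is (N, R))) (snd (effects ?is (N, R))) (S(a := exp_val S (\<lambda>_. 0) e)) V"
      by (simp add: effects_append e1)
  qed
qed

lemma prim_correct:
  assumes "prim_ok p (S, V)"
  shows "triple A T (\<lambda>N R. sim N R S V) (prim_code p)
    (\<lambda>N R. sim N R (fst (prim_sem p (S, V))) (snd (prim_sem p (S, V)))) (400 * T)"
  using assms T_ge
proof (cases p)
  case (SAssign a e)
  then show ?thesis using triple_conseq[OF sassign_correct[of a e S V]] assms T_ge by simp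
next
  case (VAssign a e)
  then show ?thesis using triple_conseq[OF vassign_correct[of a e S V]] assms T_ge by simp
next
  case (SSum a b')
  then show ?thesis using triple_conseq[OF ssum_correct[of a b' S V]] assms T_ge by simp
next
  case (MatMul a b')
  then show ?thesis using matmul_correct[of a b' S V] assms by simp
next
  case (TransMul a b')
  then show ?thesis using transmul_correct[of a b' S V] assms by simp
next
  case (SolveGram a b' c)
  then show ?thesis using triple_conseq[OF solve_correct[of a b' c V S]] assms T_ge by simp
next
  case (LoadRhs a)
  then show ?thesis using triple_conseq[OF load_correct[of a S V]] assms T_ge by simp
qed

text \<open>Quantitative weakest preconditions: if the continuation fails with probability at most
  \<open>\<phi> S' V'\<close> from abstract state \<open>(S', V')\<close>, then the command followed by the continuation fails with
  probability at most \<open>\<delta>\<close>.\<close>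

definition wp :: "com \<Rightarrow> real \<Rightarrow> scalars \<Rightarrow> vectors \<Rightarrow> real \<Rightarrow> (scalars \<Rightarrow> vectors \<Rightarrow> real) \<Rightarrow> bool" where
  "wp com t S V \<delta> \<phi> \<longleftrightarrow> (\<forall>P F c t2.
     code_at P (pc c) (compile (pc c) com) \<longrightarrow> result c = None \<longrightarrow> sim (nmem c) (rmem c) S V \<longrightarrow>
     (\<forall>c' S' V'. pc c' = pc c + com_len com \<longrightarrow> result c' = None \<longrightarrow> sim (nmem c') (rmem c') S' V' \<longrightarrow>
        reach A T P F c' t2 (\<phi> S' V')) \<longrightarrow>
     reach A T P F c (t + t2) \<delta>)"

lemma wpI:
  assumes "\<And>P F c t2. code_at P (pc c) (compile (pc c) com) \<Longrightarrow> result c = None \<Longrightarrow> sim (nmem c) (rmem c) S V \<Longrightarrow>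
     (\<And>c' S' V'. pc c' = pc c + com_len com \<Longrightarrow> result c' = None \<Longrightarrow> sim (nmem c') (rmem c') S' V' \<Longrightarrow>
        reach A T P F c' t2 (\<phi> S' V')) \<Longrightarrow>
     reach A T P F c (t + t2) \<delta>"
  shows "wp com t S V \<delta> \<phi>"
  unfolding wp_def using assms by blast

lemma wpD:
  assumes "wp com t S V \<delta> \<phi>" "code_at P l (compile l com)" "pc c = l" "result c = None" "sim (nmem c) (rmem c) S V"
    "\<And>c' S' V'. pc c' = l + com_len com \<Longrightarrow> result c' = None \<Longrightarrow> sim (nmem c') (rmem c') S' V' \<Longrightarrow>
        reach A T P F c' t2 (\<phi> S' V')"
    "t + t2 \<le> t'"
  shows "reach A T P F c t' \<delta>"
proof -
  have "reach A T P F c (t + t2) \<delta>" using assms(1-6) unfolding wp_def by blast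
  then show ?thesis by (rule reach_mono) (use assms(7) in auto)
qed

lemma wp_mono:
  assumes "wp com t S V \<delta> \<phi>" "t \<le> t'" "\<delta> \<le> \<delta>'" "\<And>S V. \<phi>' S V \<le> \<phi> S V"
  shows "wp com t' S V \<delta>' \<phi>'"
proof (rule wpI)
  fix P F and c :: config and t2
  assume a: "code_at P (pc c) (compile (pc c) com)" "result c = None" "sim (nmem c) (rmem c) S V"
    and k: "\<And>c' S' V'. pc c' = pc c + com_len com \<Longrightarrow> result c' = None \<Longrightarrow> sim (nmem c') (rmem c') S' V' \<Longrightarrow>
        reach A T P F c' t2 (\<phi>' S' V')"
  have "reach A T P F c (t + t2) \<delta>"
  proof (rule wpD[OF assms(1) a(1) refl a(2,3)])
    fix c' :: config and S' V' assume "pc c' = pc c + com_len com" "result c' = None" "sim (nmem c') (rmem c') S' V'"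
    from k[OF this] show "reach A T P F c' t2 (\<phi> S' V')" by (rule reach_mono) (use assms(4) in auto)
  qed simp
  then show "reach A T P F c (t' + t2) \<delta>'" by (rule reach_mono) (use assms in auto)
qed

lemma wp_fail: "1 \<le> \<delta> \<Longrightarrow> wp com t S V \<delta> \<phi>"
  by (rule wpI) (rule reach_fail)

lemma wp_triple:
  assumes "triple A T (\<lambda>N R. sim N R S V) com (\<lambda>N R. sim N R S' V') t" "\<phi> S' V' \<le> \<delta>"
  shows "wp com t S V \<delta> \<phi>"
proof (rule wpI)
  fix P F and c :: config and t2
  assume a: "code_at P (pc c) (compile (pc c) com)" "result c = None" "sim (nmem c) (rmem c) S V"
    and k: "\<And>c' S' V'. pc c' = pc c + com_len com \<Longrightarrow> result c' = None \<Longrightarrow> sim (nmem c') (rmem c') S' V' \<Longrightarrow>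
        reach A T P F c' t2 (\<phi> S' V')"
  show "reach A T P F c (t + t2) \<delta>"
  proof (rule tripleD[OF assms(1) a(1) refl a(2,3)])
    fix c' :: config assume "pc c' = pc c + com_len com" "result c' = None" "sim (nmem c') (rmem c') S' V'"
    from k[OF this] show "reach A T P F c' t2 \<delta>" by (rule reach_mono) (use assms(2) in auto)
  qed simp
qed

lemma wp_seq:
  assumes "wp c1 t1 S V \<delta> \<psi>" "\<And>S V. wp c2 t2 S V (\<psi> S V) \<phi>"
  shows "wp (c1 ;; c2) (t1 + t2) S V \<delta> \<phi>"
proof (rule wpI)
  fix P F and c :: config and s
  assume a: "code_at P (pc c) (compile (pc c) (c1 ;; c2))" "result c = None" "sim (nmem c) (rmem c) S V"
    and k: "\<And>c' S' V'. pc c' = pc c + com_len (c1 ;; c2) \<Longrightarrow> result c' = None \<Longrightarrow> sim (nmem c') (rmem c') S' V' \<Longrightarrow>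
        reach A T P F c' s (\<phi> S' V')"
  have ca: "code_at P (pc c) (compile (pc c) c1)" "code_at P (pc c + com_len c1) (compile (pc c + com_len c1) c2)"
    using a(1) by (simp_all add: code_at_append)
  show "reach A T P F c (t1 + t2 + s) \<delta>"
  proof (rule wpD[OF assms(1) ca(1) refl a(2,3)])
    fix c' :: config and S' V' assume c': "pc c' = pc c + com_len c1" "result c' = None" "sim (nmem c') (rmem c') S' V'"
    show "reach A T P F c' (t2 + s) (\<psi> S' V')"
      by (rule wpD[OF assms(2) ca(2) c' k]) (auto simp: add.assoc)
  qed simp
qed

text \<open>\<open>\<Phi> j\<close> bounds the failure probability at the start of round
  \<open>j\<close>. States with \<open>\<Phi>\<close> at least 1 count as failed already, so
  invariants are expressed by the value 1 outside them, and the bound \<open>m\<close> on the rounds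
  is required only below 1.\<close>

lemma wp_while:
  assumes ab: "a < 40" "b' < 40" and t: "0 \<le> t"
    and body: "\<And>j S V. S a < S b' \<Longrightarrow> \<Phi> j S V < 1 \<Longrightarrow> j < m \<and> wp com t S V (\<Phi> j S V) (\<Phi> (Suc j))"
    and exit: "\<And>j S V. \<not> S a < S b' \<Longrightarrow> \<Phi> j S V < 1 \<Longrightarrow> \<phi> S V \<le> \<Phi> j S V"
  shows "wp (WhileLess (2 * a) (2 * b') com) (real m * (t + 1) + 4) S V (\<Phi> 0 S V) \<phi>"
proof (rule wpI)
  fix P F and c :: config and s
  let ?W = "WhileLess (2 * a) (2 * b') com"
  assume a: "code_at P (pc c) (compile (pc c) ?W)" "result c = None" "sim (nmem c) (rmem c) S V"
    and k: "\<And>c' S' V'. pc c' = pc c + com_len ?W \<Longrightarrow> result c' = None \<Longrightarrow> sim (nmem c') (rmem c') S' V' \<Longrightarrow>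
        reach A T P F c' s (\<phi> S' V')"
  define l where "l = pc c"
  have ca: "l < length P" "P ! l = RJumpLess (2 * a) (2 * b') (l + 4)"
    "Suc l < length P" "P ! Suc l = NConst 0 0" "Suc (Suc l) < length P" "P ! Suc (Suc l) = NConst 2 1"
    "Suc (Suc (Suc l)) < length P" "P ! Suc (Suc (Suc l)) = NJumpLess 0 2 (l + 5 + com_len com)"
    "code_at P (l + 4) (compile (l + 4) com)"
    "l + 4 + com_len com < length P" "P ! (l + 4 + com_len com) = RJumpLess (2 * a) (2 * b') (l + 4)"
    using a(1) unfolding l_def by (simp_all add: code_at_append code_at_Cons numeral_eq_Suc add.commute)
  have loop: "reach A T P F c (real (m - j) * (t + 1) + s) (\<Phi> j S V)"
    if "pc c = l + 4" "result c = None" "sim (nmem c) (rmem c) S V" "S a < S b'" for j c S V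
    using that
  proof (induction "m - j" arbitrary: j c S V rule: less_induct)
    case less
    show ?case
    proof (cases "\<Phi> j S V < 1")
      case False
      then show ?thesis by (intro reach_fail) simp
    next
      case True
      from body[OF less.prems(4) True] have jm: "j < m" and w: "wp com t S V (\<Phi> j S V) (\<Phi> (Suc j))" by auto
      have ms: "real (m - j) = real (m - Suc j) + 1" using jm by linarith
      show ?thesis
      proof (rule wpD[OF w ca(9) less.prems(1-3), where ?t2.0 = "real (m - Suc j) * (t + 1) + s + 1"])
        fix c' :: config and S' V'
        assume c': "pc c' = l + 4 + com_len com" "result c' = None" "sim (nmem c') (rmem c') S' V'"
        let ?c = "c'\<lparr>pc := (if rmem c' (2 * a) < rmem c' (2 * b') then l + 4 else Suc (pc c')), clock := clock c' + 1\<rparr>"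
        have cond: "rmem c' (2 * a) < rmem c' (2 * b') \<longleftrightarrow> S' a < S' b'" using simD(7)[OF c'(3)] ab by simp
        have "reach A T P F ?c (real (m - Suc j) * (t + 1) + s) (\<Phi> (Suc j) S' V')"
        proof (cases "S' a < S' b'")
          case True
          show ?thesis by (rule less.hyps) (use True jm c' cond in auto)
        next
          case False
          show ?thesis
          proof (cases "\<Phi> (Suc j) S' V' < 1")
            case True
            have "reach A T P F ?c s (\<phi> S' V')"
              by (rule k) (use False c' cond l_def in auto)
            then show ?thesis by (rule reach_mono) (use exit[OF False True] t in auto)
          qed (intro reach_fail, simp)
        qed
        then show "reach A T P F c' (real (m - Suc j) * (t + 1) + s + 1) (\<Phi> (Suc j) S' V')"
          by (rule reach_rjump[rotated 3]) (use c' ca in auto)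
      qed (simp add: ms algebra_simps)
    qed
  qed
  have cond: "rmem c (2 * a) < rmem c (2 * b') \<longleftrightarrow> S a < S b'" using simD(7)[OF a(3)] ab by simp
  let ?c = "c\<lparr>pc := (if rmem c (2 * a) < rmem c (2 * b') then l + 4 else Suc (pc c)), clock := clock c + 1\<rparr>"
  have "reach A T P F ?c (real m * (t + 1) + 3 + s) (\<Phi> 0 S V)"
  proof (cases "S a < S b'")
    case True
    have "reach A T P F ?c (real (m - 0) * (t + 1) + s) (\<Phi> 0 S V)"
      by (rule loop) (use True cond a in auto)
    then show ?thesis by (rule reach_mono) auto
  next
    case False
    show ?thesis
    proof (cases "\<Phi> 0 S V < 1")
      case True
      let ?c1 = "set_n 0 0 ?c" and ?c2 = "set_n 2 1 (set_n 0 0 ?c)"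
      let ?c3 = "?c2\<lparr>pc := (if nmem ?c2 0 < nmem ?c2 2 then l + 5 + com_len com else Suc (pc ?c2)), clock := clock ?c2 + 1\<rparr>"
      have pcs: "pc ?c = Suc l" "pc ?c1 = Suc (Suc l)" "pc ?c2 = Suc (Suc (Suc l))" "result ?c = None"
        "result ?c1 = None" "result ?c2 = None" "nmem ?c2 0 = 0" "nmem ?c2 2 = 1"
        "clock ?c1 = clock ?c + 1" "clock ?c2 = clock ?c1 + 1"
        using False cond a(2) by (auto simp: l_def set_n_def advance_def)
      have "reach A T P F ?c3 s (\<phi> S V)"
      proof (rule k)
        show "pc ?c3 = pc c + com_len ?W" using pcs by (simp add: l_def)
        show "result ?c3 = None" using a(2) by (simp add: set_n_def advance_def)
        show "sim (nmem ?c3) (rmem ?c3) S V"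
          using a(3) by (auto simp: set_n_def advance_def intro!: sim_scratch_nat)
      qed
      then have "reach A T P F ?c2 (s + 1) (\<phi> S V)"
        by (rule reach_njump[rotated 3]) (use pcs ca in auto)
      then have "reach A T P F ?c1 (s + 2) (\<phi> S V)"
        by (rule reach_step[rotated 4]) (use pcs ca in auto)
      then have "reach A T P F ?c (s + 3) (\<phi> S V)"
        by (rule reach_step[rotated 4]) (use pcs ca in auto)
      then show ?thesis by (rule reach_mono) (use exit[OF False True] t in auto)
    qed (intro reach_fail, simp)
  qed
  then show "reach A T P F c (real m * (t + 1) + 4 + s) (\<Phi> 0 S V)"
    by (rule reach_rjump[rotated 3]) (use a(2) ca l_def in auto)
qed

end

section \<open>Random signs on the machine and additive failure bounds\<close>

context regression begin

text \<open>The bits drawn so far are kept as a list \<open>bs\<close>, and the remaining failure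
  bound is the average over its continuations; each flip unfolds one level of
  \<open>avg\<close>.\<close>

lemma wp_rand:
  assumes a: "a < 16"
    and \<delta>: "avg n (\<lambda>bs. \<phi> S (V(a := \<lambda>i. if i < n then sign bs i else V a i))) \<le> \<delta>"
  shows "wp (rand_code a) (20 * T) S V \<delta> \<phi>"
proof (rule wpI)
  fix P F and c :: config and t2
  assume at: "code_at P (pc c) (compile (pc c) (rand_code a))" "result c = None" "sim (nmem c) (rmem c) S V"
    and k: "\<And>c' S' V'. pc c' = pc c + com_len (rand_code a) \<Longrightarrow> result c' = None \<Longrightarrow> sim (nmem c') (rmem c') S' V' \<Longrightarrow>
        reach A T P F c' t2 (\<phi> S' V')"
  let ?is = "[ROfNat 80 6, ROfNat 82 2, RAdd 80 80 80, RSub 80 80 82, NAdd 4 0 (40 + 2 * a), RStore 4 80, NAdd 0 0 2]"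
  define l where "l = Suc (Suc (pc c))"
  have comp: "compile (pc c) (rand_code a) = [NConst 0 0, NConst 2 1] @ [Flip 6] @ ?is @ [NJumpLess 0 1 l]"
    by (simp add: rand_code_def l_def)
  have parts: "code_at P (pc c) [NConst 0 0, NConst 2 1]" "code_at P l [Flip 6]" "code_at P (Suc l) ?is"
    "code_at P (Suc l + length ?is) [NJumpLess 0 1 l]"
    using at(1) unfolding comp code_at_append l_def by simp_all
  have ca0: "code_at P (pc c) (compile (pc c) (Code [NConst 0 0, NConst 2 1]))" using parts(1) by simp
  have ca: "l < length P" "P ! l = Flip 6" "code_at P (Suc l) (compile (Suc l) (Code ?is))"
    "Suc l + length ?is < length P" "P ! (Suc l + length ?is) = NJumpLess 0 1 l"
    using parts by (simp_all add: code_at_Cons)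
  define W where "W bs = V(a := \<lambda>i. if i < length bs then sign bs i else V a i)" for bs
  have blk: "triple A T (\<lambda>N R. N 0 = length bs \<and> N 2 = 1 \<and> N 6 = (if h then 1 else 0) \<and> sim N R S (W bs)) (Code ?is)
      (\<lambda>N R. N 0 = Suc (length bs) \<and> N 2 = 1 \<and> sim N R S (W (bs @ [h]))) 7" if "length bs < n" for bs h
  proof (rule triple_codeI)
    fix N R assume *: "N 0 = length bs \<and> N 2 = 1 \<and> N 6 = (if h then 1 else 0) \<and> sim N R S (W bs)"
    then have s: "sim N R S (W bs)" by simp
    let ?x = "if h then 1 else - 1 :: real"
    have W: "W (bs @ [h]) = (W bs)(a := (W bs a)(length bs := ?x))"
      by (auto simp: W_def fun_eq_iff sign_def nth_append less_Suc_eq)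
    have N': "fst (effects ?is (N, R)) = N(4 := length bs + (base + a * n), 0 := Suc (length bs))"
      using * simD(6)[OF s a] by (auto simp: fun_eq_iff)
    have R': "snd (effects ?is (N, R)) = R(80 := ?x, 82 := 1, length bs + (base + a * n) := ?x)"
      using * simD(6)[OF s a] by (auto simp: fun_eq_iff)
    have "sim (fst (effects ?is (N, R))) (snd (effects ?is (N, R))) S (W (bs @ [h]))"
      unfolding N' R'
      by (intro sim_scratch_nat sim_store'[OF _ _ W a that] sim_scratch_real s) auto
    then show "fst (effects ?is (N, R)) 0 = Suc (length bs) \<and> fst (effects ?is (N, R)) 2 = 1 \<and>
        sim (fst (effects ?is (N, R))) (snd (effects ?is (N, R))) S (W (bs @ [h]))"
      using * unfolding N' by simp
  qed auto
  have loop: "reach A T P F c (real (Suc m) * 9 + t2) (avg (Suc m) (\<lambda>r. \<phi> S (W (bs @ r))))"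
    if "length bs + Suc m = n" "pc c = l" "result c = None" "nmem c 0 = length bs" "nmem c 2 = 1"
      "sim (nmem c) (rmem c) S (W bs)" for m bs c
    using that
  proof (induction m arbitrary: bs c)
    case 0
    have pre: "length bs < n" "pc c = l" "result c = None" "nmem c 0 = length bs" "nmem c 2 = 1" using 0 by simp_all
    have s6: "sim ((nmem c)(6 := h)) (rmem c) S (W bs)" for h using sim_scratch_nat[OF 0(6)] by simp
    have step: "reach A T P F (set_n 6 (if h then 1 else 0) c) (8 + t2) (\<phi> S (W (bs @ [h])))" for h
    proof (rule tripleD[OF blk[of bs h] ca(3), where ?t2.0 = "1 + t2"])
      fix c' :: config
      assume c': "pc c' = Suc l + com_len (Code ?is)" "result c' = None"
        "nmem c' 0 = Suc (length bs) \<and> nmem c' 2 = 1 \<and> sim (nmem c') (rmem c') S (W (bs @ [h]))"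
      let ?c = "c'\<lparr>pc := (if nmem c' 0 < nmem c' 1 then l else Suc (pc c')), clock := clock c' + 1\<rparr>"
      have s: "sim (nmem c') (rmem c') S (W (bs @ [h]))" using c' by simp
      have "reach A T P F ?c t2 (\<phi> S (W (bs @ [h])))"
        by (rule k) (use c' 0 simD(1)[OF s] in \<open>auto simp: l_def rand_code_def\<close>)
      then show "reach A T P F c' (1 + t2) (\<phi> S (W (bs @ [h])))"
        by (rule reach_njump[rotated 3]) (use c' ca in auto)
    qed (use pre s6 in \<open>auto simp: set_n_def advance_def\<close>)
    show ?case
      by (rule reach_flip[OF _ _ _ _ step[of False, unfolded if_False] step[of True, unfolded if_True]]) (use pre ca in auto)
  next
    case (Suc m)
    have pre: "length bs < n" "pc c = l" "result c = None" "nmem c 0 = length bs" "nmem c 2 = 1" using Suc.prems by simp_all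
    have s6: "sim ((nmem c)(6 := h)) (rmem c) S (W bs)" for h using sim_scratch_nat[OF Suc.prems(6)] by simp
    have step: "reach A T P F (set_n 6 (if h then 1 else 0) c) (8 + (real (Suc m) * 9 + t2)) (avg (Suc m) (\<lambda>r. \<phi> S (W ((bs @ [h]) @ r))))" for h
    proof (rule tripleD[OF blk[of bs h] ca(3), where ?t2.0 = "1 + (real (Suc m) * 9 + t2)"])
      fix c' :: config
      assume c': "pc c' = Suc l + com_len (Code ?is)" "result c' = None"
        "nmem c' 0 = Suc (length bs) \<and> nmem c' 2 = 1 \<and> sim (nmem c') (rmem c') S (W (bs @ [h]))"
      let ?c = "c'\<lparr>pc := (if nmem c' 0 < nmem c' 1 then l else Suc (pc c')), clock := clock c' + 1\<rparr>"
      have s: "sim (nmem c') (rmem c') S (W (bs @ [h]))" using c' by simp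
      have "reach A T P F ?c (real (Suc m) * 9 + t2) (avg (Suc m) (\<lambda>r. \<phi> S (W ((bs @ [h]) @ r))))"
        by (rule Suc.IH) (use c' Suc.prems(1) simD(1)[OF s] in auto)
      then show "reach A T P F c' (1 + (real (Suc m) * 9 + t2)) (avg (Suc m) (\<lambda>r. \<phi> S (W ((bs @ [h]) @ r))))"
        by (rule reach_njump[rotated 3]) (use c' ca in auto)
    qed (use pre s6 in \<open>auto simp: set_n_def advance_def\<close>)
    have e: "avg (Suc (Suc m)) (\<lambda>r. \<phi> S (W (bs @ r)))
        = (avg (Suc m) (\<lambda>r. \<phi> S (W ((bs @ [False]) @ r))) + avg (Suc m) (\<lambda>r. \<phi> S (W ((bs @ [True]) @ r)))) / 2"
      by (subst avg.simps(2)) simp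
    show ?case unfolding e
      by (rule reach_flip[OF _ _ _ _ step[of False, unfolded if_False] step[of True, unfolded if_True]]) (use pre ca in auto)
  qed
  obtain m where m: "n = Suc m" using n_pos by (cases n) auto
  have V: "W [] = V" by (simp add: W_def)
  have init: "triple A T (\<lambda>N R. sim N R S V) (Code [NConst 0 0, NConst 2 1]) (\<lambda>N R. N 0 = 0 \<and> N 2 = 1 \<and> sim N R S V) 2"
    by (rule triple_codeI) (auto intro!: sim_scratch_nat)
  have "reach A T P F c (2 + (real n * 9 + t2)) (avg n (\<lambda>r. \<phi> S (W r)))"
  proof (rule tripleD[OF init ca0 refl at(2,3)])
    fix c' :: config
    assume "pc c' = pc c + com_len (Code [NConst 0 0, NConst 2 1])" "result c' = None"
      "nmem c' 0 = 0 \<and> nmem c' 2 = 1 \<and> sim (nmem c') (rmem c') S V"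
    then show "reach A T P F c' (real n * 9 + t2) (avg n (\<lambda>r. \<phi> S (W r)))"
      unfolding m using loop[of "[]" m c'] V by (simp add: l_def m)
  qed simp
  moreover have "avg n (\<lambda>r. \<phi> S (W r)) \<le> avg n (\<lambda>bs. \<phi> S (V(a := \<lambda>i. if i < n then sign bs i else V a i)))"
    by (rule avg_mono) (simp add: W_def)
  ultimately show "reach A T P F c (20 * T + t2) \<delta>"
    using reach_mono[of A T P F c "2 + (real n * 9 + t2)" "avg n (\<lambda>r. \<phi> S (W r))" "20 * T + t2" \<delta>] \<delta> T_ge by auto
qed

text \<open>\<open>\<eta>\<close> is the failure bound of the continuation and
  \<open>\<delta>\<close> what the command adds; missing \<open>Post\<close> is charged with
  probability 1. Quantifying over \<open>\<eta>\<close> turns the union bound into addition. Time is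
  counted in units of \<open>500 * T\<close>, enough for any primitive together with its
  overhead.\<close>

definition hoare :: "real \<Rightarrow> real \<Rightarrow> (scalars \<Rightarrow> vectors \<Rightarrow> bool) \<Rightarrow> com \<Rightarrow> (scalars \<Rightarrow> vectors \<Rightarrow> bool) \<Rightarrow> bool" where
  "hoare t \<delta> Pre com Post \<longleftrightarrow> (\<forall>S V \<eta>. Pre S V \<longrightarrow> 0 \<le> \<eta> \<longrightarrow> \<eta> \<le> 1 \<longrightarrow>
     wp com (t * (500 * T)) S V (\<delta> + \<eta>) (\<lambda>S V. if Post S V then \<eta> else 1))"

lemma hoareI:
  assumes "\<And>S V \<eta>. Pre S V \<Longrightarrow> 0 \<le> \<eta> \<Longrightarrow> \<eta> \<le> 1 \<Longrightarrow>
     wp com (t * (500 * T)) S V (\<delta> + \<eta>) (\<lambda>S V. if Post S V then \<eta> else 1)"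
  shows "hoare t \<delta> Pre com Post"
  using assms by (simp add: hoare_def)

lemma hoareD:
  "hoare t \<delta> Pre com Post \<Longrightarrow> Pre S V \<Longrightarrow> 0 \<le> \<eta> \<Longrightarrow> \<eta> \<le> 1 \<Longrightarrow>
     wp com (t * (500 * T)) S V (\<delta> + \<eta>) (\<lambda>S V. if Post S V then \<eta> else 1)"
  by (simp add: hoare_def)

lemma unit_mono: "s \<le> t \<Longrightarrow> s * (500 * T) \<le> t * (500 * T)"
  using T_ge by (intro mult_right_mono) auto

lemma hoare_conseq:
  assumes "hoare t \<delta> Pre com Post" "\<And>S V. Pre' S V \<Longrightarrow> Pre S V" "\<And>S V. Post S V \<Longrightarrow> Post' S V" "t \<le> t'" "\<delta> \<le> \<delta>'"
  shows "hoare t' \<delta>' Pre' com Post'"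
proof (rule hoareI)
  fix S V and \<eta> :: real assume h: "Pre' S V" "0 \<le> \<eta>" "\<eta> \<le> 1"
  show "wp com (t' * (500 * T)) S V (\<delta>' + \<eta>) (\<lambda>S V. if Post' S V then \<eta> else 1)"
    by (rule wp_mono[OF hoareD[OF assms(1) assms(2)[OF h(1)] h(2,3)] unit_mono[OF assms(4)]])
      (use assms(3,5) h(3) in auto)
qed

lemma hoare_seq:
  assumes "hoare t1 \<delta>1 Pre c1 Mid" "hoare t2 \<delta>2 Mid c2 Post" "0 \<le> \<delta>1" "0 \<le> \<delta>2"
  shows "hoare (t1 + t2) (\<delta>1 + \<delta>2) Pre (c1 ;; c2) Post"
proof (rule hoareI)
  fix S V and \<eta> :: real assume h: "Pre S V" "0 \<le> \<eta>" "\<eta> \<le> 1"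
  show "wp (c1 ;; c2) ((t1 + t2) * (500 * T)) S V (\<delta>1 + \<delta>2 + \<eta>) (\<lambda>S V. if Post S V then \<eta> else 1)"
  proof (cases "\<delta>2 + \<eta> \<le> 1")
    case True
    have "wp (c1 ;; c2) (t1 * (500 * T) + t2 * (500 * T)) S V (\<delta>1 + (\<delta>2 + \<eta>)) (\<lambda>S V. if Post S V then \<eta> else 1)"
    proof (rule wp_seq)
      show "wp c1 (t1 * (500 * T)) S V (\<delta>1 + (\<delta>2 + \<eta>)) (\<lambda>S V. if Mid S V then \<delta>2 + \<eta> else 1)"
        using hoareD[OF assms(1) h(1) _ True] h assms(4) by simp
      show "wp c2 (t2 * (500 * T)) S V (if Mid S V then \<delta>2 + \<eta> else 1) (\<lambda>S V. if Post S V then \<eta> else 1)" for S V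
        using hoareD[OF assms(2) _ h(2,3)] by (auto intro: wp_fail)
    qed
    then show ?thesis by (simp add: algebra_simps)
  next
    case False
    then show ?thesis using assms(3) by (intro wp_fail) simp
  qed
qed

fun prims_sem :: "prim list \<Rightarrow> scalars \<times> vectors \<Rightarrow> scalars \<times> vectors" where
  "prims_sem [] s = s"
| "prims_sem (p # ps) s = prims_sem ps (prim_sem p s)"

fun prims_ok :: "prim list \<Rightarrow> scalars \<times> vectors \<Rightarrow> bool" where
  "prims_ok [] s = True"
| "prims_ok (p # ps) s \<longleftrightarrow> prim_ok p s \<and> prims_ok ps (prim_sem p s)"

lemma wp_prims:
  assumes "prims_ok ps (S, V)" "prims_sem ps (S, V) = (S', V')" "\<phi> S' V' \<le> \<delta>"
  shows "wp (prims ps) (real (length ps) * (500 * T)) S V \<delta> \<phi>"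
  using assms
proof (induction ps arbitrary: S V)
  case Nil
  have "triple A T (\<lambda>N R. sim N R S V) (Code []) (\<lambda>N R. sim N R S V) 0" by (rule triple_codeI) auto
  from wp_triple[OF this, of \<phi> \<delta>] show ?case using Nil by simp
next
  case (Cons p ps)
  obtain S1 V1 where 1: "prim_sem p (S, V) = (S1, V1)" by fastforce
  have "triple A T (\<lambda>N R. sim N R S V) (prim_code p) (\<lambda>N R. sim N R S1 V1) (400 * T)"
    using prim_correct[of p S V] Cons.prems(1) 1 by simp
  from wp_triple[OF this, of "\<lambda>S V. if S = S1 \<and> V = V1 then \<delta> else 1" \<delta>]
  have a: "wp (prim_code p) (400 * T) S V \<delta> (\<lambda>S V. if S = S1 \<and> V = V1 then \<delta> else 1)" by simp
  have b: "wp (prims ps) (real (length ps) * (500 * T)) S1 V1 \<delta> \<phi>"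
    by (rule Cons.IH) (use Cons.prems 1 in auto)
  have "wp (prim_code p ;; prims ps) (400 * T + real (length ps) * (500 * T)) S V \<delta> \<phi>"
    by (rule wp_seq[OF a]) (use b in \<open>auto intro: wp_fail\<close>)
  then show ?case unfolding prims.simps by (rule wp_mono) (use T_ge in \<open>auto simp: algebra_simps\<close>)
qed

lemma hoare_prims:
  assumes "\<And>S V. Pre S V \<Longrightarrow> prims_ok ps (S, V) \<and> (case prims_sem ps (S, V) of (S', V') \<Rightarrow> Post S' V')"
    "real (length ps) \<le> t"
  shows "hoare t 0 Pre (prims ps) Post"
proof (rule hoareI)
  fix S V and \<eta> :: real assume h: "Pre S V" "0 \<le> \<eta>" "\<eta> \<le> 1"
  obtain S' V' where 1: "prims_sem ps (S, V) = (S', V')" by fastforce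
  have "wp (prims ps) (real (length ps) * (500 * T)) S V (0 + \<eta>) (\<lambda>S V. if Post S V then \<eta> else 1)"
    by (rule wp_prims[OF _ 1]) (use assms(1)[OF h(1)] 1 in auto)
  then show "wp (prims ps) (t * (500 * T)) S V (0 + \<eta>) (\<lambda>S V. if Post S V then \<eta> else 1)"
    by (rule wp_mono) (use unit_mono[OF assms(2)] in auto)
qed

lemma hoare_while:
  assumes ab: "a < 40" "b' < 40" and t: "0 \<le> t" and \<delta>: "0 \<le> \<delta>"
    and body: "\<And>j. hoare t \<delta> (\<lambda>S V. I j S V \<and> S a < S b') com (I (Suc j))"
    and bound: "\<And>j S V. I j S V \<Longrightarrow> S a < S b' \<Longrightarrow> j < m"
  shows "hoare (real m * (t + 1) + 1) (real m * \<delta>) (I 0) (WhileLess (2 * a) (2 * b') com)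
    (\<lambda>S V. \<exists>j. I j S V \<and> \<not> S a < S b')"
proof (rule hoareI)
  fix S V and \<eta> :: real assume h: "I 0 S V" "0 \<le> \<eta>" "\<eta> \<le> 1"
  let ?\<Phi> = "\<lambda>j S V. if I j S V then real (m - j) * \<delta> + \<eta> else 1"
  have "wp (WhileLess (2 * a) (2 * b') com) (real m * (t * (500 * T) + 1) + 4) S V (?\<Phi> 0 S V)
      (\<lambda>S V. if \<exists>j. I j S V \<and> \<not> S a < S b' then \<eta> else 1)"
  proof (rule wp_while[OF ab])
    show "0 \<le> t * (500 * T)" using t T_ge by simp
    fix j S V assume c: "S a < S b'" "?\<Phi> j S V < 1"
    then have I: "I j S V" by (cases "I j S V") auto
    from bound[OF this c(1)] have jm: "j < m" .
    then have mj: "real (m - j) = 1 + real (m - Suc j)" by linarith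
    have lt: "real (m - j) * \<delta> + \<eta> < 1" using c(2) I by simp
    then have "real (m - Suc j) * \<delta> + \<eta> \<le> 1" using \<delta> unfolding mj by (simp add: algebra_simps)
    moreover have "0 \<le> real (m - Suc j) * \<delta> + \<eta>" using \<delta> h by simp
    ultimately have "wp com (t * (500 * T)) S V (\<delta> + (real (m - Suc j) * \<delta> + \<eta>))
        (\<lambda>S V. if I (Suc j) S V then real (m - Suc j) * \<delta> + \<eta> else 1)"
      using hoareD[OF body[of j]] I c(1) by blast
    moreover have "?\<Phi> j S V = \<delta> + (real (m - Suc j) * \<delta> + \<eta>)" using I unfolding mj by (simp add: algebra_simps)
    ultimately show "j < m \<and> wp com (t * (500 * T)) S V (?\<Phi> j S V) (?\<Phi> (Suc j))" using jm by simp
  next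
    fix j S V assume c: "\<not> S a < S b'" "?\<Phi> j S V < 1"
    then have I: "I j S V" by (cases "I j S V") auto
    then have "\<exists>j. I j S V \<and> \<not> S a < S b'" using c(1) by blast
    then show "(if \<exists>j. I j S V \<and> \<not> S a < S b' then \<eta> else 1) \<le> ?\<Phi> j S V" using I \<delta> by simp
  qed
  then show "wp (WhileLess (2 * a) (2 * b') com) ((real m * (t + 1) + 1) * (500 * T)) S V (real m * \<delta> + \<eta>)
      (\<lambda>S V. if \<exists>j. I j S V \<and> \<not> S a < S b' then \<eta> else 1)"
  proof (rule wp_mono)
    have "real m * 1 \<le> real m * (500 * T)" using T_ge by (intro mult_left_mono) auto
    then show "real m * (t * (500 * T) + 1) + 4 \<le> (real m * (t + 1) + 1) * (500 * T)"
      using T_ge by (simp add: algebra_simps)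
    show "?\<Phi> 0 S V \<le> real m * \<delta> + \<eta>" using h by simp
  qed auto
qed

end

section \<open>Huber functions and Bregman divergences of powers\<close>

text \<open>Tangent of a concave power, obtained from the weighted arithmetic-geometric mean
  inequality; this separates the boundary point \<open>y = 0\<close>, where the power need not be
  differentiable.\<close>

lemma powr_tangent:
  fixes x y a :: real
  assumes "0 \<le> y" "0 < x" "0 < a" "a \<le> 1"
  shows "y powr a \<le> x powr a + a * x powr (a - 1) * (y - x)"
proof (cases "y = 0")
  case True
  have "a * x powr (a - 1) * x = a * x powr a" using assms by (simp add: powr_diff)
  then show ?thesis using True assms by (simp add: algebra_simps mult_le_cancel_right1)
next
  case False
  then have y: "0 < y" using assms by simp
  have "y powr a * x powr (1 - a) \<le> a * y + (1 - a) * x"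
    by (rule Youngs_inequality_0) (use assms y in auto)
  then have "x powr (a - 1) * (y powr a * x powr (1 - a)) \<le> x powr (a - 1) * (a * y + (1 - a) * x)"
    by (intro mult_left_mono) auto
  moreover have "x powr (a - 1) * x powr (1 - a) = 1" using assms by (simp add: powr_add[symmetric])
  then have "x powr (a - 1) * (y powr a * x powr (1 - a)) = y powr a" by (metis mult.left_commute mult.right_neutral)
  moreover have "x powr (a - 1) * x = x powr a" using assms by (simp add: powr_diff)
  then have "x powr (a - 1) * (a * y + (1 - a) * x) = x powr a + a * x powr (a - 1) * (y - x)"
    by (simp add: algebra_simps)
  ultimately show ?thesis by simp
qed

lemma powr_tangent_ge1:
  fixes x y q :: real
  assumes "0 \<le> y" "0 < x" "1 < q"
  shows "x powr q + q * x powr (q - 1) * (y - x) \<le> y powr q"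
proof (cases "y = 0")
  case True
  have "x powr (q - 1) * x = x powr q" using assms by (simp add: powr_diff)
  then have "x powr q + q * x powr (q - 1) * (y - x) = (1 - q) * x powr q" using True by (simp add: algebra_simps)
  also have "\<dots> \<le> 0" using assms by (intro mult_nonpos_nonneg) auto
  finally show ?thesis using True by simp
next
  case False
  then have y: "0 < y" using assms by simp
  have "(y powr q) powr (1/q) * (x powr q) powr (1 - 1/q) \<le> (1/q) * y powr q + (1 - 1/q) * x powr q"
    by (rule Youngs_inequality_0) (use assms y in auto)
  moreover have "(y powr q) powr (1/q) = y" "(x powr q) powr (1 - 1/q) = x powr (q - 1)"
    using assms y by (simp_all add: powr_powr right_diff_distrib)
  ultimately have "q * (y * x powr (q - 1)) \<le> q * ((1/q) * y powr q + (1 - 1/q) * x powr q)"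
    using assms by (intro mult_left_mono) auto
  also have "\<dots> = y powr q + (q - 1) * x powr q" using assms by (simp add: algebra_simps)
  moreover have "x powr (q - 1) * x = x powr q" using assms by (simp add: powr_diff)
  ultimately show ?thesis by (simp add: algebra_simps)
qed

lemma powr_diff_antimono:
  fixes x y h a :: real
  assumes "0 < x" "x \<le> y" "0 \<le> h" "0 < a" "a \<le> 1"
  shows "(y + h) powr a - y powr a \<le> (x + h) powr a - x powr a"
proof -
  have "(x + 0) powr a - (y + 0) powr a \<le> (x + h) powr a - (y + h) powr a"
  proof (rule DERIV_nonneg_imp_nondecreasing[where f = "\<lambda>h. (x + h) powr a - (y + h) powr a"])
    fix t assume t: "0 \<le> t" "t \<le> h"
    have "((\<lambda>h. (x + h) powr a - (y + h) powr a) has_real_derivative a * (x + t) powr (a - 1) - a * (y + t) powr (a - 1)) (at t)"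
      using assms t by (auto intro!: derivative_eq_intros)
    moreover have "(y + t) powr (a - 1) \<le> (x + t) powr (a - 1)"
      using assms t by (intro powr_mono2') auto
    then have "0 \<le> a * (x + t) powr (a - 1) - a * (y + t) powr (a - 1)" using assms by simp
    ultimately show "\<exists>y'. ((\<lambda>h. (x + h) powr a - (y + h) powr a) has_real_derivative y') (at t) \<and> 0 \<le> y'" by blast
  qed (use assms in auto)
  then show ?thesis by simp
qed

lemma powr_subadd:
  fixes s t a :: real
  assumes "0 \<le> s" "0 \<le> t" "0 < a" "a \<le> 1"
  shows "(s + t) powr a \<le> s powr a + t powr a"
proof (cases "s = 0")
  case False
  then have s: "0 < s" using assms by simp
  show ?thesis
  proof (cases "t = 0")
    case False
    then have t: "0 < t" using assms by simp
    have 1: "x / (s + t) \<le> (x / (s + t)) powr a" if "0 < x" "x \<le> s + t" for x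
    proof -
      have "(x / (s + t)) powr 1 \<le> (x / (s + t)) powr a" using that assms s t by (intro powr_mono') auto
      then show ?thesis using that s t by simp
    qed
    have "1 = s / (s + t) + t / (s + t)" using s t by (simp add: add_divide_distrib[symmetric])
    also have "\<dots> \<le> (s / (s + t)) powr a + (t / (s + t)) powr a" using 1[of s] 1[of t] s t by simp
    also have "\<dots> = (s powr a + t powr a) / (s + t) powr a"
      using s t by (simp add: powr_divide add_divide_distrib)
    finally show ?thesis using s t by (simp add: pos_le_divide_eq)
  qed (use assms in auto)
qed (use assms in auto)

text \<open>The derivative of \<open>\<bar>t\<bar> powr q\<close> up to the factor \<open>q\<close>,
  in a form that the vector programs can evaluate without a sign function.\<close>

definition sgn_powr :: "real \<Rightarrow> real \<Rightarrow> real" where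
  "sgn_powr q t = \<bar>t\<bar> powr (q - 2) * t"

lemma sgn_powr_nonneg: "0 \<le> t \<Longrightarrow> sgn_powr q t = t powr (q - 1)"
  by (cases "t = 0") (auto simp: sgn_powr_def powr_diff power2_eq_square field_simps)

lemma sgn_powr_minus [simp]: "sgn_powr q (- t) = - sgn_powr q t"
  by (simp add: sgn_powr_def)

lemma DERIV_abs_powr:
  assumes "1 < q"
  shows "((\<lambda>t. \<bar>t\<bar> powr q) has_real_derivative q * sgn_powr q x) (at x)"
proof -
  have pos: "((\<lambda>t. \<bar>t\<bar> powr q) has_real_derivative q * sgn_powr q x) (at x)" if x: "0 < x" for x
  proof -
    have "((\<lambda>t. t powr q) has_real_derivative q * x powr (q - 1)) (at x)"
      using x by (auto intro!: derivative_eq_intros)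
    then have "((\<lambda>t. \<bar>t\<bar> powr q) has_real_derivative q * x powr (q - 1)) (at x)"
      by (rule has_field_derivative_transform_within_open[where S = "{0<..}"]) (use x in auto)
    then show ?thesis using x by (simp add: sgn_powr_nonneg)
  qed
  consider "0 < x" | "x < 0" | "x = 0" by linarith
  then show ?thesis
  proof cases
    case 2
    have "((\<lambda>t. \<bar>- t\<bar> powr q) has_real_derivative (q * sgn_powr q (- x)) * (- 1)) (at x)"
      by (rule DERIV_chain2[OF pos]) (use 2 in \<open>auto intro!: derivative_eq_intros\<close>)
    then show ?thesis by simp
  next
    case 3
    have "((\<lambda>h. \<bar>h\<bar> powr (q - 1)) \<longlongrightarrow> \<bar>0\<bar> powr (q - 1)) (at (0::real))"
      by (intro tendsto_powr' tendsto_intros) (use assms in auto)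
    then have 1: "((\<lambda>h. \<bar>h\<bar> powr (q - 1)) \<longlongrightarrow> 0) (at (0::real))" by simp
    have "norm (\<bar>h\<bar> powr q / h) \<le> \<bar>h\<bar> powr (q - 1)" for h :: real by (simp add: powr_diff)
    then have "((\<lambda>h. \<bar>h\<bar> powr q / h) \<longlongrightarrow> 0) (at (0::real))"
      by (rule Lim_null_comparison[OF always_eventually[OF allI] 1])
    then show ?thesis using 3 by (simp add: DERIV_def sgn_powr_def)
  qed (use pos in auto)
qed

text \<open>As \<open>q \<le> 2\<close>, the derivative
  \<open>(q - 1) * \<bar>t\<bar> powr (q - 2)\<close> is smallest at the radius \<open>R\<close>. It
  is singular at 0 for \<open>q < 2\<close>, hence the separate treatment of \<open>x = 0\<close>
  and of the two signs.\<close>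

lemma sgn_powr_lower:
  assumes q: "1 < q" "q \<le> 2" and R: "0 < R" and xy: "x \<le> y" "\<bar>x\<bar> \<le> R" "\<bar>y\<bar> \<le> R"
  shows "(q - 1) * R powr (q - 2) * (y - x) \<le> sgn_powr q y - sgn_powr q x"
proof -
  have pos: "(q - 1) * R powr (q - 2) * (y - x) \<le> sgn_powr q y - sgn_powr q x"
    if xy: "0 \<le> x" "x \<le> y" "y \<le> R" for x y
  proof (cases "x = 0")
    case True
    show ?thesis
    proof (cases "y = 0")
      case False
      have "R powr (q - 2) \<le> y powr (q - 2)" using q xy False R by (intro powr_mono2') auto
      then have "(q - 1) * R powr (q - 2) * y \<le> 1 * y powr (q - 2) * y"
        using q xy R by (intro mult_right_mono mult_mono) auto
      also have "\<dots> = sgn_powr q y" using xy by (simp add: sgn_powr_def)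
      finally show ?thesis using True by (simp add: sgn_powr_def)
    qed (use True in \<open>simp add: sgn_powr_def\<close>)
  next
    case False
    then have x: "0 < x" using xy by simp
    have "x powr (q - 1) - (q - 1) * R powr (q - 2) * x \<le> y powr (q - 1) - (q - 1) * R powr (q - 2) * y"
    proof (rule DERIV_nonneg_imp_nondecreasing[where f = "\<lambda>t. t powr (q - 1) - (q - 1) * R powr (q - 2) * t"])
      fix t assume t: "x \<le> t" "t \<le> y"
      have "((\<lambda>t. t powr (q - 1) - (q - 1) * R powr (q - 2) * t) has_real_derivative
          (q - 1) * t powr (q - 2) - (q - 1) * R powr (q - 2)) (at t)"
        using t x by (auto intro!: derivative_eq_intros)
      moreover have "R powr (q - 2) \<le> t powr (q - 2)" using q xy t x by (intro powr_mono2') auto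
      then have "0 \<le> (q - 1) * t powr (q - 2) - (q - 1) * R powr (q - 2)" using q by simp
      ultimately show "\<exists>y'. ((\<lambda>t. t powr (q - 1) - (q - 1) * R powr (q - 2) * t) has_real_derivative y') (at t) \<and> 0 \<le> y'"
        by blast
    qed (use xy in auto)
    then show ?thesis using xy by (simp add: sgn_powr_nonneg algebra_simps)
  qed
  have 0: "sgn_powr q 0 = 0" by (simp add: sgn_powr_def)
  consider "0 \<le> x" | "y \<le> 0" | "x \<le> 0" "0 \<le> y" by linarith
  then show ?thesis
  proof cases
    case 1
    then show ?thesis using pos[of x y] xy by auto
  next
    case 2
    then show ?thesis using pos[of "- y" "- x"] xy by (auto simp: algebra_simps)
  next
    case 3
    then show ?thesis using pos[of 0 y] pos[of 0 "- x"] xy 0 by (auto simp: algebra_simps)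
  qed
qed

text \<open>On one side of 0 this is subadditivity of the power \<open>q - 1\<close>; the factor 2
  pays for intervals containing 0.\<close>

lemma sgn_powr_upper:
  assumes q: "1 < q" "q \<le> 2" and xy: "x \<le> y"
  shows "sgn_powr q y - sgn_powr q x \<le> 2 * (y - x) powr (q - 1)"
proof -
  have pos: "sgn_powr q y - sgn_powr q x \<le> 2 * (y - x) powr (q - 1)" if xy: "0 \<le> x" "x \<le> y" for x y
  proof -
    have "y powr (q - 1) \<le> x powr (q - 1) + (y - x) powr (q - 1)"
      using powr_subadd[of x "y - x" "q - 1"] xy q by simp
    moreover have "0 \<le> (y - x) powr (q - 1)" by simp
    moreover have "sgn_powr q y - sgn_powr q x = y powr (q - 1) - x powr (q - 1)" using xy by (simp add: sgn_powr_nonneg)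
    ultimately show ?thesis by linarith
  qed
  consider "0 \<le> x" | "y \<le> 0" | "x \<le> 0" "0 \<le> y" by linarith
  then show ?thesis
  proof cases
    case 1
    then show ?thesis using pos xy by simp
  next
    case 2
    then show ?thesis using pos[of "- y" "- x"] xy by simp
  next
    case 3
    have "y powr (q - 1) \<le> (y - x) powr (q - 1)" by (rule powr_mono2) (use 3 q in auto)
    moreover have "(- x) powr (q - 1) \<le> (y - x) powr (q - 1)" by (rule powr_mono2) (use 3 q in auto)
    moreover have "sgn_powr q y = y powr (q - 1)" "- sgn_powr q x = (- x) powr (q - 1)"
      using 3 sgn_powr_nonneg[of "- x" q] by (simp_all add: sgn_powr_nonneg)
    ultimately show ?thesis by linarith
  qed
qed

text \<open>Smooth replacement for the Huber function, of order
  \<open>u powr (q - 2) * t ^ 2\<close> for small and \<open>\<bar>t\<bar> powr q\<close> for large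
  \<open>t\<close>. Being a power of \<open>u ^ 2 + t ^ 2\<close> with exponent at most 1, it
  inherits most of its estimates from concavity of that power.\<close>

definition huber :: "real \<Rightarrow> real \<Rightarrow> real \<Rightarrow> real" where
  "huber q u t = (u\<^sup>2 + t\<^sup>2) powr (q / 2) - u powr q"

definition huber' :: "real \<Rightarrow> real \<Rightarrow> real \<Rightarrow> real" where
  "huber' q u t = (u\<^sup>2 + t\<^sup>2) powr (q / 2 - 1) * t"

definition bregman :: "real \<Rightarrow> real \<Rightarrow> real \<Rightarrow> real" where
  "bregman q z t = \<bar>z + t\<bar> powr q - \<bar>z\<bar> powr q - q * sgn_powr q z * t"

lemma sq_powr: "(x\<^sup>2) powr a = \<bar>x::real\<bar> powr (2 * a)"
proof -
  have "x\<^sup>2 = \<bar>x\<bar> powr 2" by (cases "x = 0") auto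
  then show ?thesis using powr_powr[of "\<bar>x\<bar>" 2 a] by simp
qed

context
  fixes q :: real
  assumes q: "1 < q" "q \<le> 2"
begin

lemma huber_nonneg: "0 < u \<Longrightarrow> 0 \<le> huber q u t"
proof -
  assume u: "0 < u"
  have "(u\<^sup>2) powr (q/2) \<le> (u\<^sup>2 + t\<^sup>2) powr (q/2)" using q u by (intro powr_mono2) auto
  then show ?thesis using u by (simp add: huber_def sq_powr)
qed

lemma huber_minus [simp]: "huber q u (- t) = huber q u t"
  by (simp add: huber_def)

lemma bregman_minus: "bregman q (- z) (- t) = bregman q z t"
proof -
  have "\<bar>- z + - t\<bar> = \<bar>z + t\<bar>" by simp
  then show ?thesis by (simp only: bregman_def sgn_powr_minus) simp
qed

lemma DERIV_huber:
  assumes "0 < u"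
  shows "(huber q u has_real_derivative q * huber' q u t) (at t)"
proof -
  have "u\<^sup>2 + t\<^sup>2 > 0" using assms by (simp add: add_pos_nonneg)
  then show ?thesis unfolding huber_def huber'_def by (auto intro!: derivative_eq_intros)
qed

lemma DERIV_bregman: "(bregman q z has_real_derivative q * (sgn_powr q (z + t) - sgn_powr q z)) (at t)"
proof -
  have 1: "((\<lambda>t. \<bar>z + t\<bar> powr q) has_real_derivative (q * sgn_powr q (z + t)) * 1) (at t)"
    by (rule DERIV_chain2[OF DERIV_abs_powr]) (use q in \<open>auto intro!: derivative_eq_intros\<close>)
  show ?thesis unfolding bregman_def
    by (rule derivative_eq_intros 1 refl)+ (simp add: algebra_simps)
qed

text \<open>Derivatives in \<open>t\<close> are compared. Between \<open>z\<close> and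
  \<open>z + s\<close> absolute values stay below \<open>u + s\<close>, hence below
  \<open>sqrt (2 * (u ^ 2 + s ^ 2))\<close>, and \<open>sgn_powr_lower\<close> applies with this
  radius; the factor 2 inside the power costs at most one half.\<close>

lemma bregman_lower:
  assumes u: "0 < u" "\<bar>z\<bar> \<le> u"
  shows "(q - 1) / 2 * huber q u t \<le> bregman q z t"
proof -
  have nn: "(q - 1) / 2 * huber q u t \<le> bregman q z t" if z: "\<bar>z\<bar> \<le> u" and t: "0 \<le> t" for z t
  proof -
    let ?f = "\<lambda>t. bregman q z t - (q - 1) / 2 * huber q u t"
    have "?f 0 \<le> ?f t"
    proof (rule DERIV_nonneg_imp_nondecreasing[OF t])
      fix s assume s: "0 \<le> s" "s \<le> t"
      let ?D = "q * (sgn_powr q (z + s) - sgn_powr q z) - (q - 1) / 2 * (q * huber' q u s)"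
      have D: "(?f has_real_derivative ?D) (at s)"
        by (rule derivative_intros DERIV_bregman DERIV_cmult DERIV_huber u)+
      define R where "R = sqrt 2 * sqrt (u\<^sup>2 + s\<^sup>2)"
      have us: "0 < u\<^sup>2 + s\<^sup>2" using u by (simp add: add_pos_nonneg)
      have "\<bar>z\<bar> + s \<le> u + s" using z by simp
      also have "\<dots> \<le> R"
      proof -
        have "(u + s)\<^sup>2 \<le> 2 * (u\<^sup>2 + s\<^sup>2)" using sum_squares_bound[of u s] by (simp add: power2_sum)
        then show ?thesis unfolding R_def real_sqrt_mult[symmetric] using u s by (intro real_le_rsqrt)
      qed
      finally have R: "\<bar>z\<bar> + s \<le> R" .
      have R0: "0 < R" unfolding R_def using us by simp
      have "(q - 1) * R powr (q - 2) * ((z + s) - z) \<le> sgn_powr q (z + s) - sgn_powr q z"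
        by (rule sgn_powr_lower) (use q R0 R s in auto)
      moreover have "R powr (q - 2) = 2 powr (q / 2 - 1) * (u\<^sup>2 + s\<^sup>2) powr (q / 2 - 1)"
      proof -
        have "R = sqrt (2 * (u\<^sup>2 + s\<^sup>2))" unfolding R_def real_sqrt_mult ..
        also have "\<dots> = (2 * (u\<^sup>2 + s\<^sup>2)) powr (1/2)" using us by (intro powr_half_sqrt[symmetric]) simp
        finally have "R = (2 * (u\<^sup>2 + s\<^sup>2)) powr (1/2)" .
        then have "R powr (q - 2) = (2 * (u\<^sup>2 + s\<^sup>2)) powr (q / 2 - 1)" by (simp add: powr_powr diff_divide_distrib)
        also have "\<dots> = 2 powr (q / 2 - 1) * (u\<^sup>2 + s\<^sup>2) powr (q / 2 - 1)" by (rule powr_mult; use us in simp)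
        finally show ?thesis .
      qed
      moreover have "(1/2) \<le> (2::real) powr (q / 2 - 1)"
        using powr_mono[of "-1" "q / 2 - 1" "2::real"] q by (simp add: powr_minus_divide)
      then have "(1/2) * (u\<^sup>2 + s\<^sup>2) powr (q / 2 - 1) \<le> 2 powr (q / 2 - 1) * (u\<^sup>2 + s\<^sup>2) powr (q / 2 - 1)"
        by (intro mult_right_mono) auto
      then have "(q - 1) * ((1/2) * (u\<^sup>2 + s\<^sup>2) powr (q / 2 - 1)) * s \<le> (q - 1) * (2 powr (q / 2 - 1) * (u\<^sup>2 + s\<^sup>2) powr (q / 2 - 1)) * s"
        by (rule mult_right_mono[OF mult_left_mono]) (use q s in auto)
      ultimately have "(q - 1) / 2 * huber' q u s \<le> sgn_powr q (z + s) - sgn_powr q z"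
        by (simp add: huber'_def)
      then have "q * ((q - 1) / 2 * huber' q u s) \<le> q * (sgn_powr q (z + s) - sgn_powr q z)"
        using q by (intro mult_left_mono) auto
      then have "0 \<le> ?D" by (simp add: algebra_simps)
      with D show "\<exists>y. (?f has_real_derivative y) (at s) \<and> 0 \<le> y" by blast
    qed
    then show ?thesis using u by (simp add: bregman_def huber_def sq_powr)
  qed
  show ?thesis
  proof (cases "0 \<le> t")
    case True
    then show ?thesis using nn u by simp
  next
    case False
    then show ?thesis using nn[of "- z" "- t"] u by (simp add: bregman_minus)
  qed
qed

lemma bregman_upper_powr: "bregman q z t \<le> 2 * \<bar>t\<bar> powr q"
proof -
  have nn: "bregman q z t \<le> 2 * \<bar>t\<bar> powr q" if t: "0 \<le> t" for z t
  proof -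
    let ?f = "\<lambda>t. 2 * \<bar>t\<bar> powr q - bregman q z t"
    have "?f 0 \<le> ?f t"
    proof (rule DERIV_nonneg_imp_nondecreasing[OF t])
      fix s assume s: "0 \<le> s" "s \<le> t"
      let ?D = "2 * (q * sgn_powr q s) - q * (sgn_powr q (z + s) - sgn_powr q z)"
      have D: "(?f has_real_derivative ?D) (at s)"
        by (rule derivative_intros DERIV_bregman DERIV_cmult DERIV_abs_powr q)+
      have "sgn_powr q (z + s) - sgn_powr q z \<le> 2 * ((z + s) - z) powr (q - 1)"
        by (rule sgn_powr_upper) (use q s in auto)
      then have "sgn_powr q (z + s) - sgn_powr q z \<le> 2 * sgn_powr q s" using s by (simp add: sgn_powr_nonneg)
      then have "q * (sgn_powr q (z + s) - sgn_powr q z) \<le> q * (2 * sgn_powr q s)"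
        using q by (intro mult_left_mono) auto
      then have "0 \<le> ?D" by simp
      with D show "\<exists>y. (?f has_real_derivative y) (at s) \<and> 0 \<le> y" by blast
    qed
    then show ?thesis using q by (simp add: bregman_def)
  qed
  show ?thesis
  proof (cases "0 \<le> t")
    case False
    then show ?thesis using nn[of "- t" "- z"] by (simp add: bregman_minus)
  qed (use nn in auto)
qed

text \<open>Concavity of the power \<open>q / 2\<close> at \<open>z ^ 2\<close>: in the increment
  \<open>(z + t) ^ 2 - z ^ 2\<close> the part linear in \<open>t\<close> cancels against the tangent
  of \<open>\<bar>z\<bar> powr q\<close>.\<close>

lemma bregman_upper_quad:
  assumes "z \<noteq> 0"
  shows "bregman q z t \<le> q / 2 * \<bar>z\<bar> powr (q - 2) * t\<^sup>2"
proof -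
  have "((z + t)\<^sup>2) powr (q/2) \<le> (z\<^sup>2) powr (q/2) + q/2 * (z\<^sup>2) powr (q/2 - 1) * ((z + t)\<^sup>2 - z\<^sup>2)"
    by (rule powr_tangent) (use q assms in auto)
  then have "\<bar>z + t\<bar> powr q \<le> \<bar>z\<bar> powr q + q/2 * \<bar>z\<bar> powr (q - 2) * ((z + t)\<^sup>2 - z\<^sup>2)"
    by (simp add: sq_powr right_diff_distrib)
  moreover have "q/2 * w * ((z + t)\<^sup>2 - z\<^sup>2) = q * (w * z) * t + q/2 * w * t\<^sup>2" for w
    by (simp add: power2_eq_square field_simps)
  from this[of "\<bar>z\<bar> powr (q - 2)"]
  have "q/2 * \<bar>z\<bar> powr (q - 2) * ((z + t)\<^sup>2 - z\<^sup>2) = q * (\<bar>z\<bar> powr (q - 2) * z) * t + q/2 * \<bar>z\<bar> powr (q - 2) * t\<^sup>2" .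
  ultimately show ?thesis unfolding bregman_def sgn_powr_def by linarith
qed

text \<open>By concavity the value only decreases when \<open>u\<close> grows, so
  \<open>u = \<bar>t\<bar>\<close> is the worst case, with factor \<open>2 powr (q/2) - 1\<close>,
  at least \<open>sqrt 2 - 1\<close>.\<close>

lemma huber_big:
  assumes "0 < u" "u \<le> \<bar>t\<bar>"
  shows "2/5 * \<bar>t\<bar> powr q \<le> huber q u t"
proof -
  have "(t\<^sup>2 + t\<^sup>2) powr (q/2) - (t\<^sup>2) powr (q/2) \<le> (u\<^sup>2 + t\<^sup>2) powr (q/2) - (u\<^sup>2) powr (q/2)"
    by (rule powr_diff_antimono) (use assms q power_mono[of u "\<bar>t\<bar>" 2] in auto)
  moreover have "(t\<^sup>2 + t\<^sup>2) powr (q/2) = 2 powr (q/2) * \<bar>t\<bar> powr q"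
  proof -
    have "t\<^sup>2 + t\<^sup>2 = 2 * t\<^sup>2" by simp
    then show ?thesis by (simp add: powr_mult sq_powr)
  qed
  moreover have "7/5 \<le> (2::real) powr (q/2)"
  proof -
    have "7/5 \<le> sqrt (2::real)" by (rule real_le_rsqrt) (simp add: power2_eq_square)
    also have "\<dots> = 2 powr (1/2)" by (simp add: powr_half_sqrt)
    also have "\<dots> \<le> 2 powr (q/2)" using q by (intro powr_mono) auto
    finally show ?thesis .
  qed
  then have "7/5 * \<bar>t\<bar> powr q \<le> 2 powr (q/2) * \<bar>t\<bar> powr q" by (intro mult_right_mono) auto
  ultimately show ?thesis using assms by (simp add: huber_def sq_powr)
qed

text \<open>The tangent at \<open>u ^ 2 + t ^ 2\<close>, evaluated at \<open>u ^ 2\<close>; the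
  constant is \<open>1/2 * 7/10\<close>, with \<open>7/10\<close> below
  \<open>sqrt (1/2)\<close>.\<close>

lemma huber_small:
  assumes "0 < u" "\<bar>t\<bar> \<le> u"
  shows "1/3 * u powr (q - 2) * t\<^sup>2 \<le> huber q u t"
proof -
  have us: "0 < u\<^sup>2 + t\<^sup>2" using assms by (simp add: add_pos_nonneg)
  have "(u\<^sup>2) powr (q/2) \<le> (u\<^sup>2 + t\<^sup>2) powr (q/2) + q/2 * (u\<^sup>2 + t\<^sup>2) powr (q/2 - 1) * (u\<^sup>2 - (u\<^sup>2 + t\<^sup>2))"
    by (rule powr_tangent) (use q us in auto)
  then have 1: "q/2 * (u\<^sup>2 + t\<^sup>2) powr (q/2 - 1) * t\<^sup>2 \<le> huber q u t" using assms by (simp add: huber_def sq_powr)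
  have "t\<^sup>2 \<le> u\<^sup>2" using assms power_mono[of "\<bar>t\<bar>" u 2] by simp
  then have "(2 * u\<^sup>2) powr (q/2 - 1) \<le> (u\<^sup>2 + t\<^sup>2) powr (q/2 - 1)" using q us by (intro powr_mono2') auto
  moreover have "(2 * u\<^sup>2) powr (q/2 - 1) = 2 powr (q/2 - 1) * u powr (q - 2)"
    using assms by (simp add: powr_mult sq_powr right_diff_distrib)
  moreover have "7/10 \<le> (2::real) powr (q/2 - 1)"
  proof -
    have "7/10 \<le> sqrt (1/2 :: real)" by (rule real_le_rsqrt) (simp add: power2_eq_square)
    also have "\<dots> = (1/2) powr (1/2)" by (simp add: powr_half_sqrt)
    also have "\<dots> = 2 powr (- (1/2))" by (simp add: powr_minus_divide powr_divide)
    also have "\<dots> \<le> 2 powr (q/2 - 1)" using q by (intro powr_mono) auto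
    finally show ?thesis .
  qed
  then have "7/10 * u powr (q - 2) \<le> 2 powr (q/2 - 1) * u powr (q - 2)" by (intro mult_right_mono) auto
  ultimately have "7/10 * u powr (q - 2) \<le> (u\<^sup>2 + t\<^sup>2) powr (q/2 - 1)" by linarith
  then have "1/2 * (7/10 * u powr (q - 2)) * t\<^sup>2 \<le> q/2 * (u\<^sup>2 + t\<^sup>2) powr (q/2 - 1) * t\<^sup>2"
    using q by (intro mult_right_mono mult_mono) auto
  moreover have "1/3 * u powr (q - 2) * t\<^sup>2 \<le> 1/2 * (7/10 * u powr (q - 2)) * t\<^sup>2"
    by (intro mult_right_mono) auto
  ultimately show ?thesis using 1 by linarith
qed

text \<open>Extracting \<open>s powr q\<close> replaces \<open>u\<close> by the larger
  \<open>u / s\<close>, which by concavity only lowers the value. This is the superlinear decay of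
  scaled steps.\<close>

lemma huber_scale:
  assumes "0 < u" "0 < s" "s \<le> 1"
  shows "huber q u (s * t) \<le> s powr q * huber q u t"
proof -
  have "(u\<^sup>2 / s\<^sup>2 + t\<^sup>2) powr (q/2) - (u\<^sup>2 / s\<^sup>2) powr (q/2) \<le> (u\<^sup>2 + t\<^sup>2) powr (q/2) - (u\<^sup>2) powr (q/2)"
  proof (rule powr_diff_antimono)
    have "s\<^sup>2 \<le> 1" using assms by (simp add: power_le_one)
    then show "u\<^sup>2 \<le> u\<^sup>2 / s\<^sup>2" using assms by (simp add: pos_le_divide_eq mult_left_le)
  qed (use assms q in auto)
  then have "s powr q * ((u\<^sup>2 / s\<^sup>2 + t\<^sup>2) powr (q/2) - (u\<^sup>2 / s\<^sup>2) powr (q/2)) \<le> s powr q * huber q u t"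
    using assms by (intro mult_left_mono) (auto simp: huber_def sq_powr)
  moreover have "s powr q * x powr (q/2) = (s\<^sup>2 * x) powr (q/2)" if "0 \<le> x" for x
    using assms that by (simp add: powr_mult sq_powr)
  ultimately show ?thesis using assms
    by (simp add: right_diff_distrib huber_def distrib_left power_mult_distrib sq_powr)
qed

text \<open>Convexity, as the power \<open>q\<close> of the Euclidean norm of \<open>(u, t)\<close>:
  \<open>u ^ 2 + x * y \<le> r0 * r\<close> is Cauchy-Schwarz for the two norms, followed by the
  tangent of the convex power.\<close>

lemma huber_tangent:
  assumes "0 < u"
  shows "huber q u x + q * huber' q u x * (y - x) \<le> huber q u y"
proof -
  define r0 r where "r0 = sqrt (u\<^sup>2 + x\<^sup>2)" and "r = sqrt (u\<^sup>2 + y\<^sup>2)"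
  have p: "0 < u\<^sup>2 + x\<^sup>2" "0 < u\<^sup>2 + y\<^sup>2" using assms by (simp_all add: add_pos_nonneg)
  have r0: "0 < r0" "0 \<le> r" "r0\<^sup>2 = u\<^sup>2 + x\<^sup>2" "r\<^sup>2 = u\<^sup>2 + y\<^sup>2" using p by (simp_all add: r0_def r_def)
  have "(u\<^sup>2 + x * y)\<^sup>2 \<le> (r0 * r)\<^sup>2"
  proof -
    have "(r0 * r)\<^sup>2 - (u\<^sup>2 + x * y)\<^sup>2 = (u * (x - y))\<^sup>2"
      by (simp add: power_mult_distrib r0) (simp add: power2_eq_square algebra_simps)
    then show ?thesis by (metis diff_ge_0_iff_ge zero_le_power2)
  qed
  from power2_le_imp_le[OF this] have "u\<^sup>2 + x * y \<le> r0 * r" using r0 by simp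
  then have "x * (y - x) \<le> r0 * (r - r0)" using r0(3) by (simp add: algebra_simps power2_eq_square)
  then have "q * r0 powr (q - 2) * (x * (y - x)) \<le> q * r0 powr (q - 2) * (r0 * (r - r0))"
    using q by (intro mult_left_mono) auto
  also have "\<dots> = q * r0 powr (q - 1) * (r - r0)"
  proof -
    have "r0 powr (q - 1) = r0 powr (q - 2) * r0" using r0 powr_add[of r0 "q - 2" 1] by simp
    then show ?thesis by simp
  qed
  also have "\<dots> \<le> r powr q - r0 powr q" using powr_tangent_ge1[of r r0 q] r0 q by simp
  finally have "q * r0 powr (q - 2) * (x * (y - x)) \<le> r powr q - r0 powr q" .
  moreover have "r powr q = (u\<^sup>2 + y\<^sup>2) powr (q/2)" "r0 powr q = (u\<^sup>2 + x\<^sup>2) powr (q/2)"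
    "r0 powr (q - 2) = (u\<^sup>2 + x\<^sup>2) powr (q/2 - 1)"
    using p by (simp_all add: r_def r0_def powr_half_sqrt[symmetric] powr_powr diff_divide_distrib)
  ultimately show ?thesis by (simp add: huber_def huber'_def mult.assoc)
qed

text \<open>Concavity of the power gives a quadratic majorant, as in iteratively reweighted least
  squares; its weight is largest at \<open>x = 0\<close>.\<close>

lemma huber_smooth:
  assumes "0 < u"
  shows "huber q u y \<le> huber q u x + q * huber' q u x * (y - x) + q / 2 * u powr (q - 2) * (y - x)\<^sup>2"
proof -
  have p: "0 < u\<^sup>2 + x\<^sup>2" using assms by (simp add: add_pos_nonneg)
  have "(u\<^sup>2 + y\<^sup>2) powr (q/2) \<le> (u\<^sup>2 + x\<^sup>2) powr (q/2) + q/2 * (u\<^sup>2 + x\<^sup>2) powr (q/2 - 1) * ((u\<^sup>2 + y\<^sup>2) - (u\<^sup>2 + x\<^sup>2))"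
    by (rule powr_tangent) (use q p in \<open>auto simp: add_nonneg_nonneg\<close>)
  also have "(u\<^sup>2 + y\<^sup>2) - (u\<^sup>2 + x\<^sup>2) = 2 * x * (y - x) + (y - x)\<^sup>2" by (simp add: power2_eq_square algebra_simps)
  finally have 1: "huber q u y \<le> huber q u x + q * huber' q u x * (y - x) + q / 2 * (u\<^sup>2 + x\<^sup>2) powr (q/2 - 1) * (y - x)\<^sup>2"
  proof -
    assume *: "(u\<^sup>2 + y\<^sup>2) powr (q/2) \<le> (u\<^sup>2 + x\<^sup>2) powr (q/2) + q/2 * (u\<^sup>2 + x\<^sup>2) powr (q/2 - 1) * (2 * x * (y - x) + (y - x)\<^sup>2)"
    have "q/2 * w * (2 * x * (y - x) + (y - x)\<^sup>2) = q * (w * x) * (y - x) + q/2 * w * (y - x)\<^sup>2" for w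
      by (simp add: field_simps)
    from this[of "(u\<^sup>2 + x\<^sup>2) powr (q/2 - 1)"] * show ?thesis unfolding huber_def huber'_def by linarith
  qed
  have "(u\<^sup>2 + x\<^sup>2) powr (q/2 - 1) \<le> (u\<^sup>2) powr (q/2 - 1)" using q assms by (intro powr_mono2') auto
  also have "\<dots> = u powr (q - 2)" using assms by (simp add: sq_powr right_diff_distrib)
  finally have "q / 2 * (u\<^sup>2 + x\<^sup>2) powr (q/2 - 1) * (y - x)\<^sup>2 \<le> q / 2 * u powr (q - 2) * (y - x)\<^sup>2"
    using q by (intro mult_right_mono mult_left_mono) auto
  with 1 show ?thesis by linarith
qed

text \<open>For \<open>\<bar>t\<bar>\<close> at least \<open>u\<close> both sides have order
  \<open>\<bar>t\<bar> powr q\<close>. Below \<open>u\<close> the quadratic bound at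
  \<open>z\<close> suffices if the scale equals \<open>\<bar>z\<bar>\<close>; an enlarged scale
  costs an additive \<open>2 * u powr q\<close>, which is why the sum of enlarged scales has to be
  small.\<close>

lemma bregman_upper:
  assumes u: "0 < u" "\<bar>z\<bar> \<le> u"
  shows "bregman q z t \<le> 5 * huber q u t + 2 * (if u = \<bar>z\<bar> then 0 else u powr q)"
proof (cases "u \<le> \<bar>t\<bar>")
  case True
  have "bregman q z t \<le> 5 * huber q u t" using huber_big[OF u(1) True] bregman_upper_powr[of z t] by linarith
  then show ?thesis by (auto intro: order_trans)
next
  case False
  then have t: "\<bar>t\<bar> \<le> u" by simp
  show ?thesis
  proof (cases "u = \<bar>z\<bar>")
    case True
    have "q / 2 * \<bar>z\<bar> powr (q - 2) * t\<^sup>2 \<le> 1 * \<bar>z\<bar> powr (q - 2) * t\<^sup>2"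
      using q by (intro mult_right_mono) auto
    moreover have "z \<noteq> 0" using True u by auto
    ultimately have "bregman q z t \<le> 1 * \<bar>z\<bar> powr (q - 2) * t\<^sup>2" using bregman_upper_quad[of z t] by linarith
    then have "bregman q z t \<le> u powr (q - 2) * t\<^sup>2" using True by simp
    then show ?thesis using huber_small[OF u(1) t] huber_nonneg[OF u(1), of t] True by simp
  next
    case False
    have "\<bar>t\<bar> powr q \<le> u powr q" using t q by (intro powr_mono2) auto
    then show ?thesis using False bregman_upper_powr[of z t] huber_nonneg[OF u(1), of t] by simp
  qed
qed

text \<open>Beyond \<open>u\<close> the quadratic grows faster than the power \<open>q\<close>, and
  at \<open>K * u\<close> the excess is \<open>K powr (2 - q)\<close>. This loss is what
  acceleration has to pay for.\<close>

lemma weight_le_huber: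
  assumes "0 < u" "1 \<le> K" "\<bar>t\<bar> \<le> K * u"
  shows "u powr (q - 2) * t\<^sup>2 \<le> 3 * K powr (2 - q) * huber q u t"
proof (cases "\<bar>t\<bar> \<le> u")
  case True
  have "1 \<le> K powr (2 - q)" using assms q by (intro ge_one_powr_ge_zero) auto
  then have "1 * (3 * huber q u t) \<le> K powr (2 - q) * (3 * huber q u t)"
    using huber_nonneg[OF assms(1)] by (intro mult_right_mono) auto
  then show ?thesis using huber_small[OF assms(1) True] by linarith
next
  case False
  then have t: "u \<le> \<bar>t\<bar>" "0 < \<bar>t\<bar>" using assms by auto
  have "u powr (q - 2) = (1 / u) powr (2 - q)" using assms by (simp add: powr_divide powr_minus_divide[symmetric])
  also have "\<dots> \<le> (K / \<bar>t\<bar>) powr (2 - q)"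
    using assms t q by (intro powr_mono2) (auto simp: field_simps)
  also have "\<dots> = K powr (2 - q) * \<bar>t\<bar> powr (q - 2)" 
  proof -
    have "(K / \<bar>t\<bar>) powr (2 - q) = K powr (2 - q) / \<bar>t\<bar> powr (2 - q)" by (rule powr_divide; use assms t in simp)
    moreover have "\<bar>t\<bar> powr (q - 2) = 1 / \<bar>t\<bar> powr (2 - q)" using powr_minus_divide[of "\<bar>t\<bar>" "2 - q"] by simp
    ultimately show ?thesis by simp
  qed
  finally have "u powr (q - 2) * t\<^sup>2 \<le> (K powr (2 - q) * \<bar>t\<bar> powr (q - 2)) * t\<^sup>2" by (intro mult_right_mono) auto
  also have "\<bar>t\<bar> powr (q - 2) * t\<^sup>2 = \<bar>t\<bar> powr q"
    using powr_add[of "\<bar>t\<bar>" "q - 2" 2] t by simp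
  then have "(K powr (2 - q) * \<bar>t\<bar> powr (q - 2)) * t\<^sup>2 = K powr (2 - q) * \<bar>t\<bar> powr q" by simp
  also have "\<dots> \<le> K powr (2 - q) * (3 * huber q u t)"
    using huber_big[OF assms(1) t(1)] huber_nonneg[OF assms(1), of t] by (intro mult_left_mono) auto
  finally show ?thesis by simp
qed

end

section \<open>Iterative refinement\<close>

context regression begin

definition resid :: "(nat \<Rightarrow> real) \<Rightarrow> nat \<Rightarrow> real" where
  "resid x i = mulA x i - vec_index b i"

definition cost :: "(nat \<Rightarrow> real) \<Rightarrow> real" where
  "cost x = (\<Sum>i<n. \<bar>resid x i\<bar> powr q)"

definition wt :: "(nat \<Rightarrow> real) \<Rightarrow> nat \<Rightarrow> real" where
  "wt u i = u i powr (q - 2)"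

lemma wt_pos: "0 < u i \<Longrightarrow> 0 < wt u i"
  by (simp add: wt_def)

lemma resid_add: "resid (\<lambda>j. x j + y j) i = resid x i + mulA y i"
  using mulA_linear[of 1 x 1 y i] by (simp add: resid_def)

text \<open>The upper model of the change in cost from \<open>bregman_upper\<close>, without its
  error term, divided by \<open>5 * q\<close>: with this normalization its curvature in row
  \<open>i\<close> is at most \<open>wt u i\<close>.\<close>

definition potential :: "(nat \<Rightarrow> real) \<Rightarrow> (nat \<Rightarrow> real) \<Rightarrow> nat \<Rightarrow> real \<Rightarrow> real" where
  "potential z u i t = sgn_powr q (z i) / 5 * t + huber q (u i) t / q"

definition grad :: "(nat \<Rightarrow> real) \<Rightarrow> (nat \<Rightarrow> real) \<Rightarrow> nat \<Rightarrow> real \<Rightarrow> real" where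
  "grad z u i t = sgn_powr q (z i) / 5 + huber' q (u i) t"

text \<open>The Lyapunov function of accelerated descent. Its comparison point \<open>s\<close> is
  arbitrary, so no minimizer of the model has to exist.\<close>

definition energy :: "(nat \<Rightarrow> real) \<Rightarrow> (nat \<Rightarrow> real) \<Rightarrow> (nat \<Rightarrow> real) \<Rightarrow> nat \<Rightarrow> (nat \<Rightarrow> real) \<Rightarrow> (nat \<Rightarrow> real) \<Rightarrow> real" where
  "energy z u s j x v = real j * (real j + 1) / 4 * (\<Sum>i<n. potential z u i (mulA x i) - potential z u i (mulA s i))
     + (\<Sum>i<n. wt u i / 2 * (mulA s i - mulA v i)\<^sup>2)"

text \<open>The sum of \<open>agd_coordinate\<close> over the rows. Since \<open>v - v'\<close> is a
  projected gradient, the weighted inner product of its image with any vector in the range equals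
  that of the scaled gradient, so the leftover brackets add up to 0.\<close>

lemma agd_step:
  assumes u: "\<And>i. i < n \<Longrightarrow> 0 < u i" and th: "\<theta> = 2 / (real j + 2)"
    and y: "\<And>k. k < d \<Longrightarrow> y k = (1 - \<theta>) * x k + \<theta> * v k"
    and v': "\<And>k. k < d \<Longrightarrow> v' k = v k - (real j + 1) / 2 * sol (wt u) (mulT (\<lambda>i. grad z u i (mulA y i))) k"
    and x': "\<And>k. k < d \<Longrightarrow> x' k = (1 - \<theta>) * x k + \<theta> * v' k"
  shows "energy z u s (Suc j) x' v' \<le> energy z u s j x v"
proof -
  let ?g = "\<lambda>i. grad z u i (mulA y i)" and ?w = "wt u"
  let ?\<psi> = "\<lambda>i. potential z u i"
  have w: "0 < ?w i" if "i < n" for i using wt_pos[where u = u] u that by simp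
  have my: "mulA y i = (1 - \<theta>) * mulA x i + \<theta> * mulA v i" for i
    unfolding mulA_linear[symmetric] by (rule mulA_cong) (rule y)
  have mx': "mulA x' i = (1 - \<theta>) * mulA x i + \<theta> * mulA v' i" for i
    unfolding mulA_linear[symmetric] by (rule mulA_cong) (rule x')
  have mv': "mulA v' i = 1 * mulA v i + (- ((real j + 1) / 2)) * mulA (sol ?w (mulT ?g)) i" for i
    unfolding mulA_linear[symmetric] by (rule mulA_cong) (simp add: v')
  have q0: "0 < q" using q by simp
  have gen: "a * t + h + (a + g) * (t' - t) = a * t' + (h + g * (t' - t))" for a h g t t' :: real
    by (simp add: algebra_simps)
  have conv: "?\<psi> i t + grad z u i t * (t' - t) \<le> ?\<psi> i t'" if "i < n" for i t t'
  proof -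
    have "(huber q (u i) t + q * huber' q (u i) t * (t' - t)) / q \<le> huber q (u i) t' / q"
      using huber_tangent[OF q u[OF that], of t t'] q0 by (intro divide_right_mono) auto
    moreover have "(huber q (u i) t + q * huber' q (u i) t * (t' - t)) / q = huber q (u i) t / q + huber' q (u i) t * (t' - t)"
      using q0 by (simp add: add_divide_distrib)
    ultimately show ?thesis unfolding potential_def grad_def gen by simp
  qed
  have smooth: "?\<psi> i t' \<le> ?\<psi> i t + grad z u i t * (t' - t) + ?w i / 2 * (t' - t)\<^sup>2" if "i < n" for i t t'
  proof -
    have "huber q (u i) t' / q \<le> (huber q (u i) t + q * huber' q (u i) t * (t' - t) + q / 2 * u i powr (q - 2) * (t' - t)\<^sup>2) / q"
      using huber_smooth[OF q u[OF that], of t' t] q0 by (intro divide_right_mono) auto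
    also have "\<dots> = huber q (u i) t / q + huber' q (u i) t * (t' - t) + ?w i / 2 * (t' - t)\<^sup>2"
      using q0 by (simp add: add_divide_distrib wt_def)
    finally show ?thesis unfolding potential_def grad_def gen by simp
  qed
  let ?r = "\<lambda>i. (real j + 1) / 2 * ?g i * (mulA v' i - mulA s i) - ?w i * (mulA v i - mulA v' i) * (mulA v' i - mulA s i)"
  have c: "(real j + 1) * (real j + 2) / 4 * (?\<psi> i (mulA x' i) - ?\<psi> i (mulA s i)) + ?w i / 2 * (mulA s i - mulA v' i)\<^sup>2
      \<le> real j * (real j + 1) / 4 * (?\<psi> i (mulA x i) - ?\<psi> i (mulA s i)) + ?w i / 2 * (mulA s i - mulA v i)\<^sup>2 + ?r i"
    if "i < n" for i
    by (rule agd_coordinate[OF th my mx' smooth[OF that] conv[OF that] conv[OF that]]) (use w[OF that] in simp)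
  have orth: "(\<Sum>i<n. ?r i) = 0"
  proof -
    have md: "mulA v' i - mulA s i = mulA (\<lambda>k. 1 * v' k + (- 1) * s k) i" for i by (subst mulA_linear) simp
    have "(\<Sum>i<n. ?w i * mulA (sol ?w (mulT ?g)) i * (mulA v' i - mulA s i)) = (\<Sum>i<n. ?g i * (mulA v' i - mulA s i))"
      unfolding md by (rule sol_mulT_inner[where w = ?w, OF w])
    then have 0: "(\<Sum>i<n. ?g i * (mulA v' i - mulA s i)) - (\<Sum>i<n. ?w i * mulA (sol ?w (mulT ?g)) i * (mulA v' i - mulA s i)) = 0"
      by simp
    have "?r i = (real j + 1) / 2 * (?g i * (mulA v' i - mulA s i) - ?w i * mulA (sol ?w (mulT ?g)) i * (mulA v' i - mulA s i))" for i
      unfolding mv' by (simp add: field_simps)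
    then have "(\<Sum>i<n. ?r i) = (\<Sum>i<n. (real j + 1) / 2 * (?g i * (mulA v' i - mulA s i) - ?w i * mulA (sol ?w (mulT ?g)) i * (mulA v' i - mulA s i)))"
      by (intro sum.cong) auto
    also have "\<dots> = (real j + 1) / 2 * ((\<Sum>i<n. ?g i * (mulA v' i - mulA s i)) - (\<Sum>i<n. ?w i * mulA (sol ?w (mulT ?g)) i * (mulA v' i - mulA s i)))"
      by (simp only: sum_distrib_left[symmetric] sum_subtractf)
    finally show ?thesis unfolding 0 by simp
  qed
  have "(\<Sum>i<n. (real j + 1) * (real j + 2) / 4 * (?\<psi> i (mulA x' i) - ?\<psi> i (mulA s i)) + ?w i / 2 * (mulA s i - mulA v' i)\<^sup>2)
      \<le> (\<Sum>i<n. real j * (real j + 1) / 4 * (?\<psi> i (mulA x i) - ?\<psi> i (mulA s i)) + ?w i / 2 * (mulA s i - mulA v i)\<^sup>2 + ?r i)"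
    by (rule sum_mono) (use c in simp)
  also have "\<dots> = energy z u s j x v + (\<Sum>i<n. ?r i)"
    by (simp add: energy_def sum.distrib sum_distrib_left)
  also have "(\<Sum>i<n. (real j + 1) * (real j + 2) / 4 * (?\<psi> i (mulA x' i) - ?\<psi> i (mulA s i)) + ?w i / 2 * (mulA s i - mulA v' i)\<^sup>2)
      = energy z u s (Suc j) x' v'"
    by (simp add: energy_def sum.distrib sum_distrib_left add.commute mult.commute)
  finally show ?thesis using orth by simp
qed

lemma cost_diff: "cost (\<lambda>j. x j + y j) - cost x
    = (\<Sum>i<n. q * sgn_powr q (resid x i) * mulA y i + bregman q (resid x i) (mulA y i))"
  unfolding cost_def resid_add sum_subtractf[symmetric]
  by (rule sum.cong) (auto simp: bregman_def)

text \<open>The accelerated iterate \<open>X\<close> competes with the scaled optimal step. In the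
  upper model that step gains at least \<open>s\<close> times the true gap; the optimization error
  and the enlarged scales lose \<open>s * G / 4\<close> each, which leaves the factor
  \<open>1 - s / 2\<close>.\<close>

lemma phase_progress:
  fixes x X u :: "nat \<Rightarrow> real" and s G \<kappa> r k :: real
  defines "z \<equiv> resid x"
  defines "E \<equiv> \<Sum>i<n. if u i = \<bar>z i\<bar> then 0 else u i powr q"
  defines "B \<equiv> 8 / ((q - 1) * s)"
  defines "Q \<equiv> 3 * B * G * r\<^sup>2 / \<kappa>"
  assumes s: "s = ((q - 1) / 20) powr (1 / (q - 1))"
    and G: "0 < G" and gap: "\<And>y. cost x - cost y \<le> G"
    and u: "\<And>i. i < n \<Longrightarrow> 0 < u i" "\<And>i. i < n \<Longrightarrow> \<bar>z i\<bar> \<le> u i"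
    and E: "2 * E \<le> s * G / 4"
    and \<kappa>: "0 < \<kappa>" and lev: "\<And>i. i < n \<Longrightarrow> \<kappa> * lev (wt u) i \<le> r\<^sup>2 * (u i)\<^sup>2"
    and Q1: "1 \<le> Q"
    and k: "sqrt (1920 / (q - 1)) * Q powr (1 - q / 2) \<le> k" "0 < k"
    and agd: "\<And>y. k\<^sup>2 / 4 * (\<Sum>i<n. potential z u i (mulA X i) - potential z u i (mulA y i))
        \<le> (\<Sum>i<n. wt u i / 2 * (mulA y i)\<^sup>2)"
  shows "cost (\<lambda>j. x j + X j) - cost y \<le> (1 - s / 2) * G"
proof -
  have q0: "0 < q - 1" using q by simp
  have s0: "0 < s" "s \<le> 1"
  proof -
    show "0 < s" using q0 by (simp add: s)
    have "((q - 1) / 20) powr (1 / (q - 1)) \<le> 1" using q by (intro powr_le1) auto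
    then show "s \<le> 1" by (simp add: s)
  qed
  \<comment> \<open>The choice of \<open>s\<close>: in the upper model a step scaled by
    \<open>s\<close> pays only half of the Huber term that the lower model credits to it.\<close>
  have sq: "5 * s powr (q - 1) = (q - 1) / 4" using q0 by (simp add: s powr_powr)
  have sq': "5 * s powr q = s * ((q - 1) / 4)"
  proof -
    have "s powr q = s powr (q - 1) * s" using s0 powr_add[of s "q - 1" 1] by simp
    then have "5 * s powr q = s * (5 * s powr (q - 1))" by simp
    then show ?thesis by (simp only: sq)
  qed
  have E0: "0 \<le> E" unfolding E_def by (intro sum_nonneg) auto
  have E1: "2 * E \<le> G" using E s0 G mult_right_mono[of s 1 G] by linarith
  define lin where "lin y = (\<Sum>i<n. q * sgn_powr q (z i) * mulA y i)" for y
  define Gam where "Gam y = (\<Sum>i<n. huber q (u i) (mulA y i))" for y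
  have Gam0: "0 \<le> Gam y" for y unfolding Gam_def by (intro sum_nonneg huber_nonneg[OF q] u) auto
  have upper: "cost (\<lambda>j. x j + y j) - cost x \<le> lin y + 5 * Gam y + 2 * E" for y
    unfolding cost_diff lin_def Gam_def E_def sum_distrib_left sum.distrib[symmetric] z_def[symmetric]
    by (rule sum_mono) (use bregman_upper[OF q u(1) u(2)] in \<open>simp add: add.assoc\<close>)
  have lower: "lin y + (q - 1) / 2 * Gam y \<le> cost (\<lambda>j. x j + y j) - cost x" for y
    unfolding cost_diff lin_def Gam_def sum_distrib_left sum.distrib[symmetric] z_def[symmetric]
    by (rule sum_mono) (use bregman_lower[OF q u(1) u(2)] in simp)
  have mul_s: "mulA (\<lambda>j. t * y j) i = t * mulA y i" for t y i using mulA_linear[of t y 0 y i] by simp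
  have lin_s: "lin (\<lambda>j. t * y j) = t * lin y" for t y
    unfolding lin_def mul_s sum_distrib_left by (rule sum.cong) auto
  have Gam_s: "5 * Gam (\<lambda>j. s * y j) \<le> s * ((q - 1) / 4) * Gam y" for y
  proof -
    have "Gam (\<lambda>j. s * y j) \<le> s powr q * Gam y"
      unfolding Gam_def mul_s sum_distrib_left by (rule sum_mono) (use huber_scale[OF q u(1) s0] in simp)
    then have "5 * Gam (\<lambda>j. s * y j) \<le> (5 * s powr q) * Gam y" by simp
    then show ?thesis by (simp only: sq')
  qed
  have main: "cost (\<lambda>j. x j + X j) - cost y \<le> (1 - s / 2) * G" if le: "cost y \<le> cost x" for y
  proof -
    define D where "D = (\<lambda>j. y j - x j)"
    define Gt where "Gt = cost x - cost y"
    have Gt: "0 \<le> Gt" "Gt \<le> G" using le gap[of y] by (auto simp: Gt_def)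
    have yD: "cost (\<lambda>j. x j + D j) = cost y" by (simp add: D_def)
    have low: "lin D + (q - 1) / 2 * Gam D \<le> - Gt" using lower[of D] by (simp add: yD Gt_def)
    have sD: "cost (\<lambda>j. x j + s * D j) - cost x \<le> s * lin D + s * ((q - 1) / 4) * Gam D + 2 * E"
      using upper[of "\<lambda>j. s * D j"] Gam_s[of D] by (simp add: lin_s)
    \<comment> \<open>No step gains more than \<open>G\<close>, while the spare half of the Huber
      term would be an additional gain of the scaled step; this bounds \<open>Gam D\<close>.\<close>
    have "- G \<le> cost (\<lambda>j. x j + s * D j) - cost x" using gap[of "\<lambda>j. x j + s * D j"] by simp
    then have "- G \<le> s * (lin D + (q - 1) / 4 * Gam D) + 2 * E" using sD by (simp add: algebra_simps)
    then have "- (2 * G) \<le> s * (lin D + (q - 1) / 4 * Gam D)" using E1 by simp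
    also have "\<dots> \<le> s * (- ((q - 1) / 4 * Gam D))"
    proof (rule mult_left_mono)
      have "(q - 1) / 2 * Gam D = (q - 1) / 4 * Gam D + (q - 1) / 4 * Gam D" by (simp add: field_simps)
      then show "lin D + (q - 1) / 4 * Gam D \<le> - ((q - 1) / 4 * Gam D)" using low Gt by linarith
    qed (use s0 in simp)
    finally have "s * ((q - 1) / 4 * Gam D) \<le> 2 * G" by simp
    then have Gam: "Gam D \<le> B * G" using s0 q0 by (simp add: B_def field_simps)
    define K where "K = Max (insert 1 ((\<lambda>i. \<bar>mulA D i\<bar> / u i) ` {..<n}))"
    have K1: "1 \<le> K" unfolding K_def by (rule Max_ge) auto
    have Ki: "\<bar>mulA D i\<bar> \<le> K * u i" if "i < n" for i
    proof -
      have "\<bar>mulA D i\<bar> / u i \<le> K" unfolding K_def using that by (intro Max_ge) auto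
      then show ?thesis using u(1)[OF that] by (simp add: field_simps)
    qed
    have nrm: "(\<Sum>i<n. wt u i * (mulA D i)\<^sup>2) \<le> 3 * K powr (2 - q) * (B * G)"
    proof -
      have "(\<Sum>i<n. wt u i * (mulA D i)\<^sup>2) \<le> (\<Sum>i<n. 3 * K powr (2 - q) * huber q (u i) (mulA D i))"
        unfolding wt_def by (rule sum_mono) (use weight_le_huber[OF q u(1) K1 Ki] in simp)
      also have "\<dots> = 3 * K powr (2 - q) * Gam D" by (simp add: Gam_def sum_distrib_left)
      also have "\<dots> \<le> 3 * K powr (2 - q) * (B * G)" using Gam by (intro mult_left_mono) auto
      finally show ?thesis .
    qed
    \<comment> \<open>At a row attaining \<open>K\<close>, the leverage bound yields \<open>\<kappa>
      * K ^ 2 \<le> r ^ 2 * (3 * K powr (2 - q) * (B * G))\<close>; cancelling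
      \<open>K powr (2 - q)\<close> closes the circle.\<close>
    have KQ: "K powr q \<le> Q"
    proof (cases "K = 1")
      case True
      then show ?thesis using Q1 by simp
    next
      case False
      have "K \<in> insert 1 ((\<lambda>i. \<bar>mulA D i\<bar> / u i) ` {..<n})" unfolding K_def by (rule Max_in) auto
      then obtain i where i: "i < n" "K = \<bar>mulA D i\<bar> / u i" using False by auto
      have ui: "0 < u i" using u(1)[OF i(1)] .
      have "\<kappa> * (mulA D i)\<^sup>2 \<le> \<kappa> * (lev (wt u) i * (\<Sum>k<n. wt u k * (mulA D k)\<^sup>2))"
        using mulA_le_lev[where w = "wt u", OF wt_pos[where u = u, OF u(1)]] \<kappa> by (intro mult_left_mono) auto
      also have "\<dots> = (\<kappa> * lev (wt u) i) * (\<Sum>k<n. wt u k * (mulA D k)\<^sup>2)" by (simp add: mult.assoc)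
      also have "\<dots> \<le> (r\<^sup>2 * (u i)\<^sup>2) * (3 * K powr (2 - q) * (B * G))"
      proof (rule mult_mono[OF lev[OF i(1)] nrm])
        show "0 \<le> (\<Sum>k<n. wt u k * (mulA D k)\<^sup>2)"
          using wt_pos[where u = u, OF u(1)] by (intro sum_nonneg mult_nonneg_nonneg) (auto simp: less_imp_le)
      qed simp
      finally have "\<kappa> * (mulA D i)\<^sup>2 \<le> (r\<^sup>2 * (3 * K powr (2 - q) * (B * G))) * (u i)\<^sup>2" by (simp add: mult_ac)
      then have "\<kappa> * ((mulA D i)\<^sup>2 / (u i)\<^sup>2) \<le> r\<^sup>2 * (3 * K powr (2 - q) * (B * G))"
        using ui by (simp add: pos_divide_le_eq)
      then have "\<kappa> * K\<^sup>2 \<le> r\<^sup>2 * (3 * K powr (2 - q) * (B * G))" unfolding i(2) by (simp add: power_divide)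
      moreover have "K\<^sup>2 = K powr q * K powr (2 - q)" using K1 by (simp add: powr_add[symmetric])
      ultimately have "(\<kappa> * K powr q) * K powr (2 - q) \<le> (r\<^sup>2 * (3 * (B * G))) * K powr (2 - q)" by (simp add: mult_ac)
      then have "\<kappa> * K powr q \<le> r\<^sup>2 * (3 * (B * G))" using K1 by (subst (asm) mult_le_cancel_right_pos) auto
      then show ?thesis using \<kappa> by (simp add: Q_def pos_le_divide_eq mult_ac)
    qed
    \<comment> \<open>Using only \<open>K \<le> K powr q\<close> gives up a root of
      \<open>Q\<close>, but this exponent is exactly the one claimed for \<open>d\<close>.\<close>
    have "K powr (2 - q) \<le> Q powr (2 - q)"
    proof -
      have "K powr 1 \<le> K powr q" using K1 q by (intro powr_mono) auto
      then have "K \<le> Q" using KQ K1 by simp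
      then show ?thesis using K1 q by (intro powr_mono2) auto
    qed
    then have nrm2: "(\<Sum>i<n. wt u i * (mulA D i)\<^sup>2) \<le> 3 * Q powr (2 - q) * (B * G)"
    proof -
      assume "K powr (2 - q) \<le> Q powr (2 - q)"
      then have "3 * K powr (2 - q) * (B * G) \<le> 3 * Q powr (2 - q) * (B * G)"
        using s0 q0 G by (intro mult_right_mono) (auto simp: B_def)
      with nrm show ?thesis by simp
    qed
    \<comment> \<open>\<open>1920 = 12 * 160\<close>: the starting energy is at most
      \<open>12 / (q - 1) * Q powr (2 - q)\<close> times \<open>s * G\<close>, so the error of the
      potential is at most \<open>s * G / 40\<close>, and at most \<open>s * G / 4\<close> after
      undoing the division by \<open>5 * q\<close>.\<close>
    have k2: "1920 / (q - 1) * Q powr (2 - q) \<le> k\<^sup>2"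
    proof -
      have "(sqrt (1920 / (q - 1)) * Q powr (1 - q / 2))\<^sup>2 \<le> k\<^sup>2"
        using k(1) q0 by (intro power_mono) auto
      moreover have "(Q powr (1 - q / 2))\<^sup>2 = Q powr (2 - q)"
        by (simp add: power2_eq_square powr_add[symmetric])
      ultimately show ?thesis using q0 by (simp add: power_mult_distrib)
    qed
    define H where "H t = (\<Sum>i<n. potential z u i (mulA t i))" for t
    have H: "5 * q * H t = lin t + 5 * Gam t" for t
      unfolding H_def lin_def Gam_def sum_distrib_left sum.distrib[symmetric] potential_def
      by (rule sum.cong) (use q in \<open>auto simp: field_simps\<close>)
    have "k\<^sup>2 / 4 * (H X - H (\<lambda>j. s * D j)) \<le> (\<Sum>i<n. wt u i / 2 * (mulA (\<lambda>j. s * D j) i)\<^sup>2)"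
      using agd[of "\<lambda>j. s * D j"] by (simp add: H_def sum_subtractf)
    also have "\<dots> = s\<^sup>2 / 2 * (\<Sum>i<n. wt u i * (mulA D i)\<^sup>2)"
      unfolding mul_s sum_distrib_left by (rule sum.cong) (auto simp: power_mult_distrib)
    also have "\<dots> \<le> s\<^sup>2 / 2 * (3 * Q powr (2 - q) * (B * G))" using nrm2 by (intro mult_left_mono) auto
    also have "\<dots> = (s * G) * (12 / (q - 1) * Q powr (2 - q))"
      using s0 q0 by (simp add: B_def power2_eq_square field_simps)
    also have "\<dots> \<le> (s * G) * (k\<^sup>2 / 160)"
      using k2 s0 G by (intro mult_left_mono) (auto simp: field_simps)
    finally have *: "k\<^sup>2 / 4 * (H X - H (\<lambda>j. s * D j)) \<le> (s * G) * (k\<^sup>2 / 160)" .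
    have "k\<^sup>2 * (40 * Z) \<le> k\<^sup>2 * (s * G)" if "k\<^sup>2 / 4 * Z \<le> (s * G) * (k\<^sup>2 / 160)" for Z
      using that by (simp add: field_simps)
    from this[OF *] have "k\<^sup>2 * (40 * (H X - H (\<lambda>j. s * D j))) \<le> k\<^sup>2 * (s * G)" .
    then have HX: "40 * (H X - H (\<lambda>j. s * D j)) \<le> s * G" using k(2) by (simp add: mult_le_cancel_left_pos)
    have "5 * q * (H X - H (\<lambda>j. s * D j)) \<le> s * G / 4"
    proof (cases "0 \<le> H X - H (\<lambda>j. s * D j)")
      case True
      have "5 * q * (H X - H (\<lambda>j. s * D j)) \<le> 10 * (H X - H (\<lambda>j. s * D j))"
        using True q by (intro mult_right_mono) auto
      then show ?thesis using HX by simp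
    next
      case False
      have "5 * q * (H X - H (\<lambda>j. s * D j)) \<le> 0" using False q by (intro mult_nonneg_nonpos) auto
      moreover have "0 \<le> s * G / 4" using s0 G by simp
      ultimately show ?thesis by linarith
    qed
    then have "lin X + 5 * Gam X \<le> lin (\<lambda>j. s * D j) + 5 * Gam (\<lambda>j. s * D j) + s * G / 4"
      using H[of X] H[of "\<lambda>j. s * D j"] right_diff_distrib[of "5 * q" "H X" "H (\<lambda>j. s * D j)"] by linarith
    also have "\<dots> \<le> s * lin D + s * ((q - 1) / 4) * Gam D + s * G / 4"
      using Gam_s[of D] by (simp add: lin_s)
    also have "\<dots> \<le> s * (- Gt) + s * G / 4"
    proof -
      have "0 \<le> (q - 1) / 4 * Gam D" using q0 Gam0 by simp
      then have "lin D + (q - 1) / 4 * Gam D \<le> - Gt" using low by simp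
      then have "s * (lin D + (q - 1) / 4 * Gam D) \<le> s * (- Gt)" using s0 by (intro mult_left_mono) auto
      moreover have "s * (lin D + (q - 1) / 4 * Gam D) = s * lin D + s * ((q - 1) / 4) * Gam D"
        by (simp only: distrib_left mult.assoc)
      ultimately show ?thesis by linarith
    qed
    finally have "lin X + 5 * Gam X \<le> s * (- Gt) + s * G / 4" .
    then have "cost (\<lambda>j. x j + X j) - cost x \<le> s * (- Gt) + s * G / 2" using upper[of X] E by simp
    then have "cost (\<lambda>j. x j + X j) - cost y \<le> (1 - s) * Gt + s * G / 2" by (simp add: Gt_def algebra_simps)
    also have "\<dots> \<le> (1 - s) * G + s * G / 2" using Gt s0 by (intro add_right_mono mult_left_mono) auto
    also have "\<dots> = (1 - s / 2) * G" by (simp add: algebra_simps)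
    finally show ?thesis .
  qed
  show ?thesis
  proof (cases "cost y \<le> cost x")
    case True
    then show ?thesis by (rule main)
  next
    case False
    then show ?thesis using main[of x] by simp
  qed
qed

text \<open>The exact map \<open>u \<mapsto> max zf (sqrt (\<kappa> * lev (wt u)))\<close> halves logarithmic ratios, which is why estimates that are
  correct up to the factor \<open>N\<close> suffice for a fixed point up to \<open>N\<close>.\<close>

definition refine :: "(nat \<Rightarrow> real) \<Rightarrow> real \<Rightarrow> real \<Rightarrow> (nat \<Rightarrow> real) \<Rightarrow> (nat \<Rightarrow> real) \<Rightarrow> bool" where
  "refine zf \<kappa> N u u' \<longleftrightarrow> (\<forall>i<n. \<exists>est. lev (wt u) i \<le> est \<and> est \<le> N * lev (wt u) i \<and> u' i = max (zf i) (sqrt (\<kappa> * est)))"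

definition ratio :: "real \<Rightarrow> (nat \<Rightarrow> real) \<Rightarrow> (nat \<Rightarrow> real) \<Rightarrow> bool" where
  "ratio \<rho> u u' \<longleftrightarrow> (\<forall>i<n. u i \<le> \<rho> * u' i \<and> u' i \<le> \<rho> * u i)"

text \<open>Weights decrease with the scales, with exponent \<open>2 - q\<close>, which is below 1;
  the factor \<open>\<rho> powr (2 - q)\<close> is therefore at most \<open>\<rho>\<close>.\<close>

lemma lev_wt_le:
  assumes u: "\<And>i. i < n \<Longrightarrow> 0 < u i" "\<And>i. i < n \<Longrightarrow> 0 < u' i" and le: "\<And>i. i < n \<Longrightarrow> u i \<le> \<rho> * u' i" and \<rho>: "1 \<le> \<rho>"
  shows "lev (wt u) i \<le> \<rho> * lev (wt u') i"
proof -
  have "wt u' k \<le> \<rho> * wt u k" if "k < n" for k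
  proof -
    have "(\<rho> * u' k) powr (q - 2) \<le> u k powr (q - 2)" using u le[OF that] that q by (intro powr_mono2') auto
    then have "\<rho> powr (q - 2) * u' k powr (q - 2) \<le> u k powr (q - 2)" using \<rho> u(2)[OF that] by (simp add: powr_mult)
    then have "\<rho> powr (2 - q) * (\<rho> powr (q - 2) * u' k powr (q - 2)) \<le> \<rho> powr (2 - q) * u k powr (q - 2)"
      by (intro mult_left_mono) auto
    moreover have "\<rho> powr (2 - q) * \<rho> powr (q - 2) = 1" using \<rho> by (simp add: powr_add[symmetric])
    ultimately have "u' k powr (q - 2) \<le> \<rho> powr (2 - q) * u k powr (q - 2)" by (simp add: mult.assoc[symmetric])
    also have "\<dots> \<le> \<rho> powr 1 * u k powr (q - 2)" using \<rho> q by (intro mult_right_mono powr_mono) auto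
    finally show ?thesis using \<rho> by (simp add: wt_def)
  qed
  then show ?thesis using \<rho> by (intro lev_mono wt_pos u) auto
qed

lemma refine_pos: "refine zf \<kappa> N u u' \<Longrightarrow> (\<And>i. i < n \<Longrightarrow> 0 < zf i) \<Longrightarrow> i < n \<Longrightarrow> 0 < u' i"
  unfolding refine_def by (force simp: less_max_iff_disj)

lemma refine_le:
  assumes "refine zf \<kappa> N u u'" "refine zf \<kappa> N v v'" and pos: "\<And>i. i < n \<Longrightarrow> 0 < u i" "\<And>i. i < n \<Longrightarrow> 0 < v i" "\<And>i. i < n \<Longrightarrow> 0 < zf i"
    and le: "\<And>i. i < n \<Longrightarrow> u i \<le> \<rho> * v i" and "1 \<le> \<rho>" "1 \<le> N" "0 < \<kappa>" and i: "i < n"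
  shows "u' i \<le> sqrt (N * \<rho>) * v' i"
proof -
  obtain e where e: "e \<le> N * lev (wt u) i" "u' i = max (zf i) (sqrt (\<kappa> * e))"
    using assms(1) i by (auto simp: refine_def)
  obtain e' where e': "lev (wt v) i \<le> e'" "v' i = max (zf i) (sqrt (\<kappa> * e'))"
    using assms(2) i by (auto simp: refine_def)
  have "lev (wt u) i \<le> \<rho> * lev (wt v) i" by (rule lev_wt_le) (use assms in auto)
  also have "\<dots> \<le> \<rho> * e'" using e'(1) assms by simp
  finally have "N * lev (wt u) i \<le> N * (\<rho> * e')" using assms by (intro mult_left_mono) auto
  with e(1) have "e \<le> N * (\<rho> * e')" by linarith
  then have "\<kappa> * e \<le> \<kappa> * (N * (\<rho> * e'))" using assms by (intro mult_left_mono) auto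
  also have "\<dots> = (N * \<rho>) * (\<kappa> * e')" by (simp add: mult_ac)
  finally have "sqrt (\<kappa> * e) \<le> sqrt ((N * \<rho>) * (\<kappa> * e'))" by (rule real_sqrt_le_mono)
  also have "\<dots> = sqrt (N * \<rho>) * sqrt (\<kappa> * e')" by (rule real_sqrt_mult)
  also have "\<dots> \<le> sqrt (N * \<rho>) * v' i" using e'(2) assms by (intro mult_left_mono) auto
  finally have 1: "sqrt (\<kappa> * e) \<le> sqrt (N * \<rho>) * v' i" .
  have "1 * 1 \<le> N * \<rho>" using assms by (intro mult_mono) auto
  then have "1 \<le> sqrt (N * \<rho>)" by simp
  then have "1 * zf i \<le> sqrt (N * \<rho>) * v' i" using e'(2) pos(3)[OF i] by (intro mult_mono) auto
  with 1 show ?thesis using e(2) by simp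
qed

lemma refine_ratio:
  assumes "refine zf \<kappa> N u u'" "refine zf \<kappa> N u' u''" "\<And>i. i < n \<Longrightarrow> 0 < u i" "\<And>i. i < n \<Longrightarrow> 0 < zf i"
    "ratio \<rho> u u'" "1 \<le> \<rho>" "1 \<le> N" "0 < \<kappa>"
  shows "ratio (sqrt (N * \<rho>)) u' u''"
proof -
  have u': "\<And>i. i < n \<Longrightarrow> 0 < u' i" using refine_pos[OF assms(1,4)] by blast
  show ?thesis unfolding ratio_def
  proof (intro allI impI conjI)
    fix i assume i: "i < n"
    show "u' i \<le> sqrt (N * \<rho>) * u'' i"
      by (rule refine_le[OF assms(1,2,3) u' assms(4) _ assms(6-8) i]) (use assms(5) in \<open>auto simp: ratio_def\<close>)
    show "u'' i \<le> sqrt (N * \<rho>) * u' i"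
      by (rule refine_le[OF assms(2,1) u' assms(3,4) _ assms(6-8) i]) (use assms(5) in \<open>auto simp: ratio_def\<close>)
  qed
qed

text \<open>A scale that is neither \<open>\<bar>z i\<bar>\<close> nor the floor satisfies
  \<open>(u i) ^ 2 = \<kappa> * e\<close>. Multiplied by the weight, this bounds
  \<open>u i powr q\<close> by a multiple of weight times leverage, and these products sum to
  \<open>d\<close>.\<close>

lemma refine_final:
  assumes ref: "refine zf \<kappa> N u0 u" and u0: "\<And>i. i < n \<Longrightarrow> 0 < u0 i" and zf: "\<And>i. i < n \<Longrightarrow> zf i = max \<bar>z i\<bar> fl" and fl: "0 < fl"
    and rat: "ratio r u0 u" and r: "1 \<le> r" and N: "1 \<le> N" and \<kappa>: "0 < \<kappa>"
  shows "i < n \<Longrightarrow> 0 < u i" "i < n \<Longrightarrow> \<bar>z i\<bar> \<le> u i" "i < n \<Longrightarrow> \<kappa> * lev (wt u) i \<le> r\<^sup>2 * (u i)\<^sup>2"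
    "(\<Sum>i<n. if u i = \<bar>z i\<bar> then 0 else u i powr q) \<le> real n * fl powr q + N * r * \<kappa> * real d"
proof -
  have zf0: "0 < zf i" if "i < n" for i using zf[OF that] fl by simp
  have up: "0 < u i" if "i < n" for i using refine_pos[OF ref zf0 that] .
  then show "i < n \<Longrightarrow> 0 < u i" .
  have le1: "\<And>i. i < n \<Longrightarrow> u i \<le> r * u0 i" and le2: "\<And>i. i < n \<Longrightarrow> u0 i \<le> r * u i"
    using rat by (auto simp: ratio_def)
  show "i < n \<Longrightarrow> \<bar>z i\<bar> \<le> u i" using ref zf[of i] by (auto simp: refine_def)
  show "\<kappa> * lev (wt u) i \<le> r\<^sup>2 * (u i)\<^sup>2" if i: "i < n"
  proof -
    obtain e where e: "lev (wt u0) i \<le> e" "u i = max (zf i) (sqrt (\<kappa> * e))"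
      using ref i by (auto simp: refine_def)
    have e0: "0 \<le> e" using e(1) lev_nonneg[where w = "wt u0", OF wt_pos[where u = u0, OF u0], of i] by simp
    have "lev (wt u) i \<le> r * lev (wt u0) i" by (rule lev_wt_le) (use up u0 le1 r in auto)
    also have "\<dots> \<le> r * e" using e(1) r by simp
    finally have "\<kappa> * lev (wt u) i \<le> \<kappa> * (r * e)" using \<kappa> by simp
    also have "\<dots> = r * (sqrt (\<kappa> * e))\<^sup>2" using e0 \<kappa> by simp
    also have "\<dots> \<le> r * (u i)\<^sup>2" using e(2) r e0 \<kappa> by (intro mult_left_mono power_mono) auto
    also have "\<dots> \<le> r\<^sup>2 * (u i)\<^sup>2" using r by (intro mult_right_mono) (auto simp: power2_eq_square)
    finally show ?thesis .
  qed
  have "(if u i = \<bar>z i\<bar> then 0 else u i powr q) \<le> fl powr q + N * r * \<kappa> * (wt u i * lev (wt u) i)" if i: "i < n" for i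
  proof -
    have ln: "0 \<le> wt u i * lev (wt u) i"
      using wt_pos[where u = u, OF up, OF i] lev_nonneg[where w = "wt u", OF wt_pos[where u = u, OF up], of i] by simp
    have rhs: "0 \<le> N * r * \<kappa> * (wt u i * lev (wt u) i)" using ln N r \<kappa> by simp
    obtain e where e: "lev (wt u0) i \<le> e" "e \<le> N * lev (wt u0) i" "u i = max (zf i) (sqrt (\<kappa> * e))"
      using ref i by (auto simp: refine_def)
    have e0: "0 \<le> e" using e(1) lev_nonneg[where w = "wt u0", OF wt_pos[where u = u0, OF u0], of i] by simp
    consider "u i = \<bar>z i\<bar>" | "u i = fl" | "u i = sqrt (\<kappa> * e)" using e(3) zf[OF i] by (auto simp: max_def split: if_splits)
    then show ?thesis
    proof cases
      case 1
      then show ?thesis using rhs by simp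
    next
      case 2
      then show ?thesis using rhs by simp
    next
      case 3
      have "u i powr q = wt u i * (u i)\<^sup>2" using up[OF i] powr_add[of "u i" "q - 2" 2] by (simp add: wt_def)
      also have "(u i)\<^sup>2 = \<kappa> * e" using 3 e0 \<kappa> by simp
      also have "wt u i * (\<kappa> * e) \<le> wt u i * (\<kappa> * (N * (r * lev (wt u) i)))"
      proof -
        have "lev (wt u0) i \<le> r * lev (wt u) i" by (rule lev_wt_le) (use up u0 le2 r in auto)
        then have "N * lev (wt u0) i \<le> N * (r * lev (wt u) i)" using N by (intro mult_left_mono) auto
        with e(2) have "e \<le> N * (r * lev (wt u) i)" by linarith
        then show ?thesis using \<kappa> wt_pos[where u = u, OF up, OF i] by (intro mult_left_mono) auto
      qed
      also have "\<dots> = N * r * \<kappa> * (wt u i * lev (wt u) i)" by (simp add: mult_ac)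
      finally have "u i powr q \<le> N * r * \<kappa> * (wt u i * lev (wt u) i)" .
      moreover have "0 \<le> fl powr q" by simp
      ultimately have "u i powr q \<le> fl powr q + N * r * \<kappa> * (wt u i * lev (wt u) i)" by linarith
      then show ?thesis using rhs by (auto intro: add_nonneg_nonneg)
    qed
  qed
  then have "(\<Sum>i<n. if u i = \<bar>z i\<bar> then 0 else u i powr q) \<le> (\<Sum>i<n. fl powr q + N * r * \<kappa> * (wt u i * lev (wt u) i))"
    by (intro sum_mono) auto
  also have "\<dots> = real n * fl powr q + N * r * \<kappa> * real d"
    using sum_weight_lev[where w = "wt u", OF wt_pos[where u = u, OF up]] by (simp add: sum.distrib sum_distrib_left[symmetric])
  finally show "(\<Sum>i<n. if u i = \<bar>z i\<bar> then 0 else u i powr q) \<le> real n * fl powr q + N * r * \<kappa> * real d" .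
qed

end

section \<open>The algorithm and its parameters\<close>

abbreviation exp_plus (infixl "+." 65) where "a +. b \<equiv> Bin Plus a b"
abbreviation exp_minus (infixl "-." 65) where "a -. b \<equiv> Bin Minus a b"
abbreviation exp_times (infixl "*." 70) where "a *. b \<equiv> Bin Times a b"
abbreviation exp_div (infixl "'/." 70) where "a /. b \<equiv> Bin Divide a b"
abbreviation exp_pow (infixr "^." 80) where "a ^. b \<equiv> Bin Power a b"

text \<open>\<open>Power\<close> takes the absolute value of its base, so the exponent 1 yields
  \<open>\<bar>a - b\<bar>\<close>, and the maximum is half of
  \<open>a + b + \<bar>a - b\<bar>\<close>.\<close>

definition exp_max :: "exp \<Rightarrow> exp \<Rightarrow> exp" where
  "exp_max a b = (a +. b +. (a -. b) ^. Const 1) /. Const 2"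

definition exp_theta :: exp where
  "exp_theta = Const 2 /. (Scal 15 +. Const 2)"

text \<open>Scalar variables: 0 \<open>L\<close>, 1 \<open>2^L\<close>, 3 \<open>s\<close>, 4 \<open>c\<close>, 5 \<open>\<Lambda>\<close>, 6 number of samples, 7 \<open>N\<close>, 8 \<open>r\<close>,
  9 initial cost, 10 final gap, 11 gap \<open>G\<close>, 12 number of accelerated steps, 13 \<open>\<kappa>\<close>, 14 and 15 loop
  counters, 16 \<open>L + 1\<close>, 17 lower bound for the scales, 18 initial scale.
  Vector variables: 0 \<open>x\<close>, 1 residual, 2 \<open>b\<close>, 3 scales \<open>u\<close>, 4 weights, 5 random signs, 6 and 7 temporary,
  8 solution of the linear system, 9 leverage estimates, 10 to 12 accelerated iterates.\<close>

definition log_com :: com where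
  "log_com = prims [LoadRhs 2, SAssign 2 (DimRow *. (Const 1 +. Const 1 /. InEps)), SAssign 1 (Const 1), SAssign 0 (Const 0)] ;;
     WhileLess (2 * 1) (2 * 2) (prims [SAssign 1 (Scal 1 *. Const 2), SAssign 0 (Scal 0 +. Const 1)])"

definition steps_exp :: exp where
  "steps_exp = (Const 1920 /. (InQ -. Const 1)) ^. (Const 1 /. Const 2) *.
     (Const 3 *. (Const 8 /. ((InQ -. Const 1) *. Scal 3)) *. Scal 8 *. Scal 8 *. Scal 8 *. Scal 7 *. DimCol /. Scal 4)
       ^. (Const 1 -. InQ /. Const 2)"

text \<open>The constant \<open>D\<close> is the only trace of the demanded failure probability in
  the program; it scales the number of samples.\<close>

definition setup_com :: "nat \<Rightarrow> com" where
  "setup_com D =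
     prims [SAssign 3 (((InQ -. Const 1) /. Const 20) ^. (Const 1 /. (InQ -. Const 1)))] ;;
     prims [SAssign 4 (Scal 3 /. Const 16), SAssign 5 (Const D *. (Scal 0 +. Const 1 /. Scal 3)), SAssign 6 (Const 10 *. Scal 5)] ;;
     prims [SAssign 7 (Const 4 *. (Scal 6 +. Const 1) *. Scal 5)] ;;
     prims [SAssign 8 (Const 2 *. Scal 7 /. Scal 4)] ;;
     prims [SAssign 12 steps_exp] ;;
     prims [VAssign 4 (Const 1), TransMul 7 2, SolveGram 4 7 0, MatMul 1 0, VAssign 1 (Comp 1 -. Comp 2),
       VAssign 6 (Comp 1 ^. InQ), SSum 9 6,
       SAssign 10 (Scal 9 /. Scal 1), SAssign 11 (Scal 9), SAssign 18 (Scal 9 ^. (Const 1 /. InQ))]"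

text \<open>With the factor 2, a single sample whose square is at least half of the leverage makes
  the estimate large enough. Squares are added up, so later samples cannot spoil a lower
  bound.\<close>

definition sample_prims :: "prim list" where
  "sample_prims =
    [VAssign 6 (Comp 4 ^. (Const 1 /. Const 2) *. Comp 5), TransMul 7 6, SolveGram 4 7 8, MatMul 6 8,
     VAssign 9 (Comp 9 +. Const 2 *. Comp 6 *. Comp 6), SAssign 15 (Scal 15 +. Const 1)]"

definition refine_com :: com where
  "refine_com = prims [VAssign 4 (Comp 3 ^. (InQ -. Const 2)), VAssign 9 (Const 0), SAssign 15 (Const 0)] ;;
     WhileLess (2 * 15) (2 * 6) (rand_code 5 ;; prims sample_prims) ;;
     prims [VAssign 3 (exp_max (exp_max (Comp 1 ^. Const 1) (Scal 17)) ((Scal 13 *. Comp 9) ^. (Const 1 /. Const 2))),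
       SAssign 14 (Scal 14 +. Const 1)]"

definition agd_prims :: "prim list" where
  "agd_prims =
    [VAssign 12 ((Const 1 -. exp_theta) *. Comp 10 +. exp_theta *. Comp 11),
     MatMul 6 12,
     VAssign 6 (Comp 1 ^. (InQ -. Const 2) *. Comp 1 /. Const 5
       +. (Comp 3 *. Comp 3 +. Comp 6 *. Comp 6) ^. (InQ /. Const 2 -. Const 1) *. Comp 6),
     TransMul 7 6, SolveGram 4 7 8,
     VAssign 11 (Comp 11 -. (Scal 15 +. Const 1) /. Const 2 *. Comp 8),
     VAssign 10 ((Const 1 -. exp_theta) *. Comp 10 +. exp_theta *. Comp 11),
     SAssign 15 (Scal 15 +. Const 1)]"

definition phase_com :: com where
  "phase_com = prims
      [SAssign 17 ((Scal 4 *. Scal 11 /. DimRow) ^. (Const 1 /. InQ)),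
       SAssign 13 (Scal 4 *. Scal 11 /. (Scal 7 *. Scal 8 *. DimCol)),
       VAssign 3 (Scal 18), SAssign 14 (Const 0), SAssign 16 (Scal 0 +. Const 1)] ;;
    WhileLess (2 * 14) (2 * 16) refine_com ;;
    prims [VAssign 4 (Comp 3 ^. (InQ -. Const 2)), VAssign 10 (Const 0), VAssign 11 (Const 0), SAssign 15 (Const 0)] ;;
    WhileLess (2 * 15) (2 * 12) (prims agd_prims) ;;
    prims [VAssign 0 (Comp 0 +. Comp 10), MatMul 1 0, VAssign 1 (Comp 1 -. Comp 2),
      SAssign 11 (Scal 11 *. (Const 1 -. Scal 3 /. Const 2))]"

definition main_com :: "nat \<Rightarrow> com" where
  "main_com D = log_com ;; setup_com D ;; WhileLess (2 * 10) (2 * 11) phase_com"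

locale algorithm = regression +
  fixes D :: nat
  assumes D: "1 \<le> D"
begin

text \<open>The number of doublings found by \<open>log_com\<close>; \<open>2 ^ Lg\<close> dominates
  both \<open>n\<close> and \<open>n / \<epsilon>\<close>.\<close>

definition Lg :: nat where "Lg = (LEAST l. real n * (1 + 1 / \<epsilon>) \<le> 2 ^ l)"
definition sP :: real where "sP = ((q - 1) / 20) powr (1 / (q - 1))"
text \<open>The floors and the enlarged leverages each contribute \<open>cP * G\<close> to the sum
  of enlarged scales; twice their total is then the \<open>sP * G / 4\<close> that a phase
  tolerates.\<close>

definition cP :: real where "cP = sP / 16"
text \<open>Controls the failure probability through \<open>exp (- Lam)\<close>. The summand
  \<open>1 / sP\<close> makes the number of phases polynomial in \<open>Lam\<close>, whatever
  \<open>q\<close> is.\<close>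

definition Lam :: real where "Lam = real D * (real Lg + 1 / sP)"
text \<open>At most \<open>10 * Lam + 1\<close> samples, each adding at most
  \<open>2 * (2 * Lam)\<close> times the leverage.\<close>

definition NN :: real where "NN = 4 * (10 * Lam + 1) * Lam"
text \<open>Bound for the ratio of the last two scales: \<open>NN\<close> is the fixed point of
  \<open>\<rho> \<mapsto> sqrt (NN * \<rho>)\<close>, and the initial ratio has shrunk to at most
  \<open>2 / cP\<close>.\<close>

definition rr :: real where "rr = 2 * NN / cP"
text \<open>The quantity \<open>Q\<close> of \<open>phase_progress\<close> for the chosen
  \<open>\<kappa>\<close>, in which \<open>G\<close> cancels.\<close>

definition QQ :: real where "QQ = 3 * (8 / ((q - 1) * sP)) * rr * rr * rr * NN * real d / cP"
definition kmax :: real where "kmax = (1920 / (q - 1)) powr (1 / 2) * QQ powr (1 - q / 2)"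
definition x0 :: "nat \<Rightarrow> real" where "x0 = sol (\<lambda>_. 1) (mulT (vec_index b))"
definition F0 :: real where "F0 = cost x0"

lemma Lg_props: "real n * (1 + 1 / \<epsilon>) \<le> 2 ^ Lg" "1 \<le> Lg" "2 ^ j < real n * (1 + 1 / \<epsilon>) \<Longrightarrow> j < Lg"
proof -
  obtain l where "real n * (1 + 1 / \<epsilon>) < 2 ^ l" using real_arch_pow[of 2] by auto
  then have ex: "real n * (1 + 1 / \<epsilon>) \<le> 2 ^ l" by simp
  show 1: "real n * (1 + 1 / \<epsilon>) \<le> 2 ^ Lg" unfolding Lg_def by (rule LeastI[of _ l]) (rule ex)
  show 2: "j < Lg" if "2 ^ j < real n * (1 + 1 / \<epsilon>)" for j
  proof (rule ccontr)
    assume "\<not> j < Lg"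
    then have "(2::real) ^ Lg \<le> 2 ^ j" by (intro power_increasing) auto
    with 1 that show False by linarith
  qed
  have "1 * 1 < real n * (1 + 1 / \<epsilon>)" using n_pos eps by (intro mult_le_less_imp_less) auto
  then show "1 \<le> Lg" using 2[of 0] by simp
qed

lemma n_le_pow: "real n \<le> 2 ^ Lg" "real n / \<epsilon> \<le> 2 ^ Lg"
proof -
  have "real n * (1 + 1 / \<epsilon>) = real n + real n / \<epsilon>" by (simp add: algebra_simps)
  moreover have "0 \<le> real n / \<epsilon>" "0 \<le> real n" using eps by auto
  ultimately show "real n \<le> 2 ^ Lg" "real n / \<epsilon> \<le> 2 ^ Lg" using Lg_props(1) by linarith+
qed

lemma sP_props: "0 < sP" "sP \<le> (q - 1) / 20" "sP \<le> 1 / 20" "20 \<le> 1 / sP"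
proof -
  show 1: "0 < sP" using q by (simp add: sP_def)
  have "((q - 1) / 20) powr (1 / (q - 1)) \<le> ((q - 1) / 20) powr 1" using q by (intro powr_mono') auto
  then show 2: "sP \<le> (q - 1) / 20" using q by (simp add: sP_def)
  then show "sP \<le> 1 / 20" using q by simp
  then show "20 \<le> 1 / sP" using 1 by (simp add: field_simps)
qed

lemma param_props: "0 < cP" "cP \<le> 1" "20 \<le> Lam" "1 \<le> NN" "1 \<le> rr"
proof -
  show c: "0 < cP" "cP \<le> 1" using sP_props by (auto simp: cP_def)
  have "1 * 20 \<le> real D * (real Lg + 1 / sP)" using D sP_props by (intro mult_mono) auto
  then show L: "20 \<le> Lam" by (simp add: Lam_def)
  have "1 * 1 \<le> (4 * (10 * Lam + 1)) * Lam" using L by (intro mult_mono) auto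
  then show N: "1 \<le> NN" by (simp add: NN_def)
  then have "1 * cP \<le> 2 * NN" using c by simp
  then show "1 \<le> rr" using c by (simp add: rr_def)
qed

definition K :: "scalars \<Rightarrow> vectors \<Rightarrow> bool" where
  "K S V \<longleftrightarrow> S 0 = real Lg \<and> S 3 = sP \<and> S 4 = cP \<and> S 5 = Lam \<and> S 6 = 10 * Lam \<and> S 7 = NN \<and> S 8 = rr \<and> S 9 = F0 \<and>
     S 10 = F0 / 2 ^ Lg \<and> S 12 = kmax \<and> S 18 = F0 powr (1 / q) \<and> V 2 = vec_index b"

lemma sol_cong:
  assumes "\<And>i. i < n \<Longrightarrow> w i = w' i" "\<And>j. j < d \<Longrightarrow> v j = v' j"
  shows "sol w v = sol w' v'"
proof -
  have "vec n w = vec n w'" "vec d v = vec d v'" using assms by auto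
  then show ?thesis by (simp add: sol_def fun_eq_iff)
qed

lemma mulT_cong: "(\<And>i. i < n \<Longrightarrow> y i = y' i) \<Longrightarrow> mulT y j = mulT y' j"
  unfolding mulT_def by (rule sum.cong) auto

lemma resid_cong: "(\<And>j. j < d \<Longrightarrow> x j = y j) \<Longrightarrow> resid x i = resid y i"
  unfolding resid_def using mulA_cong[of x y i] by simp

lemma cost_cong: "(\<And>j. j < d \<Longrightarrow> x j = y j) \<Longrightarrow> cost x = cost y"
  unfolding cost_def using resid_cong[of x y] by simp

lemma log_correct:
  "hoare (real Lg * 3 + 5) 0 (\<lambda>S V. True) log_com (\<lambda>S V. S 0 = real Lg \<and> S 1 = 2 ^ Lg \<and> V 2 = vec_index b)"
proof -
  define I where "I j S V \<longleftrightarrow> S 0 = real j \<and> S 1 = 2 ^ j \<and> S 2 = real n * (1 + 1 / \<epsilon>) \<and> V 2 = vec_index b \<and>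
    (\<forall>l<j. 2 ^ l < real n * (1 + 1 / \<epsilon>))" for j :: nat and S :: scalars and V :: vectors
  have 1: "hoare 4 0 (\<lambda>S V. True)
      (prims [LoadRhs 2, SAssign 2 (DimRow *. (Const 1 +. Const 1 /. InEps)), SAssign 1 (Const 1), SAssign 0 (Const 0)]) (I 0)"
    by (rule hoare_prims) (auto simp: I_def)
  have 2: "hoare 2 0 (\<lambda>S V. I j S V \<and> S 1 < S 2) (prims [SAssign 1 (Scal 1 *. Const 2), SAssign 0 (Scal 0 +. Const 1)]) (I (Suc j))" for j
    by (rule hoare_prims) (auto simp: I_def less_Suc_eq)
  have 3: "hoare (real Lg * (2 + 1) + 1) (real Lg * 0) (I 0)
      (WhileLess (2 * 1) (2 * 2) (prims [SAssign 1 (Scal 1 *. Const 2), SAssign 0 (Scal 0 +. Const 1)]))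
      (\<lambda>S V. \<exists>j. I j S V \<and> \<not> S 1 < S 2)"
    by (rule hoare_while[where I = I and a = 1 and b' = 2, OF _ _ _ _ 2]) (auto simp: I_def Lg_props(3))
  have e: "S 0 = real Lg \<and> S 1 = 2 ^ Lg \<and> V 2 = vec_index b" if h: "\<exists>j. I j S V \<and> \<not> S 1 < S 2" for S V
  proof -
    obtain j where j: "I j S V" "\<not> S 1 < S 2" using h by blast
    have "real n * (1 + 1 / \<epsilon>) \<le> 2 ^ j" using j by (simp add: I_def)
    then have "Lg \<le> j" unfolding Lg_def by (rule Least_le)
    moreover have "\<not> Lg < j" using j(1) Lg_props(1) by (force simp: I_def)
    ultimately have "j = Lg" by simp
    then show ?thesis using j(1) by (simp add: I_def)
  qed
  show ?thesis unfolding log_com_def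
    by (rule hoare_conseq[OF hoare_seq[OF 1 3]]) (use e in auto)
qed

lemma steps_exp_val:
  assumes "S 3 = sP" "S 4 = cP" "S 7 = NN" "S 8 = rr"
  shows "exp_val S v steps_exp = kmax"
proof -
  have "0 \<le> QQ" using param_props sP_props q by (simp add: QQ_def)
  then have 1: "\<bar>3 * (8 / ((q - 1) * sP)) * rr * rr * rr * NN * real d / cP\<bar> = QQ"
    unfolding QQ_def[symmetric] by (rule abs_of_nonneg)
  have 2: "\<bar>1920 / (q - 1)\<bar> = 1920 / (q - 1)" using q by simp
  show ?thesis
    unfolding steps_exp_def exp_val.simps binop_sem.simps assms of_nat_numeral of_nat_1 1 2 kmax_def ..
qed

lemma setup_correct:
  "hoare 17 0 (\<lambda>S V. S 0 = real Lg \<and> S 1 = 2 ^ Lg \<and> V 2 = vec_index b) (setup_com D)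
    (\<lambda>S V. K S V \<and> S 11 = F0 \<and> (\<forall>j<d. V 0 j = x0 j) \<and> (\<forall>i<n. V 1 i = resid x0 i))"
proof -
  define P0 where "P0 S V \<longleftrightarrow> S 0 = real Lg \<and> S 1 = 2 ^ Lg \<and> V 2 = vec_index b" for S :: scalars and V :: vectors
  define P1 where "P1 S V \<longleftrightarrow> P0 S V \<and> S 3 = sP" for S V
  define P2 where "P2 S V \<longleftrightarrow> P1 S V \<and> S 4 = cP \<and> S 5 = Lam \<and> S 6 = 10 * Lam" for S V
  define P3 where "P3 S V \<longleftrightarrow> P2 S V \<and> S 7 = NN" for S V
  define P4 where "P4 S V \<longleftrightarrow> P3 S V \<and> S 8 = rr" for S V
  define P5 where "P5 S V \<longleftrightarrow> P4 S V \<and> S 12 = kmax" for S V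
  have s1: "\<bar>(q - 1) / 20\<bar> = (q - 1) / 20" using q by auto
  have 1: "hoare 1 0 P0 (prims [SAssign 3 (((InQ -. Const 1) /. Const 20) ^. (Const 1 /. (InQ -. Const 1)))]) P1"
    by (rule hoare_prims) (use s1 in \<open>auto simp: P1_def P0_def sP_def simp del: abs_divide\<close>)
  have 2: "hoare 3 0 P1 (prims [SAssign 4 (Scal 3 /. Const 16), SAssign 5 (Const D *. (Scal 0 +. Const 1 /. Scal 3)), SAssign 6 (Const 10 *. Scal 5)]) P2"
    by (rule hoare_prims) (auto simp: P2_def P1_def P0_def cP_def Lam_def)
  have 3: "hoare 1 0 P2 (prims [SAssign 7 (Const 4 *. (Scal 6 +. Const 1) *. Scal 5)]) P3"
    by (rule hoare_prims) (auto simp: P3_def P2_def P1_def P0_def NN_def)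
  have 4: "hoare 1 0 P3 (prims [SAssign 8 (Const 2 *. Scal 7 /. Scal 4)]) P4"
    by (rule hoare_prims) (auto simp: P4_def P3_def P2_def P1_def P0_def rr_def)
  have wf: "exp_wf 0 steps_exp \<and> exp_scalar steps_exp \<and> exp_nodes steps_exp \<le> 100" by (simp add: steps_exp_def)
  have 5: "hoare 1 0 P4 (prims [SAssign 12 steps_exp]) P5"
    by (rule hoare_prims) (use wf steps_exp_val in \<open>auto simp: P5_def P4_def P3_def P2_def P1_def P0_def\<close>)
  let ?ps = "[VAssign 4 (Const 1), TransMul 7 2, SolveGram 4 7 0, MatMul 1 0, VAssign 1 (Comp 1 -. Comp 2),
       VAssign 6 (Comp 1 ^. InQ), SSum 9 6,
       SAssign 10 (Scal 9 /. Scal 1), SAssign 11 (Scal 9), SAssign 18 (Scal 9 ^. (Const 1 /. InQ))]"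
  let ?Post = "\<lambda>S V. K S V \<and> S 11 = F0 \<and> (\<forall>j<d. V 0 j = x0 j) \<and> (\<forall>i<n. V 1 i = resid x0 i)"
  have 6: "hoare 10 0 P5 (prims ?ps) ?Post"
  proof (rule hoare_prims)
    fix S :: scalars and V :: vectors assume h: "P5 S V"
    have x: "sol (\<lambda>_. 1) (\<lambda>j. if j < d then mulT (vec_index b) j else 0) = x0"
      unfolding x0_def by (rule sol_cong) auto
    have m: "mulA (\<lambda>j. if j < d then x0 j else y j) i = mulA x0 i" for y i by (rule mulA_cong) simp
    have F: "(\<Sum>i<n. \<bar>mulA x0 i - vec_index b i\<bar> powr q) = F0" by (simp add: F0_def cost_def resid_def)
    have F1: "\<bar>F0\<bar> = F0" unfolding F0_def cost_def by (simp add: sum_nonneg)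
    show "prims_ok ?ps (S, V) \<and> (case prims_sem ?ps (S, V) of (S', V') \<Rightarrow> ?Post S' V')"
      using h by (simp add: P5_def P4_def P3_def P2_def P1_def P0_def x m F F1 K_def resid_def cong: if_cong)
  qed simp
  show ?thesis unfolding setup_com_def
    by (rule hoare_conseq[OF hoare_seq[OF 1 hoare_seq[OF 2 hoare_seq[OF 3 hoare_seq[OF 4 hoare_seq[OF 5 6]]]]]])
      (auto simp: P0_def)
qed

end

section \<open>Sampling of leverage scores\<close>

context algorithm begin

definition M :: "real \<Rightarrow> real \<Rightarrow> real \<Rightarrow> (nat \<Rightarrow> real) \<Rightarrow> (nat \<Rightarrow> real) \<Rightarrow> scalars \<Rightarrow> vectors \<Rightarrow> bool" where
  "M G fl \<kappa> x z S V \<longleftrightarrow> K S V \<and> S 11 = G \<and> S 17 = fl \<and> S 13 = \<kappa> \<and> S 16 = real Lg + 1 \<and> V 0 = x \<and> V 1 = z"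

lemma M_cong:
  assumes "M G fl \<kappa> x z S V" "\<And>a. a \<notin> {1, 2, 14, 15} \<Longrightarrow> S' a = S a" "V' 0 = V 0" "V' 1 = V 1" "V' 2 = V 2"
  shows "M G fl \<kappa> x z S' V'"
  using assms by (simp add: M_def K_def)

lemma sample_step:
  assumes w: "\<And>i. i < n \<Longrightarrow> V 4 i = wt u i" and u: "\<And>i. i < n \<Longrightarrow> 0 < u i" and \<xi>: "\<And>i. i < n \<Longrightarrow> V 5 i = \<xi> i"
  obtains V' where "prims_ok sample_prims (S, V)" "prims_sem sample_prims (S, V) = (S(15 := S 15 + 1), V')"
    "\<And>i. V' 9 i = V 9 i + 2 * (mulA (sol (wt u) (mulT (\<lambda>k. sqrt (wt u k) * \<xi> k))) i)\<^sup>2"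
    "\<And>k. k < 6 \<Longrightarrow> V' k = V k"
proof -
  have wp: "0 < wt u i" if "i < n" for i using wt_pos[of u i] u that by simp
  let ?t = "\<lambda>i. \<bar>V 4 i\<bar> powr (1 / 2) * V 5 i"
  let ?td = "\<lambda>j. if j < d then mulT ?t j else 0"
  let ?v = "\<lambda>j. if j < d then sol (V 4) ?td j else V 8 j"
  have "sol (V 4) ?td = sol (wt u) (mulT (\<lambda>k. sqrt (wt u k) * \<xi> k))"
  proof (rule sol_cong)
    fix j assume "j < d"
    have "mulT ?t j = mulT (\<lambda>k. sqrt (wt u k) * \<xi> k) j"
      by (rule mulT_cong) (use w \<xi> wp in \<open>simp add: powr_half_sqrt less_imp_le\<close>)
    then show "?td j = mulT (\<lambda>k. sqrt (wt u k) * \<xi> k) j" using \<open>j < d\<close> by simp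
  qed (rule w)
  then have m: "mulA ?v i = mulA (sol (wt u) (mulT (\<lambda>k. sqrt (wt u k) * \<xi> k))) i" for i
    by (intro mulA_cong) simp
  let ?V' = "V(6 := mulA ?v, 7 := ?td, 8 := ?v, 9 := \<lambda>i. V 9 i + 2 * mulA ?v i * mulA ?v i)"
  have s: "prims_sem sample_prims (S, V) = (S(15 := S 15 + 1), ?V')"
    unfolding sample_prims_def by (simp add: fun_upd_twist cong: if_cong)
  have o: "prims_ok sample_prims (S, V)"
    unfolding sample_prims_def using w wp by simp
  show ?thesis
    by (rule that[OF o s]) (auto simp: m power2_eq_square)
qed

definition samples :: nat where "samples = nat \<lceil>10 * Lam\<rceil>"

text \<open>Union bound: a row is underestimated by all samples, or some sample of some row exceeds
  \<open>2 * Lam\<close> times its leverage.\<close>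

definition fail :: real where
  "fail = real n * (9 / 10) ^ samples + real samples * (real n * (2 * exp (- Lam)))"

lemma samples_props: "10 * Lam \<le> real samples" "real samples \<le> 10 * Lam + 1" "real j < 10 * Lam \<Longrightarrow> j < samples"
  "\<not> real j < 10 * Lam \<Longrightarrow> samples \<le> j"
proof -
  have "0 \<le> 10 * Lam" using param_props by simp
  then show "10 * Lam \<le> real samples" "real samples \<le> 10 * Lam + 1" unfolding samples_def by linarith+
  then show "real j < 10 * Lam \<Longrightarrow> j < samples" by linarith
  show "\<not> real j < 10 * Lam \<Longrightarrow> samples \<le> j" unfolding samples_def by linarith
qed

lemma fail_nonneg: "0 \<le> fail"
  by (simp add: fail_def)

context
  fixes u :: "nat \<Rightarrow> real" and G fl \<kappa> :: real and x z :: "nat \<Rightarrow> real" and i0 :: nat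
  assumes u: "\<And>i. i < n \<Longrightarrow> 0 < u i"
begin

definition SI :: "nat \<Rightarrow> scalars \<Rightarrow> vectors \<Rightarrow> bool" where
  "SI j S V \<longleftrightarrow> M G fl \<kappa> x z S V \<and> S 14 = real i0 \<and> V 3 = u \<and> (\<forall>i<n. V 4 i = wt u i) \<and> S 15 = real j \<and>
     real j \<le> 10 * Lam + 1 \<and> (\<forall>i<n. 0 \<le> V 9 i \<and> V 9 i \<le> real j * (4 * Lam) * lev (wt u) i)"

text \<open>The failure potential of the sampling loop: each row whose estimate is still too small remains so
  with probability at most \<open>9 / 10\<close> per sample.\<close>

definition SPhi :: "real \<Rightarrow> nat \<Rightarrow> scalars \<Rightarrow> vectors \<Rightarrow> real" where
  "SPhi \<eta> j S V = (if SI j S V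
     then (\<Sum>i<n. if V 9 i < lev (wt u) i then (9 / 10) ^ (samples - j) else 0)
       + real (samples - j) * (real n * (2 * exp (- Lam))) + \<eta> else 1)"

lemma sample_wp:
  assumes I: "SI j S V" and lt: "S 15 < S 6" and \<eta>: "0 \<le> \<eta>"
  shows "wp (rand_code 5 ;; prims sample_prims) (7 * (500 * T)) S V (SPhi \<eta> j S V) (SPhi \<eta> (Suc j))"
proof -
  have j: "real j < 10 * Lam" using I lt by (simp add: SI_def M_def K_def)
  have js: "j < samples" using samples_props(3)[OF j] .
  define \<psi> where "\<psi> S' V' = (if prims_ok sample_prims (S', V')
    then (case prims_sem sample_prims (S', V') of (S'', V'') \<Rightarrow> SPhi \<eta> (Suc j) S'' V'') else 1)" for S' V'
  have 2: "wp (prims sample_prims) (6 * (500 * T)) S' V' (\<psi> S' V') (SPhi \<eta> (Suc j))" for S' V'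
  proof (cases "prims_ok sample_prims (S', V')")
    case True
    obtain S'' V'' where e: "prims_sem sample_prims (S', V') = (S'', V'')" by fastforce
    have "wp (prims sample_prims) (real (length sample_prims) * (500 * T)) S' V' (\<psi> S' V') (SPhi \<eta> (Suc j))"
      by (rule wp_prims[OF True e]) (use True e in \<open>simp add: \<psi>_def\<close>)
    then show ?thesis by (simp add: sample_prims_def)
  qed (intro wp_fail, simp add: \<psi>_def)
  define c where "c i k = sqrt (wt u k) * mulA (dir (wt u) i) k" for i k
  have wpos: "\<And>i. i < n \<Longrightarrow> 0 < wt u i" using wt_pos[of u] u by simp
  have c2: "(\<Sum>k<n. (c i k)\<^sup>2) = lev (wt u) i" for i
  proof -
    have "(\<Sum>k<n. wt u k * (mulA (dir (wt u) i) k)\<^sup>2) = lev (wt u) i" using lev_eq[of "wt u" i] wpos by blast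
    moreover have "(\<Sum>k<n. (c i k)\<^sup>2) = (\<Sum>k<n. wt u k * (mulA (dir (wt u) i) k)\<^sup>2)" unfolding c_def
      by (rule sum.cong) (use wpos in \<open>auto simp: power_mult_distrib less_imp_le\<close>)
    ultimately show ?thesis by simp
  qed
  let ?p = "(9 / 10 :: real) ^ (samples - Suc j)" and ?R = "real (samples - Suc j) * (real n * (2 * exp (- Lam))) + \<eta>"
  have R0: "0 \<le> ?R" using \<eta> by simp
  \<comment> \<open>\<open>?A\<close> counts rows that stay too small, \<open>?R\<close> is the
    budget of the remaining rounds, and \<open>?B\<close> counts rows with an excessive sample. If
    the invariant breaks, some row was excessive, and \<open>?B\<close> alone pays for the value
    1.\<close>
  have pt: "\<psi> S (V(5 := \<lambda>i. if i < n then sign bs i else V 5 i))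
      \<le> (\<Sum>i<n. (if V 9 i < lev (wt u) i then ?p else 0) * (if (rad n (c i) bs)\<^sup>2 < (\<Sum>k<n. (c i k)\<^sup>2) / 2 then 1 else 0))
        + ?R + (\<Sum>i<n. if 2 * Lam * (\<Sum>k<n. (c i k)\<^sup>2) < (rad n (c i) bs)\<^sup>2 then 1 else 0)" (is "_ \<le> ?A + ?R + ?B") for bs
  proof -
    have A0: "0 \<le> ?A" by (intro sum_nonneg) auto
    have B0: "0 \<le> ?B" by (intro sum_nonneg) auto
    let ?V = "V(5 := \<lambda>i. if i < n then sign bs i else V 5 i)"
    obtain V' where V': "prims_ok sample_prims (S, ?V)" "prims_sem sample_prims (S, ?V) = (S(15 := S 15 + 1), V')"
      "\<And>i. V' 9 i = ?V 9 i + 2 * (mulA (sol (wt u) (mulT (\<lambda>k. sqrt (wt u k) * sign bs k))) i)\<^sup>2"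
      "\<And>k. k < 6 \<Longrightarrow> V' k = ?V k"
      by (rule sample_step[of ?V u "sign bs" S]) (use I u in \<open>auto simp: SI_def\<close>)
    have g: "mulA (sol (wt u) (mulT (\<lambda>k. sqrt (wt u k) * sign bs k))) i = rad n (c i) bs" for i
      using sol_signs[of "wt u" "sign bs" i] wpos by (simp add: rad_def c_def)
    have V9: "V' 9 i = V 9 i + 2 * (rad n (c i) bs)\<^sup>2" for i using V'(3)[of i] g by simp
    have le: "(\<Sum>i<n. if V' 9 i < lev (wt u) i then ?p else 0) \<le> ?A"
    proof (rule sum_mono)
      fix i assume "i \<in> {..<n}"
      then have "0 \<le> V 9 i" using I by (simp add: SI_def)
      moreover have "(if v + 2 * r < l then q else 0) \<le> (if v < l then q else 0) * (if r < l / 2 then 1 else 0)"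
        if "0 \<le> v" "0 \<le> r" "0 \<le> q" for v r l q :: real using that by auto
      ultimately show "(if V' 9 i < lev (wt u) i then ?p else 0) \<le> (if V 9 i < lev (wt u) i then ?p else 0) *
          (if (rad n (c i) bs)\<^sup>2 < (\<Sum>k<n. (c i k)\<^sup>2) / 2 then 1 else 0)"
        unfolding V9 c2 by simp
    qed
    show ?thesis
    proof (cases "\<exists>i<n. 2 * Lam * (\<Sum>k<n. (c i k)\<^sup>2) < (rad n (c i) bs)\<^sup>2")
      case True
      then obtain i where i: "i < n" "2 * Lam * (\<Sum>k<n. (c i k)\<^sup>2) < (rad n (c i) bs)\<^sup>2" by blast
      have "1 \<le> ?B"
        using member_le_sum[of i "{..<n}" "\<lambda>i. if 2 * Lam * (\<Sum>k<n. (c i k)\<^sup>2) < (rad n (c i) bs)\<^sup>2 then 1 else 0 :: real"] i by simp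
      show ?thesis
      proof (cases "SI (Suc j) (S(15 := S 15 + 1)) V'")
        case False
        then have "\<psi> S ?V = 1" by (simp add: \<psi>_def V' SPhi_def)
        then show ?thesis using A0 R0 \<open>1 \<le> ?B\<close> by linarith
      next
        case sii: True
        have "\<psi> S ?V = (\<Sum>i<n. if V' 9 i < lev (wt u) i then ?p else 0) + ?R"
          using sii by (simp add: \<psi>_def V' SPhi_def)
        then show ?thesis using le B0 by linarith
      qed
    next
      case False
      then have up: "(rad n (c i) bs)\<^sup>2 \<le> 2 * Lam * lev (wt u) i" if "i < n" for i using that by (metis c2 not_less)
      have sii: "SI (Suc j) (S(15 := S 15 + 1)) V'"
      proof -
        have "M G fl \<kappa> x z (S(15 := S 15 + 1)) V'"
          by (rule M_cong[where S = S and V = V]) (use I V'(4) in \<open>auto simp: SI_def\<close>)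
        moreover have "0 \<le> V' 9 i \<and> V' 9 i \<le> real (Suc j) * (4 * Lam) * lev (wt u) i" if "i < n" for i
        proof -
          have "V 9 i \<le> real j * (4 * Lam) * lev (wt u) i" "0 \<le> V 9 i" using I that by (auto simp: SI_def)
          then show ?thesis unfolding V9 using up[OF that] by (auto simp: algebra_simps)
        qed
        ultimately show ?thesis using I V'(4) j by (auto simp: SI_def)
      qed
      have "\<psi> S ?V = (\<Sum>i<n. if V' 9 i < lev (wt u) i then ?p else 0) + ?R"
        using sii by (simp add: \<psi>_def V' SPhi_def)
      then show ?thesis using le B0 by linarith
    qed
  qed
  have Lam0: "0 < 2 * Lam" using param_props by simp
  have "avg n (\<lambda>bs. \<psi> S (V(5 := \<lambda>i. if i < n then sign bs i else V 5 i))) \<le> SPhi \<eta> j S V"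
  proof -
    have "avg n (\<lambda>bs. \<psi> S (V(5 := \<lambda>i. if i < n then sign bs i else V 5 i)))
      \<le> avg n (\<lambda>bs. (\<Sum>i<n. (if V 9 i < lev (wt u) i then ?p else 0) * (if (rad n (c i) bs)\<^sup>2 < (\<Sum>k<n. (c i k)\<^sup>2) / 2 then 1 else 0))
        + ?R + (\<Sum>i<n. if 2 * Lam * (\<Sum>k<n. (c i k)\<^sup>2) < (rad n (c i) bs)\<^sup>2 then 1 else 0))"
      by (rule avg_mono) (rule pt)
    also have "\<dots> = (\<Sum>i<n. (if V 9 i < lev (wt u) i then ?p else 0) * avg n (\<lambda>bs. if (rad n (c i) bs)\<^sup>2 < (\<Sum>k<n. (c i k)\<^sup>2) / 2 then 1 else 0))
        + ?R + (\<Sum>i<n. avg n (\<lambda>bs. if 2 * Lam * (\<Sum>k<n. (c i k)\<^sup>2) < (rad n (c i) bs)\<^sup>2 then 1 else 0))"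
      by (simp only: avg_add avg_const avg_sum[OF finite_lessThan] avg_cmult)
    also have "\<dots> \<le> (\<Sum>i<n. (if V 9 i < lev (wt u) i then ?p else 0) * (9 / 10)) + ?R + (\<Sum>i<n. 2 * exp (- (2 * Lam) / 2))"
      by (intro add_mono sum_mono mult_left_mono rad_small_prob rad_large_prob[OF Lam0] order_refl) auto
    also have "(\<Sum>i<n. (if V 9 i < lev (wt u) i then ?p else 0) * (9 / 10)) = (\<Sum>i<n. if V 9 i < lev (wt u) i then (9 / 10) ^ (samples - j) else 0)"
    proof (rule sum.cong[OF refl])
      have "samples - j = Suc (samples - Suc j)" using js by simp
      then show "(if V 9 i < lev (wt u) i then ?p else 0) * (9 / 10) = (if V 9 i < lev (wt u) i then (9 / 10) ^ (samples - j) else 0)" for i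
        by simp
    qed
    also have "(\<Sum>i<n. if V 9 i < lev (wt u) i then (9 / 10) ^ (samples - j) else 0) + ?R + (\<Sum>i<n. 2 * exp (- (2 * Lam) / 2)) = SPhi \<eta> j S V"
    proof -
      have "real (samples - j) = real (samples - Suc j) + 1" using js by linarith
      then show ?thesis using I by (simp add: SPhi_def algebra_simps)
    qed
    finally show ?thesis .
  qed
  from wp_rand[where a = 5 and \<phi> = \<psi>, OF _ this]
  have "wp (rand_code 5) (20 * T) S V (SPhi \<eta> j S V) \<psi>" by simp
  from wp_mono[OF wp_seq[OF this 2]] show ?thesis using T_ge by simp
qed

lemma sample_loop:
  "hoare (real samples * 8 + 1) fail (SI 0) (WhileLess (2 * 15) (2 * 6) (rand_code 5 ;; prims sample_prims))
    (\<lambda>S V. M G fl \<kappa> x z S V \<and> S 14 = real i0 \<and> V 3 = u \<and> (\<forall>i<n. lev (wt u) i \<le> V 9 i \<and> V 9 i \<le> NN * lev (wt u) i))"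
  (is "hoare _ _ _ ?W ?Post")
proof (rule hoareI)
  fix S V and \<eta> :: real assume h: "SI 0 S V" "0 \<le> \<eta>" "\<eta> \<le> 1"
  have wpos: "\<And>i. i < n \<Longrightarrow> 0 < wt u i" using wt_pos[of u] u by simp
  have "wp ?W (real samples * (7 * (500 * T) + 1) + 4) S V (SPhi \<eta> 0 S V) (\<lambda>S V. if ?Post S V then \<eta> else 1)"
  proof (rule wp_while)
    show "0 \<le> 7 * (500 * T)" using T_ge by simp
    fix j S V assume c: "S 15 < S 6" "SPhi \<eta> j S V < 1"
    then have I: "SI j S V" by (cases "SI j S V") (auto simp: SPhi_def)
    have "j < samples" using I c(1) by (intro samples_props(3)) (simp add: SI_def M_def K_def)
    then show "j < samples \<and> wp (rand_code 5 ;; prims sample_prims) (7 * (500 * T)) S V (SPhi \<eta> j S V) (SPhi \<eta> (Suc j))"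
      using sample_wp[OF I c(1) h(2)] by simp
  next
    fix j S V assume c: "\<not> S 15 < S 6" "SPhi \<eta> j S V < 1"
    then have I: "SI j S V" by (cases "SI j S V") (auto simp: SPhi_def)
    have "samples \<le> j" using I c(1) by (intro samples_props(4)) (simp add: SI_def M_def K_def)
    then have Phi: "SPhi \<eta> j S V = (\<Sum>i<n. if V 9 i < lev (wt u) i then 1 else 0) + \<eta>" using I by (simp add: SPhi_def cong: if_cong)
    \<comment> \<open>After the last sample, a row that is still too small would contribute
      \<open>(9 / 10) ^ 0 = 1\<close> to a potential below 1.\<close>
    have "lev (wt u) i \<le> V 9 i" if "i < n" for i
    proof (rule ccontr)
      assume "\<not> lev (wt u) i \<le> V 9 i"
      then have "1 \<le> (\<Sum>i<n. if V 9 i < lev (wt u) i then 1 else 0 :: real)"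
        using member_le_sum[of i "{..<n}" "\<lambda>i. if V 9 i < lev (wt u) i then 1 else 0 :: real"] that by simp
      then show False using c(2) h(2) Phi by simp
    qed
    moreover have "V 9 i \<le> NN * lev (wt u) i" if "i < n" for i
    proof -
      have "V 9 i \<le> real j * (4 * Lam) * lev (wt u) i" using I that by (simp add: SI_def)
      also have "\<dots> \<le> NN * lev (wt u) i"
      proof (rule mult_right_mono)
        have "real j * (4 * Lam) \<le> (10 * Lam + 1) * (4 * Lam)"
          using I param_props by (intro mult_right_mono) (auto simp: SI_def)
        then show "real j * (4 * Lam) \<le> NN" by (simp add: NN_def algebra_simps)
      qed (rule lev_nonneg[where w = "wt u", OF wpos])
      finally show ?thesis .
    qed
    ultimately have "?Post S V" using I by (simp add: SI_def)
    moreover have "0 \<le> (\<Sum>i<n. if V 9 i < lev (wt u) i then 1 else 0 :: real)" by (intro sum_nonneg) auto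
    ultimately show "(if ?Post S V then \<eta> else 1) \<le> SPhi \<eta> j S V" unfolding Phi by simp
  qed auto
  moreover have "SPhi \<eta> 0 S V \<le> fail + \<eta>"
  proof -
    have "(\<Sum>i<n. if V 9 i < lev (wt u) i then (9 / 10) ^ samples else 0) \<le> (\<Sum>i<n. (9 / 10 :: real) ^ samples)"
      by (intro sum_mono) auto
    then show ?thesis using h(1) by (simp add: SPhi_def fail_def cong: if_cong)
  qed
  moreover have "real samples * (7 * (500 * T) + 1) + 4 \<le> (real samples * 8 + 1) * (500 * T)"
  proof -
    have "real samples * 1 \<le> real samples * (500 * T)" using T_ge by (intro mult_left_mono) auto
    then show ?thesis using T_ge by (simp add: algebra_simps)
  qed
  ultimately show "wp ?W ((real samples * 8 + 1) * (500 * T)) S V (fail + \<eta>) (\<lambda>S V. if ?Post S V then \<eta> else 1)"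
    by - (rule wp_mono[OF _ _ _ order_refl]; assumption)
qed

lemma refine_correct:
  assumes "0 < \<kappa>"
  shows "hoare (real samples * 8 + 6) fail (\<lambda>S V. M G fl \<kappa> x z S V \<and> S 14 = real i0 \<and> V 3 = u) refine_com
    (\<lambda>S V. M G fl \<kappa> x z S V \<and> S 14 = real (Suc i0) \<and> refine (\<lambda>i. max \<bar>z i\<bar> fl) \<kappa> NN u (V 3))"
proof -
  have wpos: "\<And>i. i < n \<Longrightarrow> 0 < wt u i" using wt_pos[of u] u by simp
  have 1: "hoare 3 0 (\<lambda>S V. M G fl \<kappa> x z S V \<and> S 14 = real i0 \<and> V 3 = u)
      (prims [VAssign 4 (Comp 3 ^. (InQ -. Const 2)), VAssign 9 (Const 0), SAssign 15 (Const 0)]) (SI 0)"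
  proof (rule hoare_prims)
    fix S :: scalars and V :: vectors assume h: "M G fl \<kappa> x z S V \<and> S 14 = real i0 \<and> V 3 = u"
    have "M G fl \<kappa> x z (S(15 := 0)) (V(4 := \<lambda>i. \<bar>u i\<bar> powr (q - 2), 9 := \<lambda>i. 0))"
      by (rule M_cong[where S = S and V = V]) (use h in auto)
    moreover have "\<bar>u i\<bar> powr (q - 2) = wt u i" if "i < n" for i using u[OF that] by (simp add: wt_def)
    ultimately show "prims_ok [VAssign 4 (Comp 3 ^. (InQ -. Const 2)), VAssign 9 (Const 0), SAssign 15 (Const 0)] (S, V) \<and>
      (case prims_sem [VAssign 4 (Comp 3 ^. (InQ -. Const 2)), VAssign 9 (Const 0), SAssign 15 (Const 0)] (S, V) of
         (S', V') \<Rightarrow> SI 0 S' V')"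
      using h param_props by (simp add: SI_def)
  qed simp
  let ?ps = "[VAssign 3 (exp_max (exp_max (Comp 1 ^. Const 1) (Scal 17)) ((Scal 13 *. Comp 9) ^. (Const 1 /. Const 2))),
       SAssign 14 (Scal 14 +. Const 1)]"
  have mx: "(a + b + \<bar>a - b\<bar>) / 2 = max a b" for a b :: real by (auto simp: max_def)
  have 3: "hoare 2 0 (\<lambda>S V. M G fl \<kappa> x z S V \<and> S 14 = real i0 \<and> V 3 = u \<and> (\<forall>i<n. lev (wt u) i \<le> V 9 i \<and> V 9 i \<le> NN * lev (wt u) i))
      (prims ?ps) (\<lambda>S V. M G fl \<kappa> x z S V \<and> S 14 = real (Suc i0) \<and> refine (\<lambda>i. max \<bar>z i\<bar> fl) \<kappa> NN u (V 3))"
  proof (rule hoare_prims)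
    fix S :: scalars and V :: vectors
    assume h: "M G fl \<kappa> x z S V \<and> S 14 = real i0 \<and> V 3 = u \<and> (\<forall>i<n. lev (wt u) i \<le> V 9 i \<and> V 9 i \<le> NN * lev (wt u) i)"
    let ?u' = "\<lambda>i. max (max \<bar>z i\<bar> fl) (\<bar>\<kappa> * V 9 i\<bar> powr (1 / 2))"
    have z: "V (Suc 0) = z" "S 17 = fl" "S 13 = \<kappa>" using h by (auto simp: M_def)
    have "prims_sem ?ps (S, V) = (S(14 := S 14 + 1), V(3 := ?u'))"
      by (simp add: exp_max_def z mx)
    moreover have "prims_ok ?ps (S, V)" by (simp add: exp_max_def)
    moreover have "M G fl \<kappa> x z (S(14 := S 14 + 1)) (V(3 := ?u'))"
      by (rule M_cong[where S = S and V = V]) (use h in auto)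
    moreover have "refine (\<lambda>i. max \<bar>z i\<bar> fl) \<kappa> NN u ?u'" unfolding refine_def
    proof (intro allI impI)
      fix i assume i: "i < n"
      have "0 \<le> V 9 i" using h i lev_nonneg[where w = "wt u", OF wpos, of i] by force
      then have "?u' i = max (max \<bar>z i\<bar> fl) (sqrt (\<kappa> * V 9 i))" using assms by (simp add: powr_half_sqrt abs_mult)
      then show "\<exists>est. lev (wt u) i \<le> est \<and> est \<le> NN * lev (wt u) i \<and> ?u' i = max (max \<bar>z i\<bar> fl) (sqrt (\<kappa> * est))"
        using h i by blast
    qed
    ultimately show "prims_ok ?ps (S, V) \<and> (case prims_sem ?ps (S, V) of (S', V') \<Rightarrow>
        M G fl \<kappa> x z S' V' \<and> S' 14 = real (Suc i0) \<and> refine (\<lambda>i. max \<bar>z i\<bar> fl) \<kappa> NN u (V' 3))"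
      using h by simp
  qed simp
  show ?thesis unfolding refine_com_def
    by (rule hoare_conseq[OF hoare_seq[OF 1 hoare_seq[OF sample_loop 3]]]) (use fail_nonneg in auto)
qed

end

end

section \<open>One phase\<close>

context algorithm begin

definition steps :: nat where "steps = nat \<lceil>kmax\<rceil>"

lemma agd_step_sem:
  assumes w: "\<And>i. i < n \<Longrightarrow> V 4 i = wt u i" and u: "\<And>i. i < n \<Longrightarrow> 0 < u i" and V3: "V 3 = u" and j: "S 15 = real j"
  obtains V' where "prims_ok agd_prims (S, V)" "prims_sem agd_prims (S, V) = (S(15 := real (Suc j)), V')"
    "\<And>k. k < 6 \<Longrightarrow> V' k = V k" "energy (V 1) u y (Suc j) (V' 10) (V' 11) \<le> energy (V 1) u y j (V 10) (V 11)"
proof -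
  have wp: "0 < wt u i" if "i < n" for i using wt_pos[of u i] u that by simp
  define \<theta> where "\<theta> = 2 / (real j + 2)"
  define yv where "yv i = (1 - \<theta>) * V 10 i + \<theta> * V 11 i" for i
  define t where "t i = \<bar>V 1 i\<bar> powr (q - 2) * V 1 i / 5 + \<bar>u i * u i + mulA yv i * mulA yv i\<bar> powr (q / 2 - 1) * mulA yv i" for i
  define td where "td k = (if k < d then mulT t k else 0)" for k
  define v where "v k = (if k < d then sol (V 4) td k else V 8 k)" for k
  define v' where "v' i = V 11 i - (real j + 1) / 2 * v i" for i
  define x' where "x' i = (1 - \<theta>) * V 10 i + \<theta> * v' i" for i
  let ?V' = "V(12 := yv, 6 := t, 7 := td, 8 := v, 11 := v', 10 := x')"
  have s: "prims_sem agd_prims (S, V) = (S(15 := real (Suc j)), ?V')"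
    unfolding agd_prims_def
    by (simp add: exp_theta_def j V3 \<theta>_def yv_def[abs_def] t_def[abs_def] td_def[abs_def] v_def[abs_def] v'_def[abs_def]
        x'_def[abs_def] add.commute[of 1 "real j"] cong: if_cong)
  have o: "prims_ok agd_prims (S, V)" unfolding agd_prims_def using w wp by (simp add: exp_theta_def)
  have g: "t i = grad (V 1) u i (mulA yv i)" for i
  proof -
    have "\<bar>u i * u i + mulA yv i * mulA yv i\<bar> = (u i)\<^sup>2 + (mulA yv i)\<^sup>2" by (simp add: power2_eq_square)
    then show ?thesis by (simp add: t_def grad_def sgn_powr_def huber'_def)
  qed
  have so: "sol (V 4) td = sol (wt u) (mulT (\<lambda>i. grad (V 1) u i (mulA yv i)))"
  proof (rule sol_cong)
    fix k assume "k < d"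
    then show "td k = mulT (\<lambda>i. grad (V 1) u i (mulA yv i)) k" using mulT_cong[of t "\<lambda>i. grad (V 1) u i (mulA yv i)" k] g
      by (simp add: td_def)
  qed (rule w)
  have "energy (V 1) u y (Suc j) x' v' \<le> energy (V 1) u y j (V 10) (V 11)"
    by (rule agd_step[OF u \<theta>_def, where y = yv]) (auto simp: yv_def v'_def v_def so x'_def)
  then show ?thesis by (intro that[OF o s]) auto
qed

lemma agd_loop:
  fixes u :: "nat \<Rightarrow> real"
  assumes u: "\<And>i. i < n \<Longrightarrow> 0 < u i"
  shows "hoare (real steps * 9 + 1) 0
    (\<lambda>S V. M G fl \<kappa> x z S V \<and> V 3 = u \<and> (\<forall>i<n. V 4 i = wt u i) \<and> S 15 = 0 \<and> V 10 = (\<lambda>_. 0) \<and> V 11 = (\<lambda>_. 0))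
    (WhileLess (2 * 15) (2 * 12) (prims agd_prims))
    (\<lambda>S V. M G fl \<kappa> x z S V \<and> (\<exists>j::nat. kmax \<le> real j \<and> (\<forall>y. energy z u y j (V 10) (V 11) \<le> energy z u y 0 (\<lambda>_. 0) (\<lambda>_. 0))))"
proof -
  define I where "I j S V \<longleftrightarrow> M G fl \<kappa> x z S V \<and> V 3 = u \<and> (\<forall>i<n. V 4 i = wt u i) \<and> S 15 = real j \<and>
    (\<forall>y. energy z u y j (V 10) (V 11) \<le> energy z u y 0 (\<lambda>_. 0) (\<lambda>_. 0))" for j :: nat and S :: scalars and V :: vectors
  have body: "hoare 8 0 (\<lambda>S V. I j S V \<and> S 15 < S 12) (prims agd_prims) (I (Suc j))" for j
  proof (rule hoare_prims)
    fix S :: scalars and V :: vectors assume h: "I j S V \<and> S 15 < S 12"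
    have w: "\<And>i. i < n \<Longrightarrow> V 4 i = wt u i" and V3: "V 3 = u" and j: "S 15 = real j" and z: "V 1 = z"
      using h by (auto simp: I_def M_def)
    obtain V' where V': "prims_ok agd_prims (S, V)" "prims_sem agd_prims (S, V) = (S(15 := real (Suc j)), V')"
      "\<And>k. k < 6 \<Longrightarrow> V' k = V k"
      by (rule agd_step_sem[where u = u and V = V and S = S and j = j, OF w u V3 j]) auto
    \<comment> \<open>\<open>V'\<close> is determined by its defining equation, so obtaining it
      again for an arbitrary comparison point \<open>y\<close> yields the same vectors.\<close>
    have E: "energy z u y (Suc j) (V' 10) (V' 11) \<le> energy z u y j (V 10) (V 11)" for y
      by (rule agd_step_sem[where u = u and V = V and S = S and j = j and y = y, OF w u V3 j]) (use V'(2) z in auto)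
    have "M G fl \<kappa> x z (S(15 := real (Suc j))) V'"
      by (rule M_cong[where S = S and V = V]) (use h V'(3) in \<open>auto simp: I_def\<close>)
    moreover have "energy z u y (Suc j) (V' 10) (V' 11) \<le> energy z u y 0 (\<lambda>_. 0) (\<lambda>_. 0)" for y
      using E[of y] h unfolding I_def by (meson order_trans)
    ultimately have "I (Suc j) (S(15 := real (Suc j))) V'" using h V'(3) by (simp add: I_def)
    then show "prims_ok agd_prims (S, V) \<and> (case prims_sem agd_prims (S, V) of (S', V') \<Rightarrow> I (Suc j) S' V')"
      using V' by simp
  qed (simp add: agd_prims_def)
  have "hoare (real steps * (8 + 1) + 1) (real steps * 0) (I 0) (WhileLess (2 * 15) (2 * 12) (prims agd_prims))
      (\<lambda>S V. \<exists>j. I j S V \<and> \<not> S 15 < S 12)"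
  proof (rule hoare_while[where I = I and a = 15 and b' = 12, OF _ _ _ _ body])
    show "j < steps" if "I j S V" "S 15 < S 12" for j S V
    proof -
      have "real j < kmax" using that by (simp add: I_def M_def K_def)
      then show ?thesis unfolding steps_def by linarith
    qed
  qed auto
  moreover have "\<exists>j::nat. kmax \<le> real j \<and> (\<forall>y. energy z u y j (V 10) (V 11) \<le> energy z u y 0 (\<lambda>_. 0) (\<lambda>_. 0))"
    if "I j S V" "\<not> S 15 < S 12" for j S V
    using that by (intro exI[of _ j]) (simp add: I_def M_def K_def not_less)
  ultimately show ?thesis by (elim hoare_conseq) (auto simp: I_def)
qed

lemma F0_nonneg: "0 \<le> F0"
  by (simp add: F0_def cost_def sum_nonneg)

lemma root_le: "0 < y \<Longrightarrow> y \<le> 1 \<Longrightarrow> y \<le> y powr (1 / q)" for y :: real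
  using powr_mono'[of "1 / q" 1 y] q by simp

text \<open>The search for scales starts at the constant \<open>F0 powr (1 / q)\<close>, of the
  order of the largest possible residual. The floor keeps the first iterate within the factor
  \<open>NN * r0\<close> of it, and \<open>Lg\<close> further rounds reduce this to
  \<open>rr\<close>. The last iterate then meets the requirements of
  \<open>phase_progress\<close>.\<close>

lemma phase_correct:
  assumes G: "F0 / 2 ^ Lg < G" "G \<le> F0" and gap: "\<And>y. cost x - cost y \<le> G" and z: "\<And>i. i < n \<Longrightarrow> z i = resid x i"
  shows "hoare (real (Suc Lg) * (real samples * 8 + 7) + real steps * 9 + 20) (real (Suc Lg) * fail)
    (\<lambda>S V. K S V \<and> S 11 = G \<and> V 0 = x \<and> V 1 = z) phase_com
    (\<lambda>S V. K S V \<and> S 11 = G * (1 - sP / 2) \<and> (\<forall>i<n. V 1 i = resid (V 0) i) \<and> (\<forall>y. cost (V 0) - cost y \<le> G * (1 - sP / 2)))"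
proof -
  \<comment> \<open>Both constants are calibrated to \<open>cP * G\<close>: it equals
    \<open>real n * fl powr q\<close> as well as \<open>NN * rr * \<kappa> * real d\<close>.\<close>
  define fl where "fl = (cP * G / real n) powr (1 / q)"
  define \<kappa> where "\<kappa> = cP * G / (NN * rr * real d)"
  define U where "U = F0 powr (1 / q)"
  define zf where "zf i = max \<bar>z i\<bar> fl" for i
  \<comment> \<open>One factor \<open>2 ^ Lg\<close> accounts for \<open>G\<close> against
    \<open>F0\<close>, the other for \<open>n\<close>. The \<open>q\<close>-th root that separates
    floor and start is dropped, being harmless for a base of at most 1.\<close>
  define r0 where "r0 = 2 ^ (2 * Lg) / cP"
  have F: "0 < F0"
  proof (rule ccontr)
    assume "\<not> 0 < F0"
    then have "F0 = 0" using F0_nonneg by simp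
    then show False using G by simp
  qed
  have G0: "0 < G" using G(1) F by (meson divide_pos_pos less_trans zero_less_numeral zero_less_power)
  have dn: "0 < real d" "0 < real n" using d n_pos by auto
  note pp = param_props sP_props
  have fl: "0 < fl" using pp G0 dn by (simp add: fl_def)
  have \<kappa>: "0 < \<kappa>" using pp G0 dn by (simp add: \<kappa>_def)
  have U: "0 < U" using F by (simp add: U_def)
  have Uq: "U powr q = F0" using F q by (simp add: U_def powr_powr)
  have flq: "fl powr q = cP * G / real n" using pp G0 dn q by (simp add: fl_def powr_powr)
  have r0: "1 \<le> r0"
  proof -
    have "1 * cP \<le> 2 ^ (2 * Lg)" using pp by (intro order_trans[OF _ one_le_power]) auto
    then show ?thesis using pp by (simp add: r0_def)
  qed
  have zf0: "0 < zf i" for i using fl by (simp add: zf_def)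
  have zU: "\<bar>z i\<bar> \<le> 2 * U" if i: "i < n" for i
  proof -
    have "\<bar>z i\<bar> powr q \<le> cost x" unfolding cost_def using i z by (intro member_le_sum[of i "{..<n}" "\<lambda>i. \<bar>resid x i\<bar> powr q", THEN order_trans[rotated]]) auto
    also have "\<dots> \<le> 2 * F0" using gap[of x0] G(2) by (simp add: F0_def)
    also have "\<dots> \<le> (2 powr q) * U powr q"
      using F powr_mono[of 1 q "2::real"] q Uq by simp
    also have "\<dots> = (2 * U) powr q" using U by (simp add: powr_mult)
    finally have "\<bar>z i\<bar> powr q \<le> (2 * U) powr q" .
    then show ?thesis using powr_less_mono2[of q "2 * U" "\<bar>z i\<bar>"] q U by (force simp: not_less[symmetric])
  qed
  have flU: "fl \<le> U"
  proof -
    have "cP * G / real n \<le> 1 * F0 / 1" using pp G G0 F dn d by (intro frac_le mult_mono) auto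
    then show ?thesis unfolding fl_def U_def using pp G0 dn q by (intro powr_mono2) auto
  qed
  have Ufl: "U \<le> r0 * fl"
  proof -
    have "cP / 2 ^ (2 * Lg) * F0 \<le> cP * G / real n"
    proof -
      have "cP / 2 ^ (2 * Lg) * F0 = cP * (F0 / 2 ^ Lg) / 2 ^ Lg" by (simp add: power_add mult_2)
      also have "\<dots> \<le> cP * G / real n"
        using G(1) G0 pp F dn n_le_pow(1) by (intro frac_le mult_left_mono mult_nonneg_nonneg) auto
      finally show ?thesis .
    qed
    then have "(cP / 2 ^ (2 * Lg) * F0) powr (1 / q) \<le> fl" unfolding fl_def using pp F q by (intro powr_mono2) auto
    moreover have "(cP / 2 ^ (2 * Lg) * F0) powr (1 / q) = (cP / 2 ^ (2 * Lg)) powr (1 / q) * U"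
      unfolding U_def by (rule powr_mult)
    moreover have "cP / 2 ^ (2 * Lg) \<le> (cP / 2 ^ (2 * Lg)) powr (1 / q)"
    proof (rule root_le)
      have "cP \<le> 2 ^ (2 * Lg)" using pp by (intro order_trans[OF _ one_le_power]) auto
      then show "cP / 2 ^ (2 * Lg) \<le> 1" by simp
    qed (use pp in simp)
    then have "cP / 2 ^ (2 * Lg) * U \<le> (cP / 2 ^ (2 * Lg)) powr (1 / q) * U" using U by (intro mult_right_mono) auto
    ultimately have "cP / 2 ^ (2 * Lg) * U \<le> fl" by linarith
    then show ?thesis using pp by (simp add: r0_def field_simps)
  qed
  have first: "ratio (NN * r0 powr (1 / 2 ^ 0)) (\<lambda>_. U) u" if ref: "refine zf \<kappa> NN (\<lambda>_. U) u" for u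
  proof -
    have a: "U \<le> r0 * u i \<and> u i \<le> 2 * U" if i: "i < n" for i
    proof -
      obtain e where e: "e \<le> NN * lev (wt (\<lambda>_. U)) i" "u i = max (zf i) (sqrt (\<kappa> * e))"
        using ref i by (auto simp: refine_def)
      have "fl \<le> u i" using e(2) by (simp add: zf_def)
      then have "r0 * fl \<le> r0 * u i" using r0 by (intro mult_left_mono) auto
      then have 1: "U \<le> r0 * u i" using Ufl by linarith
      \<comment> \<open>A leverage score is at most 1 and \<open>\<kappa> * NN\<close> at most
        \<open>F0\<close>, so the leverage part of the first iterate never exceeds
        \<open>U\<close>.\<close>
      have wl: "wt (\<lambda>_. U) i * lev (wt (\<lambda>_. U)) i \<le> 1"
        by (rule weight_lev_le_1) (use U i in \<open>auto simp: wt_def\<close>)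
      have "\<kappa> * e \<le> \<kappa> * (NN * lev (wt (\<lambda>_. U)) i)" using e(1) \<kappa> by (intro mult_left_mono) auto
      also have "\<dots> \<le> F0 * lev (wt (\<lambda>_. U)) i"
      proof -
        have "\<kappa> * NN \<le> F0"
        proof -
          have "\<kappa> * NN = cP * G / (rr * real d)" using pp by (simp add: \<kappa>_def)
          also have "\<dots> \<le> 1 * F0 / (1 * 1)" using pp G G0 F d by (intro frac_le mult_mono) auto
          finally show ?thesis by simp
        qed
        moreover have "0 \<le> lev (wt (\<lambda>_. U)) i" by (rule lev_nonneg) (use U in \<open>auto simp: wt_def\<close>)
        ultimately show ?thesis using mult_right_mono[of "\<kappa> * NN" F0 "lev (wt (\<lambda>_. U)) i"] by (simp add: mult.assoc)
      qed
      also have "F0 = U\<^sup>2 * wt (\<lambda>_. U) i" unfolding Uq[symmetric] wt_def using powr_add[of U 2 "q - 2"] U by simp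
      also have "U\<^sup>2 * wt (\<lambda>_. U) i * lev (wt (\<lambda>_. U)) i \<le> U\<^sup>2 * 1"
        unfolding mult.assoc by (rule mult_left_mono[OF wl]) simp
      finally have "sqrt (\<kappa> * e) \<le> sqrt (U\<^sup>2)" by (intro real_sqrt_le_mono) simp
      then have "sqrt (\<kappa> * e) \<le> U" using U by simp
      then show ?thesis using 1 e(2) zU[OF i] flU U by (simp add: zf_def)
    qed
    have r: "1 * r0 \<le> NN * r0" using pp r0 by (intro mult_right_mono) auto
    have r2: "2 \<le> r0"
    proof -
      have "(2::real) ^ 1 \<le> 2 ^ (2 * Lg)" using Lg_props(2) by (intro power_increasing) auto
      moreover have "cP * 2 \<le> 1 * 2" using pp by (intro mult_right_mono) auto
      ultimately show ?thesis using pp by (simp add: r0_def field_simps)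
    qed
    have u0: "0 < u i" if "i < n" for i using refine_pos[OF ref _ that] zf0 by blast
    have "U \<le> NN * r0 * u i \<and> u i \<le> NN * r0 * U" if "i < n" for i
    proof
      have "r0 * u i \<le> NN * r0 * u i" using r u0[OF that] by (intro mult_right_mono) auto
      then show "U \<le> NN * r0 * u i" using a[OF that] by linarith
      have "2 \<le> NN * r0" using r r2 by linarith
      then have "2 * U \<le> NN * r0 * U" using U by (intro mult_right_mono) auto
      then show "u i \<le> NN * r0 * U" using a[OF that] by linarith
    qed
    then show ?thesis using r0 by (simp add: ratio_def)
  qed
  \<comment> \<open>From round 1 on, the preceding scales \<open>u0\<close> are remembered, because
    \<open>refine_final\<close> compares the last two iterates.\<close>
  define LI where "LI i S V \<longleftrightarrow> M G fl \<kappa> x z S V \<and> S 14 = real i \<and> i \<le> Suc Lg \<and> (i = 0 \<longrightarrow> V 3 = (\<lambda>_. U)) \<and>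
    (\<forall>k. i = Suc k \<longrightarrow> (\<exists>u0. (\<forall>i<n. 0 < u0 i) \<and> refine zf \<kappa> NN u0 (V 3) \<and> ratio (NN * r0 powr (1 / 2 ^ k)) u0 (V 3)))"
    for i :: nat and S :: scalars and V :: vectors
  have body: "hoare (real samples * 8 + 6) fail (\<lambda>S V. LI i S V \<and> S 14 < S 16) refine_com (LI (Suc i))" for i
  proof (rule hoareI)
    fix S V and \<eta> :: real assume h: "LI i S V \<and> S 14 < S 16" "0 \<le> \<eta>" "\<eta> \<le> 1"
    define u where "u = V 3"
    have iL: "i < Suc Lg" using h(1) by (simp add: LI_def M_def)
    have u: "0 < u k" if "k < n" for k
    proof (cases i)
      case 0
      then show ?thesis using h(1) U by (simp add: LI_def u_def)
    next
      case (Suc l)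
      then obtain u0 where "refine zf \<kappa> NN u0 u" using h(1) by (auto simp: LI_def u_def)
      from refine_pos[OF this _ that] show ?thesis using zf0 by blast
    qed
    have post: "LI (Suc i) S' V'" if p: "M G fl \<kappa> x z S' V' \<and> S' 14 = real (Suc i) \<and> refine (\<lambda>i. max \<bar>z i\<bar> fl) \<kappa> NN u (V' 3)" for S' V'
    proof -
      have ref: "refine zf \<kappa> NN u (V' 3)" using p by (simp add: zf_def[abs_def])
      have "ratio (NN * r0 powr (1 / 2 ^ i)) u (V' 3)"
      proof (cases i)
        case 0
        then have "u = (\<lambda>_. U)" using h(1) by (simp add: LI_def u_def)
        then show ?thesis using first ref 0 by simp
      next
        case (Suc l)
        then obtain u0 where u0: "\<forall>i<n. 0 < u0 i" "refine zf \<kappa> NN u0 u" "ratio (NN * r0 powr (1 / 2 ^ l)) u0 u"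
          using h(1) by (auto simp: LI_def u_def)
        have "1 * 1 \<le> NN * r0 powr (1 / 2 ^ l)" using pp r0 by (intro mult_mono ge_one_powr_ge_zero) auto
        then have "ratio (sqrt (NN * (NN * r0 powr (1 / 2 ^ l)))) u (V' 3)"
          using u0 zf0 pp \<kappa> by (intro refine_ratio[OF u0(2) ref]) auto
        \<comment> \<open>The form \<open>NN * \<rho>\<close> is reproduced, with
          \<open>\<rho>\<close> replaced by its square root.\<close>
        moreover have "sqrt (NN * (NN * r0 powr (1 / 2 ^ l))) = NN * r0 powr (1 / 2 ^ i)"
        proof -
          have "sqrt (r0 powr (1 / 2 ^ l)) = r0 powr (1 / 2 ^ i)"
            using Suc r0 by (simp add: powr_half_sqrt[symmetric] powr_powr mult.commute)
          then show ?thesis using pp by (simp add: real_sqrt_mult mult.assoc[symmetric])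
        qed
        ultimately show ?thesis by simp
      qed
      then show ?thesis using p ref u iL by (auto simp: LI_def)
    qed
    have "wp refine_com ((real samples * 8 + 6) * (500 * T)) S V (fail + \<eta>)
        (\<lambda>S V. if M G fl \<kappa> x z S V \<and> S 14 = real (Suc i) \<and> refine (\<lambda>i. max \<bar>z i\<bar> fl) \<kappa> NN u (V 3) then \<eta> else 1)"
      by (rule hoareD[OF refine_correct[OF u \<kappa>]]) (use h in \<open>auto simp: LI_def u_def\<close>)
    then show "wp refine_com ((real samples * 8 + 6) * (500 * T)) S V (fail + \<eta>) (\<lambda>S V. if LI (Suc i) S V then \<eta> else 1)"
      by (rule wp_mono) (use post h(3) in auto)
  qed
  have lewis: "hoare (real (Suc Lg) * (real samples * 8 + 6 + 1) + 1) (real (Suc Lg) * fail) (LI 0)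
      (WhileLess (2 * 14) (2 * 16) refine_com) (\<lambda>S V. \<exists>i. LI i S V \<and> \<not> S 14 < S 16)"
    by (rule hoare_while[where I = LI and a = 14 and b' = 16, OF _ _ _ fail_nonneg body]) (auto simp: LI_def M_def)
  let ?init = "[SAssign 17 ((Scal 4 *. Scal 11 /. DimRow) ^. (Const 1 /. InQ)),
       SAssign 13 (Scal 4 *. Scal 11 /. (Scal 7 *. Scal 8 *. DimCol)),
       VAssign 3 (Scal 18), SAssign 14 (Const 0), SAssign 16 (Scal 0 +. Const 1)]"
  have init: "hoare 5 0 (\<lambda>S V. K S V \<and> S 11 = G \<and> V 0 = x \<and> V 1 = z) (prims ?init) (LI 0)"
    by (rule hoare_prims) (use pp G0 in \<open>auto simp: K_def LI_def M_def fl_def \<kappa>_def U_def abs_mult\<close>)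
  \<comment> \<open>After \<open>Lg\<close> halvings of the logarithm,
    \<open>2 * Lg \<le> 2 ^ Lg\<close> leaves at most 2 of the factor
    \<open>2 ^ (2 * Lg)\<close>.\<close>
  have ratio_le: "NN * r0 powr (1 / 2 ^ Lg) \<le> rr"
  proof -
    have "r0 powr (1 / 2 ^ Lg) = (2 ^ (2 * Lg)) powr (1 / 2 ^ Lg) * (1 / cP) powr (1 / 2 ^ Lg)"
      using pp powr_mult[of "2 ^ (2 * Lg)" "1 / cP" "1 / 2 ^ Lg"] by (simp add: r0_def)
    also have "\<dots> \<le> 2 * (1 / cP)"
    proof (rule mult_mono)
      have "2 * Lg \<le> 2 ^ Lg"
      proof -
        have "2 * Suc k \<le> 2 ^ Suc k" for k by (induction k) auto
        from this[of "Lg - 1"] show ?thesis using Lg_props(2) by simp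
      qed
      then have l: "real (2 * Lg) * (1 / 2 ^ Lg) \<le> 1"
        by (metis (mono_tags, lifting) divide_le_eq_1_pos mult.right_neutral of_nat_le_iff of_nat_numeral of_nat_power times_divide_eq_right zero_less_numeral zero_less_power)
      have "((2::real) ^ (2 * Lg)) powr (1 / 2 ^ Lg) = (2 powr real (2 * Lg)) powr (1 / 2 ^ Lg)" by (subst powr_realpow) auto
      also have "\<dots> = 2 powr (real (2 * Lg) * (1 / 2 ^ Lg))" by (rule powr_powr)
      also have "\<dots> \<le> 2 powr 1" using l by (intro powr_mono) auto
      finally show "((2::real) ^ (2 * Lg)) powr (1 / 2 ^ Lg) \<le> 2" by simp
      have "(1 / cP) powr (1 / 2 ^ Lg) \<le> (1 / cP) powr 1" using pp by (intro powr_mono) auto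
      then show "(1 / cP) powr (1 / 2 ^ Lg) \<le> 1 / cP" using pp by simp
    qed auto
    finally have "NN * r0 powr (1 / 2 ^ Lg) \<le> NN * (2 * (1 / cP))" using pp by (intro mult_left_mono) auto
    then show ?thesis by (simp add: rr_def mult_ac)
  qed
  let ?mid = "[VAssign 4 (Comp 3 ^. (InQ -. Const 2)), VAssign 10 (Const 0), VAssign 11 (Const 0), SAssign 15 (Const 0)]"
  let ?fin = "[VAssign 0 (Comp 0 +. Comp 10), MatMul 1 0, VAssign 1 (Comp 1 -. Comp 2),
      SAssign 11 (Scal 11 *. (Const 1 -. Scal 3 /. Const 2))]"
  let ?Post = "\<lambda>S V. K S V \<and> S 11 = G * (1 - sP / 2) \<and> (\<forall>i<n. V 1 i = resid (V 0) i) \<and> (\<forall>y. cost (V 0) - cost y \<le> G * (1 - sP / 2))"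
  have rest: "hoare (real steps * 9 + 9) 0 (\<lambda>S V. M G fl \<kappa> x z S V \<and> V 3 = u)
      (prims ?mid ;; WhileLess (2 * 15) (2 * 12) (prims agd_prims) ;; prims ?fin) ?Post"
    if u0: "\<forall>i<n. 0 < u0 i" and ref: "refine zf \<kappa> NN u0 u" and rat: "ratio rr u0 u" for u0 u
  proof -
    note rf = refine_final[OF ref _ _ fl rat, where z = z]
    have u: "0 < u i" if "i < n" for i using rf(1)[OF _ _ _ _ _ that] u0 pp \<kappa> by (auto simp: zf_def)
    have mid: "hoare 4 0 (\<lambda>S V. M G fl \<kappa> x z S V \<and> V 3 = u) (prims ?mid)
       (\<lambda>S V. M G fl \<kappa> x z S V \<and> V 3 = u \<and> (\<forall>i<n. V 4 i = wt u i) \<and> S 15 = 0 \<and> V 10 = (\<lambda>_. 0) \<and> V 11 = (\<lambda>_. 0))"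
      by (rule hoare_prims) (use u in \<open>auto simp: M_def K_def wt_def abs_of_pos\<close>)
    have prog: "cost (\<lambda>j. x j + X j) - cost y \<le> (1 - sP / 2) * G"
      if j: "kmax \<le> real j" and en: "\<forall>y. energy z u y j X V' \<le> energy z u y 0 (\<lambda>_. 0) (\<lambda>_. 0)" for j :: nat and X V' y
    proof -
      have zr: "\<bar>resid x i\<bar> = \<bar>z i\<bar>" if "i < n" for i using z[OF that] by simp
      \<comment> \<open>\<open>\<kappa>\<close> is proportional to \<open>G\<close>, so the number
        of accelerated steps is the same in every phase and is computed once.\<close>
      have Qe: "3 * (8 / ((q - 1) * sP)) * G * rr\<^sup>2 / \<kappa> = QQ"
        using pp G0 dn q by (simp add: QQ_def \<kappa>_def power2_eq_square field_simps)
      have Q1: "1 \<le> QQ"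
      proof -
        have ge1: "1 \<le> a * b" if "1 \<le> a" "1 \<le> b" for a b :: real using mult_mono[of 1 a 1 b] that by simp
        have "(q - 1) * sP \<le> 1 * 1" using q pp by (intro mult_mono) auto
        moreover have "0 < (q - 1) * sP" using q pp by simp
        ultimately have q1: "1 \<le> 3 * (8 / ((q - 1) * sP))" by (simp add: le_divide_eq)
        then have "1 \<le> 3 * (8 / ((q - 1) * sP)) * rr * rr * rr * NN * real d"
          using pp d by (intro ge1[OF ge1[OF ge1[OF ge1[OF ge1[OF q1]]]]]) auto
        moreover have "1 \<le> a / cP" if "1 \<le> a" for a using that pp by (simp add: le_divide_eq)
        ultimately show ?thesis unfolding QQ_def by blast
      qed
      have k0: "0 < kmax" unfolding kmax_def using q Q1 by simp
      then have j0: "0 < real j" using j by simp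
      show ?thesis
      proof (rule phase_progress[where u = u and \<kappa> = \<kappa> and r = rr and k = "real j"])
        show "sP = ((q - 1) / 20) powr (1 / (q - 1))" by (rule sP_def)
        show "\<And>i. i < n \<Longrightarrow> \<bar>resid x i\<bar> \<le> u i"
          using rf(2) u0 pp \<kappa> zr by (auto simp: zf_def)
        show "\<And>i. i < n \<Longrightarrow> \<kappa> * lev (wt u) i \<le> rr\<^sup>2 * (u i)\<^sup>2"
          using rf(3) u0 pp \<kappa> by (auto simp: zf_def)
        show "1 \<le> 3 * (8 / ((q - 1) * sP)) * G * rr\<^sup>2 / \<kappa>" unfolding Qe by (rule Q1)
        show "sqrt (1920 / (q - 1)) * (3 * (8 / ((q - 1) * sP)) * G * rr\<^sup>2 / \<kappa>) powr (1 - q / 2) \<le> real j"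
          unfolding Qe using j q by (simp add: kmax_def powr_half_sqrt)
        have "(\<Sum>i<n. if u i = \<bar>resid x i\<bar> then 0 else u i powr q) = (\<Sum>i<n. if u i = \<bar>z i\<bar> then 0 else u i powr q)"
          using zr by (intro sum.cong) auto
        also have "\<dots> \<le> real n * fl powr q + NN * rr * \<kappa> * real d"
          using rf(4) u0 pp \<kappa> by (auto simp: zf_def)
        also have "\<dots> = 2 * cP * G" using pp dn by (simp add: flq \<kappa>_def)
        finally show "2 * (\<Sum>i<n. if u i = \<bar>resid x i\<bar> then 0 else u i powr q) \<le> sP * G / 4"
          by (simp add: cP_def)
        fix y
        let ?S = "\<Sum>i<n. potential (resid x) u i (mulA X i) - potential (resid x) u i (mulA y i)"
        have Sz: "?S = (\<Sum>i<n. potential z u i (mulA X i) - potential z u i (mulA y i))"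
          using z by (intro sum.cong) (auto simp: potential_def)
        have W0: "0 \<le> (\<Sum>i<n. wt u i / 2 * (a i)\<^sup>2)" for a
          using u by (intro sum_nonneg) (auto simp: wt_def)
        have m0: "mulA (\<lambda>_. 0) i = 0" for i by (simp add: mulA_def)
        have "real j * (real j + 1) / 4 * ?S + (\<Sum>i<n. wt u i / 2 * (mulA y i - mulA V' i)\<^sup>2) \<le> (\<Sum>i<n. wt u i / 2 * (mulA y i)\<^sup>2)"
          using en[rule_format, of y] by (simp add: energy_def Sz m0)
        then have e1: "real j * (real j + 1) / 4 * ?S \<le> (\<Sum>i<n. wt u i / 2 * (mulA y i)\<^sup>2)"
          using W0[of "\<lambda>i. mulA y i - mulA V' i"] by linarith
        \<comment> \<open>The energy carries \<open>j * (j + 1)\<close> instead of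
          \<open>j ^ 2\<close>, which is stronger only if \<open>?S\<close> is nonnegative;
          otherwise the left-hand side is not positive.\<close>
        show "(real j)\<^sup>2 / 4 * ?S \<le> (\<Sum>i<n. wt u i / 2 * (mulA y i)\<^sup>2)"
        proof (cases "0 \<le> ?S")
          case True
          have "(real j)\<^sup>2 / 4 * ?S \<le> real j * (real j + 1) / 4 * ?S"
            using True by (intro mult_right_mono) (auto simp: power2_eq_square distrib_left)
          with e1 show ?thesis by linarith
        next
          case False
          then have "(real j)\<^sup>2 / 4 * ?S \<le> 0" by (intro mult_nonneg_nonpos) auto
          then show ?thesis using W0[of "mulA y"] by linarith
        qed
      qed (use G0 gap u \<kappa> j0 in auto)
    qed
    have fin: "hoare 4 0 (\<lambda>S V. M G fl \<kappa> x z S V \<and> (\<exists>j::nat. kmax \<le> real j \<and> (\<forall>y. energy z u y j (V 10) (V 11) \<le> energy z u y 0 (\<lambda>_. 0) (\<lambda>_. 0))))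
        (prims ?fin) ?Post"
    proof (rule hoare_prims)
      fix S :: scalars and V :: vectors
      assume h: "M G fl \<kappa> x z S V \<and> (\<exists>j::nat. kmax \<le> real j \<and> (\<forall>y. energy z u y j (V 10) (V 11) \<le> energy z u y 0 (\<lambda>_. 0) (\<lambda>_. 0)))"
      then have "cost (\<lambda>j. x j + V 10 j) - cost y \<le> G * (1 - sP / 2)" for y
        using prog by (auto simp: mult.commute)
      then show "prims_ok ?fin (S, V) \<and> (case prims_sem ?fin (S, V) of (S', V') \<Rightarrow> ?Post S' V')"
        using h by (simp add: M_def K_def resid_def)
    qed simp
    show ?thesis by (rule hoare_conseq[OF hoare_seq[OF mid hoare_seq[OF agd_loop[OF u] fin]]]) auto
  qed
  have tail: "hoare (real steps * 9 + 9) 0 (\<lambda>S V. \<exists>i. LI i S V \<and> \<not> S 14 < S 16)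
      (prims ?mid ;; WhileLess (2 * 15) (2 * 12) (prims agd_prims) ;; prims ?fin) ?Post"
  proof (rule hoareI)
    fix S V and \<eta> :: real assume h: "\<exists>i. LI i S V \<and> \<not> S 14 < S 16" "0 \<le> \<eta>" "\<eta> \<le> 1"
    then obtain i where i: "LI i S V" "\<not> S 14 < S 16" by blast
    then have "i = Suc Lg" by (auto simp: LI_def M_def)
    then obtain u0 where u0: "\<forall>i<n. 0 < u0 i" "refine zf \<kappa> NN u0 (V 3)" "ratio (NN * r0 powr (1 / 2 ^ Lg)) u0 (V 3)"
      using i by (auto simp: LI_def)
    have "0 < V 3 k" if "k < n" for k using refine_pos[OF u0(2) _ that] zf0 by blast
    then have "ratio rr u0 (V 3)" using u0 ratio_le
      unfolding ratio_def by (meson less_imp_le mult_right_mono order_trans)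
    from hoareD[OF rest[OF u0(1,2) this] _ h(2,3)] i(1)
    show "wp (prims ?mid ;; WhileLess (2 * 15) (2 * 12) (prims agd_prims) ;; prims ?fin) ((real steps * 9 + 9) * (500 * T)) S V (0 + \<eta>)
       (\<lambda>S V. if ?Post S V then \<eta> else 1)" by (simp add: LI_def)
  qed
  show ?thesis unfolding phase_com_def
    by (rule hoare_conseq[OF hoare_seq[OF init hoare_seq[OF lewis tail]]]) (use fail_nonneg in \<open>auto simp: algebra_simps\<close>)
qed

end

section \<open>Number of phases, time and failure probability\<close>

lemma powr_sum_le:
  fixes t :: "nat \<Rightarrow> real"
  assumes "\<And>i. 0 \<le> t i" "0 < a" "a \<le> 1"
  shows "(\<Sum>i<m. t i) powr a \<le> (\<Sum>i<m. t i powr a)"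
proof (induction m)
  case (Suc m)
  have "((\<Sum>i<m. t i) + t m) powr a \<le> (\<Sum>i<m. t i) powr a + t m powr a"
    by (rule powr_subadd) (use assms in \<open>auto intro: sum_nonneg\<close>)
  then show ?case using Suc by simp
qed simp

context algorithm begin

text \<open>Pythagoras: by the normal equations the residual of \<open>x0\<close> is orthogonal to
  the range of the matrix.\<close>

lemma least_squares: "(\<Sum>i<n. (resid x0 i)\<^sup>2) \<le> (\<Sum>i<n. (resid y i)\<^sup>2)"
proof -
  define e where "e j = 1 * y j + (- 1) * x0 j" for j
  have "resid y i = resid x0 i + mulA e i" for i
    unfolding e_def mulA_linear by (simp add: resid_def)
  then have "(resid y i)\<^sup>2 = (resid x0 i)\<^sup>2 + 2 * (resid x0 i * mulA e i) + (mulA e i)\<^sup>2" for i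
    by (simp add: power2_sum)
  then have "(\<Sum>i<n. (resid y i)\<^sup>2) = (\<Sum>i<n. (resid x0 i)\<^sup>2) + 2 * (\<Sum>i<n. resid x0 i * mulA e i) + (\<Sum>i<n. (mulA e i)\<^sup>2)"
    by (simp add: sum.distrib sum_distrib_left)
  moreover have "(\<Sum>i<n. resid x0 i * mulA e i) = 0"
    using sol_mulT_inner[where w = "\<lambda>_. 1" and g = "vec_index b" and x = e]
    by (simp add: resid_def x0_def left_diff_distrib sum_subtractf)
  moreover have "0 \<le> (\<Sum>i<n. (mulA e i)\<^sup>2)" by (intro sum_nonneg) auto
  ultimately show ?thesis by linarith
qed

text \<open>Every residual of \<open>x0\<close> is bounded by the Euclidean norm of any residual
  vector, which is at most its \<open>q\<close>-norm by subadditivity of the power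
  \<open>q / 2\<close>; summing over \<open>n\<close> rows gives the factor.\<close>

lemma F0_le: "F0 \<le> real n * cost y"
proof -
  have h: "0 < q / 2" "q / 2 \<le> 1" using q by auto
  have "\<bar>resid x0 i\<bar> powr q \<le> cost y" if i: "i < n" for i
  proof -
    have "\<bar>resid x0 i\<bar> powr q = ((resid x0 i)\<^sup>2) powr (q / 2)" by (simp add: sq_powr)
    also have "\<dots> \<le> (\<Sum>i<n. (resid y i)\<^sup>2) powr (q / 2)"
    proof (rule powr_mono2)
      have "(resid x0 i)\<^sup>2 \<le> (\<Sum>i<n. (resid x0 i)\<^sup>2)" using i by (intro member_le_sum) auto
      then show "(resid x0 i)\<^sup>2 \<le> (\<Sum>i<n. (resid y i)\<^sup>2)" using least_squares[of y] by linarith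
    qed (use h in auto)
    also have "\<dots> \<le> (\<Sum>i<n. ((resid y i)\<^sup>2) powr (q / 2))" by (rule powr_sum_le) (use h in auto)
    also have "\<dots> = cost y" by (simp add: cost_def sq_powr)
    finally show ?thesis .
  qed
  then have "F0 \<le> (\<Sum>i<n. cost y)" unfolding F0_def cost_def[of x0] by (intro sum_mono) auto
  then show ?thesis by simp
qed

definition phases :: nat where "phases = nat \<lceil>2 * real Lg / sP\<rceil>"

definition phase_time :: real where
  "phase_time = real (Suc Lg) * (real samples * 8 + 7) + real steps * 9 + 20"

lemma main_correct:
  "hoare (real Lg * 3 + real phases * (phase_time + 1) + 23) (real phases * (real (Suc Lg) * fail)) (\<lambda>S V. True) (main_com D)
    (\<lambda>S V. \<forall>y. cost (V 0) \<le> (1 + \<epsilon>) * cost y)"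
proof -
  note pp = param_props sP_props
  have s1: "0 \<le> 1 - sP / 2" "1 - sP / 2 \<le> 1" using pp by auto
  define I where "I j S V \<longleftrightarrow> K S V \<and> S 11 = F0 * (1 - sP / 2) ^ j \<and> (\<forall>i<n. V 1 i = resid (V 0) i) \<and> (\<forall>y. cost (V 0) - cost y \<le> S 11)"
    for j :: nat and S :: scalars and V :: vectors
  have start: "I 0 S V" if h: "K S V \<and> S 11 = F0 \<and> (\<forall>j<d. V 0 j = x0 j) \<and> (\<forall>i<n. V 1 i = resid x0 i)" for S V
  proof -
    have "cost (V 0) = F0" using cost_cong[of "V 0" x0] h by (simp add: F0_def)
    moreover have "0 \<le> cost y" for y by (simp add: cost_def sum_nonneg)
    moreover have "resid (V 0) i = resid x0 i" for i using resid_cong[of "V 0" x0] h by simp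
    ultimately show ?thesis using h by (simp add: I_def)
  qed
  have body: "hoare phase_time (real (Suc Lg) * fail) (\<lambda>S V. I j S V \<and> S 10 < S 11) phase_com (I (Suc j))" for j
  proof (rule hoareI)
    fix S V and \<eta> :: real assume h: "I j S V \<and> S 10 < S 11" "0 \<le> \<eta>" "\<eta> \<le> 1"
    have "F0 * (1 - sP / 2) ^ j \<le> F0 * 1" using s1 F0_nonneg by (intro mult_left_mono power_le_one) auto
    then have G: "F0 / 2 ^ Lg < S 11" "S 11 \<le> F0" using h(1) by (auto simp: I_def K_def)
    have "wp phase_com (phase_time * (500 * T)) S V (real (Suc Lg) * fail + \<eta>)
        (\<lambda>S' V'. if K S' V' \<and> S' 11 = S 11 * (1 - sP / 2) \<and> (\<forall>i<n. V' 1 i = resid (V' 0) i) \<and> (\<forall>y. cost (V' 0) - cost y \<le> S 11 * (1 - sP / 2))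
          then \<eta> else 1)"
      unfolding phase_time_def
      by (rule hoareD[OF phase_correct[OF G, where x = "V 0" and z = "V 1"]]) (use h in \<open>auto simp: I_def\<close>)
    then show "wp phase_com (phase_time * (500 * T)) S V (real (Suc Lg) * fail + \<eta>) (\<lambda>S V. if I (Suc j) S V then \<eta> else 1)"
      by (rule wp_mono) (use h in \<open>auto simp: I_def mult_ac\<close>)
  qed
  have bound: "j < phases" if h: "I j S V" "S 10 < S 11" for j S V
  proof -
    have lt: "F0 / 2 ^ Lg < F0 * (1 - sP / 2) ^ j" using h by (simp add: I_def K_def)
    \<comment> \<open>For \<open>F0 = 0\<close> the initial and the final gap agree, so the loop is
      not entered and the least squares solution is returned.\<close>
    then have F: "0 < F0" using F0_nonneg by (cases "F0 = 0") auto
    have "F0 * (1 / 2 ^ Lg) < F0 * (1 - sP / 2) ^ j" using lt by simp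
    then have "1 / 2 ^ Lg < (1 - sP / 2) ^ j" using F by (simp only: mult_less_cancel_left_pos)
    also have "\<dots> \<le> exp (- (sP / 2)) ^ j" using exp_ge_add_one_self[of "- (sP / 2)"] s1 by (intro power_mono) auto
    also have "\<dots> = exp (- (real j * (sP / 2)))" by (simp add: exp_of_nat_mult[symmetric])
    finally have "1 / 2 ^ Lg < exp (- (real j * (sP / 2)))" .
    moreover have "exp (- real Lg) \<le> 1 / 2 ^ Lg"
    proof -
      have "(2::real) ^ Lg \<le> exp 1 ^ Lg" using exp_ge_add_one_self[of "1::real"] by (intro power_mono) auto
      then have "2 ^ Lg \<le> exp (real Lg)" by (simp add: exp_of_nat_mult[symmetric])
      then have "1 / exp (real Lg) \<le> 1 / 2 ^ Lg" by (intro divide_left_mono) auto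
      then show ?thesis by (simp add: exp_minus inverse_eq_divide)
    qed
    ultimately have "exp (- real Lg) < exp (- (real j * (sP / 2)))" by linarith
    then have "real j * (sP / 2) < real Lg" by simp
    then have "real j < 2 * real Lg / sP" using pp by (simp add: field_simps)
    then show ?thesis unfolding phases_def by linarith
  qed
  have pt: "0 \<le> phase_time" by (simp add: phase_time_def)
  have loop: "hoare (real phases * (phase_time + 1) + 1) (real phases * (real (Suc Lg) * fail)) (I 0)
      (WhileLess (2 * 10) (2 * 11) phase_com) (\<lambda>S V. \<exists>j. I j S V \<and> \<not> S 10 < S 11)"
    by (rule hoare_while[where I = I and a = 10 and b' = 11, OF _ _ pt _ body bound]) (use fail_nonneg in auto)
  have fin: "\<forall>y. cost (V 0) \<le> (1 + \<epsilon>) * cost y" if h: "\<exists>j. I j S V \<and> \<not> S 10 < S 11" for S V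
  proof
    fix y
    obtain j where j: "I j S V" "\<not> S 10 < S 11" using h by blast
    have c0: "0 \<le> cost y" by (simp add: cost_def sum_nonneg)
    have "cost (V 0) - cost y \<le> S 11" "S 11 \<le> F0 / 2 ^ Lg" using j by (auto simp: I_def K_def)
    then have "cost (V 0) \<le> cost y + F0 / 2 ^ Lg" by linarith
    also have "F0 / 2 ^ Lg \<le> \<epsilon> * cost y"
    proof -
      have "F0 \<le> real n * cost y" by (rule F0_le)
      also have "\<dots> \<le> (\<epsilon> * 2 ^ Lg) * cost y" using n_le_pow(2) eps c0 by (intro mult_right_mono) (auto simp: field_simps)
      finally show ?thesis by (simp add: field_simps)
    qed
    finally show "cost (V 0) \<le> (1 + \<epsilon>) * cost y" by (simp add: algebra_simps)
  qed
  have pre: "hoare 17 0 (\<lambda>S V. S 0 = real Lg \<and> S 1 = 2 ^ Lg \<and> V 2 = vec_index b) (setup_com D) (I 0)"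
    by (rule hoare_conseq[OF setup_correct]) (use start in auto)
  show ?thesis unfolding main_com_def
    by (rule hoare_conseq[OF hoare_seq[OF log_correct hoare_seq[OF pre loop]]]) (use fin fail_nonneg in auto)
qed

text \<open>All parameters are bounded by fixed powers of \<open>ZZ\<close>.\<close>

definition ZZ :: real where "ZZ = real D * (real Lg * (1 / sP))"

lemma ZZ_props: "1 \<le> ZZ" "1 / sP \<le> ZZ" "real Lg \<le> ZZ" "real Lg * (1 / sP) \<le> ZZ" "Lam \<le> 2 * ZZ"
proof -
  note pp = param_props sP_props
  have L: "1 \<le> real Lg" using Lg_props(2) by simp
  have D1: "1 \<le> real D" using D by simp
  have a: "real Lg * 1 \<le> real Lg * (1 / sP)" "1 * (1 / sP) \<le> real Lg * (1 / sP)" using pp L by (intro mult_mono; simp)+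
  have z: "1 * (real Lg * (1 / sP)) \<le> ZZ" unfolding ZZ_def using D1 pp L by (intro mult_right_mono) auto
  then show "real Lg * (1 / sP) \<le> ZZ" by simp
  with a show "1 / sP \<le> ZZ" "real Lg \<le> ZZ" by auto
  with L show "1 \<le> ZZ" by linarith
  have "real D * (real Lg + 1 / sP) \<le> real D * (2 * (real Lg * (1 / sP)))" using a D1 by (intro mult_left_mono) auto
  then show "Lam \<le> 2 * ZZ" by (simp add: Lam_def ZZ_def mult_ac)
qed

lemma pow_bound:
  fixes Z :: real
  assumes "s \<le> x * Z ^ i" "t \<le> y * Z ^ j" "0 \<le> s" "0 \<le> t" "0 \<le> x" "1 \<le> Z"
  shows "s * t \<le> (x * y) * Z ^ (i + j)"
proof -
  have "s * t \<le> (x * Z ^ i) * (y * Z ^ j)" using assms by (intro mult_mono) auto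
  then show ?thesis by (simp add: power_add mult_ac)
qed

lemma dexp: "1 \<le> real d powr (1 - q / 2)"
  using d q by (intro ge_one_powr_ge_zero) auto

text \<open>In \<open>ZZ\<close> the degree of \<open>NN\<close> is 2, that of \<open>rr\<close> is
  3 and that of \<open>QQ\<close> is 14; a factor \<open>1 / (q - 1)\<close> adds one. Only
  \<open>d\<close> keeps the exponent \<open>1 - q / 2\<close>; the rest is at least 1 and may be
  raised to the power 1.\<close>

lemma kmax_bound: "kmax \<le> 1920 * (384 * (5632 ^ 3 * 176)) * ZZ ^ 15 * real d powr (1 - q / 2)"
proof -
  note pp = param_props sP_props
  note Z = ZZ_props
  have Z0: "0 \<le> ZZ" using Z(1) by simp
  have sg: "1 / sP \<le> 1 * ZZ ^ 1" "0 \<le> 1 / sP" using Z pp by auto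
  have Lz: "Lam \<le> 2 * ZZ ^ 1" "0 \<le> Lam" using Z pp by auto
  have "NN \<le> (44 * Lam) * Lam" unfolding NN_def using pp by (intro mult_right_mono) auto
  also have "\<dots> \<le> (88 * 2) * ZZ ^ (1 + 1)" by (rule pow_bound) (use Lz Z in auto)
  finally have N: "NN \<le> 176 * ZZ ^ 2" "0 \<le> NN" using pp by (auto simp: numeral_2_eq_2)
  have "rr = (32 * (1 / sP)) * NN" by (simp add: rr_def cP_def)
  also have "\<dots> \<le> (32 * 176) * ZZ ^ (1 + 2)" by (rule pow_bound) (use sg N Z in auto)
  finally have r: "rr \<le> 5632 * ZZ ^ 3" "0 \<le> rr" using pp by (auto simp: power3_eq_cube mult.assoc)
  have r2: "rr * rr \<le> (5632 * 5632) * ZZ ^ (3 + 3)" by (rule pow_bound) (use r Z in auto)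
  have r3: "(rr * rr) * rr \<le> (5632 * 5632 * 5632) * ZZ ^ (3 + 3 + 3)" by (rule pow_bound[OF r2 r(1)]) (use r Z in auto)
  have r4: "(rr * rr * rr) * NN \<le> (5632 * 5632 * 5632 * 176) * ZZ ^ (3 + 3 + 3 + 2)" by (rule pow_bound[OF r3 N(1)]) (use r N Z in auto)
  have qi: "1 / (q - 1) \<le> 1 / sP"
    using pp q by (intro divide_left_mono) auto
  have s2: "(1 / sP) * (1 / sP) \<le> (1 * 1) * ZZ ^ (1 + 1)" by (rule pow_bound[OF sg(1) sg(1)]) (use sg Z in auto)
  have s3: "(1 / (q - 1)) * ((1 / sP) * (1 / sP)) \<le> (1 * (1 * 1)) * ZZ ^ (1 + (1 + 1))"
    by (rule pow_bound[OF _ s2]) (use qi sg q Z in auto)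
  have all: "(1 / (q - 1)) * ((1 / sP) * (1 / sP)) * (rr * rr * rr * NN) \<le> (1 * (1 * 1) * (5632 * 5632 * 5632 * 176)) * ZZ ^ (1 + (1 + 1) + (3 + 3 + 3 + 2))"
    by (rule pow_bound[OF s3 r4]) (use r N sg q Z in auto)
  define X where "X = (384 * (5632 ^ 3 * 176)) * ZZ ^ 14"
  have X1: "1 \<le> X"
  proof -
    have "1 * 1 \<le> (384 * (5632 ^ 3 * 176)) * ZZ ^ 14" using Z(1) by (intro mult_mono one_le_power) auto
    then show ?thesis by (simp add: X_def)
  qed
  have "QQ = 384 * ((1 / (q - 1)) * ((1 / sP) * (1 / sP)) * (rr * rr * rr * NN)) * real d"
    using pp q by (simp add: QQ_def cP_def field_simps)
  also have "\<dots> \<le> X * real d"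
    using all by (intro mult_right_mono) (auto simp: X_def power3_eq_cube)
  finally have QX: "QQ \<le> X * real d" .
  have Q0: "0 \<le> QQ" using pp q by (simp add: QQ_def)
  have "QQ powr (1 - q / 2) \<le> (X * real d) powr (1 - q / 2)" using QX Q0 q by (intro powr_mono2) auto
  also have "\<dots> = X powr (1 - q / 2) * real d powr (1 - q / 2)" using X1 by (simp add: powr_mult)
  also have "\<dots> \<le> X * real d powr (1 - q / 2)"
  proof (rule mult_right_mono)
    have "X powr (1 - q / 2) \<le> X powr 1" using X1 q by (intro powr_mono) auto
    then show "X powr (1 - q / 2) \<le> X" using X1 by simp
  qed simp
  finally have Qp: "QQ powr (1 - q / 2) \<le> X * real d powr (1 - q / 2)" .
  have "(1920 / (q - 1)) powr (1 / 2) \<le> (1920 / (q - 1)) powr 1" using q by (intro powr_mono) (auto simp: field_simps)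
  also have "\<dots> = 1920 * (1 / (q - 1))" using q by simp
  also have "\<dots> \<le> 1920 * ZZ" using qi Z(2) by simp
  finally have "kmax \<le> (1920 * ZZ) * (X * real d powr (1 - q / 2))" unfolding kmax_def using Qp Z0 by (intro mult_mono) auto
  also have "\<dots> = 1920 * (384 * (5632 ^ 3 * 176)) * ZZ ^ 15 * real d powr (1 - q / 2)"
  proof -
    have "ZZ ^ 15 = ZZ * ZZ ^ 14" using power_Suc[of ZZ 14] by simp
    then show ?thesis by (simp add: X_def mult_ac)
  qed
  finally show ?thesis .
qed

lemma time_bound:
  "real Lg * 3 + real phases * (phase_time + 1) + 23 \<le> 10 ^ 21 * ZZ ^ 16 * real d powr (1 - q / 2)"
proof -
  note pp = param_props sP_props
  note Z = ZZ_props
  define c where "c = (1920 * (384 * (5632 ^ 3 * 176)) :: real)"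
  define W where "W = ZZ ^ 15 * real d powr (1 - q / 2)"
  have Zp: "ZZ ^ k \<le> ZZ ^ 15" if "k \<le> 15" for k using Z(1) that by (intro power_increasing) auto
  have W: "ZZ ^ 15 \<le> W" unfolding W_def using mult_left_mono[OF dexp, of "ZZ ^ 15"] Z(1) by simp
  have W1: "1 \<le> W" "ZZ \<le> W" "ZZ ^ 2 \<le> W" using Zp[of 0] Zp[of 1] Zp[of 2] W by auto
  have st: "real steps \<le> c * W + 1"
  proof -
    have "kmax \<le> c * W" using kmax_bound by (simp add: c_def W_def mult.assoc)
    moreover have "0 \<le> c * W" using W1 by (simp add: c_def)
    ultimately show ?thesis unfolding steps_def by linarith
  qed
  have "real (Suc Lg) * (real samples * 8 + 7) \<le> (2 * ZZ) * (183 * ZZ)"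
    using Z samples_props(2) pp by (intro mult_mono) auto
  also have "\<dots> = 366 * ZZ ^ 2" by (simp add: power2_eq_square)
  also have "\<dots> \<le> 366 * W" using W1 by simp
  finally have "phase_time + 1 \<le> 366 * W + (9 * (c * W) + 9 + 21)" unfolding phase_time_def using st by simp
  also have "\<dots> \<le> (396 + 9 * c) * W" using W1 by (simp add: algebra_simps)
  finally have pt: "phase_time + 1 \<le> (396 + 9 * c) * W" .
  have ph: "real phases \<le> 3 * ZZ"
  proof -
    have "0 \<le> 2 * real Lg / sP" using pp by simp
    then have "real phases \<le> 2 * real Lg / sP + 1" unfolding phases_def by linarith
    also have "2 * real Lg / sP \<le> 2 * ZZ" using Z(4) by simp
    finally show ?thesis using Z(1) by linarith
  qed
  have p0: "0 \<le> phase_time + 1" by (simp add: phase_time_def)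
  have c0: "0 \<le> c" by (simp add: c_def)
  have "real phases * (phase_time + 1) \<le> (3 * ZZ) * ((396 + 9 * c) * W)"
    using ph pt p0 Z(1) by (intro mult_mono) auto
  moreover have "real Lg * 3 + 23 \<le> 26 * (ZZ * W)"
  proof -
    have "ZZ * 1 \<le> ZZ * W" using W1 Z(1) by (intro mult_left_mono) auto
    then show ?thesis using Z(1,3) by linarith
  qed
  ultimately have "real Lg * 3 + real phases * (phase_time + 1) + 23 \<le> (26 + 3 * (396 + 9 * c)) * (ZZ * W)"
    by (simp add: algebra_simps)
  \<comment> \<open>The constant is dominated by \<open>27 * c\<close>, about
    \<open>6.3 * 10 ^ 20\<close>.\<close>
  also have "\<dots> \<le> 10 ^ 21 * (ZZ * W)" using W1 Z(1) by (intro mult_right_mono) (auto simp: c_def)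
  also have "\<dots> = 10 ^ 21 * ZZ ^ 16 * real d powr (1 - q / 2)"
    by (simp add: W_def power_Suc[of ZZ 15, symmetric] mult.assoc[symmetric])
  finally show ?thesis .
qed

text \<open>One half of the exponent in \<open>exp (- Lam)\<close> absorbs all polynomial factors:
  \<open>126 * Lam ^ 4 \<le> (Lam / 10) ^ 5\<close>, because \<open>Lam\<close> is at least
  \<open>20 * D\<close>, hence the size of \<open>D\<close>. The other half gives
  \<open>n powr (- (C + 1))\<close>, whose extra power compensates the union over the rows.\<close>

lemma fail_bound:
  assumes C: "0 < C" and DC: "2 * (C + 1) \<le> real D" "1000000 \<le> D"
  shows "real phases * (real (Suc Lg) * fail) \<le> real n powr (- C)"
proof -
  note pp = param_props sP_props
  have L: "1 \<le> real Lg" using Lg_props(2) by simp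
  define t where "t = real Lg + 1 / sP"
  have t: "1 \<le> t" "real Lg \<le> t" "1 / sP \<le> t" "20 \<le> t" using pp L by (auto simp: t_def)
  have Lt: "Lam = real D * t" by (simp add: Lam_def t_def)
  have tL: "t \<le> Lam" unfolding Lt using D t mult_right_mono[of 1 "real D" t] by simp
  have L20: "20 * real D \<le> Lam" unfolding Lt using t mult_left_mono[of 20 t "real D"] by (simp add: mult.commute)
  have ph: "real phases * real (Suc Lg) \<le> 6 * Lam ^ 3"
  proof -
    have "0 \<le> 2 * real Lg / sP" using pp by simp
    then have "real phases \<le> 2 * real Lg / sP + 1" unfolding phases_def by linarith
    also have "2 * real Lg / sP = 2 * (real Lg * (1 / sP))" by simp
    also have "real Lg * (1 / sP) \<le> Lam * Lam" using t tL pp L by (intro mult_mono) auto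
    finally have "real phases \<le> 2 * (Lam * Lam) + 1" by simp
    moreover have "1 * 1 \<le> Lam * Lam" using pp by (intro mult_mono) auto
    ultimately have "real phases \<le> 3 * (Lam * Lam)" by simp
    moreover have "real (Suc Lg) \<le> 2 * Lam" using t tL L by simp
    ultimately have "real phases * real (Suc Lg) \<le> (3 * (Lam * Lam)) * (2 * Lam)" using pp by (intro mult_mono) auto
    then show ?thesis by (simp add: power3_eq_cube)
  qed
  have f: "fail \<le> real n * exp (- Lam) * (21 * Lam)"
  proof -
    have "(9 / 10 :: real) ^ samples \<le> exp (- (1 / 10)) ^ samples"
      using exp_ge_add_one_self[of "- (1 / 10) :: real"] by (intro power_mono) auto
    also have "\<dots> = exp (- (real samples / 10))" by (simp add: exp_of_nat_mult[symmetric])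
    also have "\<dots> \<le> exp (- Lam)" using samples_props(1) by simp
    finally have "real n * (9 / 10) ^ samples \<le> real n * exp (- Lam)" by (intro mult_left_mono) auto
    moreover have "real samples * (real n * (2 * exp (- Lam))) \<le> (10 * Lam + 1) * (real n * (2 * exp (- Lam)))"
      using samples_props(2) by (intro mult_right_mono) auto
    ultimately have "fail \<le> real n * exp (- Lam) * (20 * Lam + 3)" unfolding fail_def by (simp add: algebra_simps)
    also have "\<dots> \<le> real n * exp (- Lam) * (21 * Lam)" using pp by (intro mult_left_mono) auto
    finally show ?thesis .
  qed
  have "real phases * (real (Suc Lg) * fail) = (real phases * real (Suc Lg)) * fail" by simp
  also have "\<dots> \<le> (6 * Lam ^ 3) * (real n * exp (- Lam) * (21 * Lam))"
    by (rule mult_mono[OF ph f]) (use fail_nonneg pp in auto)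
  also have "\<dots> = (126 * Lam ^ 4 * exp (- Lam / 2)) * (real n * exp (- Lam / 2))"
  proof -
    have "exp (- Lam) = exp (- Lam / 2) * exp (- Lam / 2)" by (simp add: exp_add[symmetric])
    then show ?thesis by (simp add: power3_eq_cube power4_eq_xxxx)
  qed
  also have "\<dots> \<le> 1 * (real n * exp (- Lam / 2))"
  proof (rule mult_right_mono)
    have "Lam / 10 \<le> exp (Lam / 10)" using exp_ge_add_one_self[of "Lam / 10"] by linarith
    then have "(Lam / 10) ^ 5 \<le> exp (Lam / 10) ^ 5" using pp by (intro power_mono) auto
    also have "\<dots> = exp (Lam / 2)" by (simp add: exp_of_nat_mult[symmetric])
    finally have e: "(Lam / 10) ^ 5 \<le> exp (Lam / 2)" .
    have "126 * Lam ^ 4 \<le> (Lam / 10) ^ 5"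
    proof -
      have "126 * 10 ^ 5 \<le> Lam" using L20 DC(2) by simp
      then have "Lam ^ 4 * (126 * 10 ^ 5) \<le> Lam ^ 4 * Lam" using pp by (intro mult_left_mono) auto
      also have "\<dots> = Lam ^ 5" by (simp add: power_Suc2[symmetric])
      finally show ?thesis by (simp add: power_divide)
    qed
    with e have "126 * Lam ^ 4 \<le> exp (Lam / 2)" by linarith
    then have "126 * Lam ^ 4 * exp (- Lam / 2) \<le> exp (Lam / 2) * exp (- Lam / 2)" by (intro mult_right_mono) auto
    then show "126 * Lam ^ 4 * exp (- Lam / 2) \<le> 1" by (simp add: exp_add[symmetric])
  qed simp
  also have "\<dots> \<le> real n * real n powr (- (C + 1))"
  proof -
    have "ln (real n) \<le> real Lg"
    proof -
      have "ln (real n) \<le> ln (2 ^ Lg)" using n_le_pow(1) n_pos by simp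
      also have "\<dots> = real Lg * ln 2" by (simp add: ln_realpow)
      also have "\<dots> \<le> real Lg * 1" using ln_2_less_1 by (intro mult_left_mono) auto
      finally show ?thesis by simp
    qed
    then have "(C + 1) * ln (real n) \<le> (C + 1) * real Lg" using C by (intro mult_left_mono) auto
    also have "\<dots> \<le> real D / 2 * real Lg" using DC by (intro mult_right_mono) auto
    also have "\<dots> \<le> real D / 2 * t" using t by (intro mult_left_mono) auto
    also have "\<dots> = Lam / 2" by (simp add: Lt)
    finally have "exp (- (Lam / 2)) \<le> exp (- ((C + 1) * ln (real n)))" by simp
    also have "\<dots> = real n powr (- (C + 1))" using n_pos by (simp add: powr_def algebra_simps)
    finally have "real n * exp (- (Lam / 2)) \<le> real n * real n powr (- (C + 1))" by (intro mult_left_mono) auto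
    then show ?thesis by simp
  qed
  also have "\<dots> = real n powr (- C)"
    using powr_add[of "real n" 1 "- (C + 1)"] n_pos by simp
  finally show ?thesis .
qed

end

section \<open>The machine program\<close>

text \<open>The addresses of the vectors are \<open>n\<close> apart and arise by repeated addition
  of register 1, as naturals cannot be multiplied.\<close>

definition pointers :: "nat \<Rightarrow> instr list" where
  "pointers k = map (\<lambda>j. NAdd (42 + 2 * j) (40 + 2 * j) 1) [0..<k]"

definition init_code :: "instr list" where
  "init_code = [NAdd 0 5 5, NAdd 0 0 1, NAdd 0 0 1, NConst 40 200, NAdd 40 40 0] @ pointers 15"

definition regression_program :: "nat \<Rightarrow> program" where
  "regression_program D = compile 0 (Code init_code ;; main_com D) @ [Halt 40]"

lemma effects_pointers:
  "\<exists>N'. effects (pointers k) (N, R) = (N', R) \<and> (\<forall>j\<le>k. N' (40 + 2 * j) = N 40 + j * N 1) \<and> (\<forall>a. odd a \<longrightarrow> N' a = N a)"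
proof (induction k)
  case 0
  show ?case by (auto simp: pointers_def)
next
  case (Suc k)
  then obtain N' where N': "effects (pointers k) (N, R) = (N', R)" "\<forall>j\<le>k. N' (40 + 2 * j) = N 40 + j * N 1" "\<forall>a. odd a \<longrightarrow> N' a = N a"
    by blast
  have "effects (pointers (Suc k)) (N, R) = (N'(42 + 2 * k := N' (40 + 2 * k) + N' 1), R)"
    using N'(1) by (simp add: pointers_def effects_append)
  moreover have "(N'(42 + 2 * k := N' (40 + 2 * k) + N' 1)) (40 + 2 * j) = N 40 + j * N 1" if "j \<le> Suc k" for j
  proof (cases "j = Suc k")
    case True
    then show ?thesis using N'(2,3) by simp
  next
    case False
    then show ?thesis using that N'(2) by simp
  qed
  moreover have "odd a \<Longrightarrow> (N'(42 + 2 * k := N' (40 + 2 * k) + N' 1)) a = N a" for a using N'(3) by auto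
  ultimately show ?case by blast
qed

lemma concat_pairs:
  fixes xs :: "(nat \<times> nat) list"
  shows "length (concat (map (\<lambda>(i, j). [i, j]) xs)) = 2 * length xs"
    "e < length xs \<Longrightarrow> concat (map (\<lambda>(i, j). [i, j]) xs) ! (2 * e) = fst (xs ! e)"
    "e < length xs \<Longrightarrow> concat (map (\<lambda>(i, j). [i, j]) xs) ! Suc (2 * e) = snd (xs ! e)"
proof -
  show "length (concat (map (\<lambda>(i, j). [i, j]) xs)) = 2 * length xs" by (induction xs) auto
  show "e < length xs \<Longrightarrow> concat (map (\<lambda>(i, j). [i, j]) xs) ! (2 * e) = fst (xs ! e)"
    by (induction xs arbitrary: e) (auto simp: nth_Cons split: nat.splits)
  show "e < length xs \<Longrightarrow> concat (map (\<lambda>(i, j). [i, j]) xs) ! Suc (2 * e) = snd (xs ! e)"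
    by (induction xs arbitrary: e) (auto simp: nth_Cons split: nat.splits)
qed

lemma list_mem_odd: "k < length xs \<Longrightarrow> list_mem xs (Suc (2 * k)) = xs ! k"
  by (simp add: list_mem_def)

context algorithm begin

lemma input_sim:
  fixes c :: config
  assumes c: "c = input_config A b q \<epsilon>"
  shows "\<exists>S V. sim (fst (effects init_code (nmem c, rmem c))) (snd (effects init_code (nmem c, rmem c))) S V"
proof -
  let ?N = "nmem c" and ?R = "rmem c"
  let ?xs = "n # d # length es # concat (map (\<lambda>(i, j). [i, j]) es)"
  let ?ys = "q # \<epsilon> # map (\<lambda>e. A $$ e) es @ list_of_vec b"
  have N: "?N = list_mem ?xs" using A by (simp add: c input_config_def nnz_def)
  have R: "?R = list_mem ?ys" by (simp add: c input_config_def)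
  have lb: "length (list_of_vec b) = n" using b by simp
  have n1: "?N 1 = n" "?N 3 = d" "?N 5 = length es"
    unfolding N using list_mem_odd[of 0 ?xs] list_mem_odd[of 1 ?xs] list_mem_odd[of 2 ?xs] by (simp_all add: numeral_eq_Suc)
  have ne: "?N (7 + 4 * e) = fst (es ! e) \<and> ?N (9 + 4 * e) = snd (es ! e) \<and> ?R (5 + 2 * e) = A $$ (es ! e)" if e: "e < length es" for e
  proof -
    have "?N (Suc (2 * (3 + 2 * e))) = ?xs ! (3 + 2 * e)" unfolding N by (rule list_mem_odd) (use e concat_pairs(1)[of es] in simp)
    moreover have "?N (Suc (2 * (4 + 2 * e))) = ?xs ! (4 + 2 * e)" unfolding N by (rule list_mem_odd) (use e concat_pairs(1)[of es] in simp)
    moreover have "?R (Suc (2 * (2 + e))) = ?ys ! (2 + e)" unfolding R by (rule list_mem_odd) (use e in simp)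
    ultimately show ?thesis using e concat_pairs(2,3)[OF e] by (simp add: nth_append numeral_eq_Suc add.assoc)
  qed
  have rb: "?R (5 + 2 * length es + 2 * i) = vec_index b i" if i: "i < n" for i
  proof -
    have "?R (Suc (2 * (2 + length es + i))) = ?ys ! (2 + length es + i)" unfolding R by (rule list_mem_odd) (use i lb in simp)
    also have "Suc (2 * (2 + length es + i)) = 5 + 2 * length es + 2 * i" by simp
    finally show ?thesis using i b by (simp add: nth_append list_of_vec_index)
  qed
  have r1: "?R 1 = q" "?R 3 = \<epsilon>" unfolding R using list_mem_odd[of 0 ?ys] list_mem_odd[of 1 ?ys] by (simp_all add: numeral_eq_Suc)
  let ?N1 = "?N(0 := 2 * length es + 2 * n, 40 := base)"
  have e1: "effects [NAdd 0 5 5, NAdd 0 0 1, NAdd 0 0 1, NConst 40 200, NAdd 40 40 0] (?N, ?R) = (?N1, ?R)"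
    using n1 by (auto simp: fun_eq_iff base_def)
  obtain N' where N': "effects (pointers 15) (?N1, ?R) = (N', ?R)" "\<forall>j\<le>15. N' (40 + 2 * j) = ?N1 40 + j * ?N1 1"
    "\<forall>a. odd a \<longrightarrow> N' a = ?N1 a"
    using effects_pointers by blast
  have "effects init_code (?N, ?R) = (N', ?R)" unfolding init_code_def effects_append e1 by (rule N'(1))
  \<comment> \<open>The initial abstract state is read off the memory; the main program works from
    any state.\<close>
  moreover have "sim N' ?R (\<lambda>a. ?R (2 * a)) (\<lambda>j i. ?R (base + j * n + i))"
  proof -
    have o: "N' a = ?N a" if "odd a" for a using N'(3) that by (auto simp: fun_upd_def)
    have p: "N' (40 + 2 * j) = base + j * n" if "j < 16" for j using N'(2) n1 that by simp
    show ?thesis unfolding sim_def using n1 ne rb r1 o p by simp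
  qed
  ultimately show ?thesis by auto
qed

text \<open>The summand 21 consists of 20 instructions of \<open>init_code\<close> and the final
  \<open>Halt\<close>.\<close>

lemma program_reach:
  assumes \<delta>: "real phases * (real (Suc Lg) * fail) \<le> \<delta>"
    and F: "\<And>y. y \<in> carrier_vec d \<Longrightarrow> (\<And>x. cost (vec_index y) \<le> (1 + \<epsilon>) * cost x) \<Longrightarrow> F y"
  shows "reach A T (regression_program D) F (input_config A b q \<epsilon>)
    (21 + (real Lg * 3 + real phases * (phase_time + 1) + 23) * (500 * T)) \<delta>"
proof -
  let ?P = "regression_program D" and ?c = "input_config A b q \<epsilon>"
  let ?t = "(real Lg * 3 + real phases * (phase_time + 1) + 23) * (500 * T)"
  let ?len = "com_len (Code init_code ;; main_com D)"
  have at: "code_at ?P 0 (compile 0 (Code init_code))"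
    "code_at ?P (length init_code) (compile (length init_code) (main_com D))"
    "?len < length ?P" "?P ! ?len = Halt 40"
  proof -
    have c: "code_at ?P 0 (compile 0 (Code init_code ;; main_com D) @ [Halt 40])"
      unfolding regression_program_def code_at_def by (rule exI[of _ "[]"], rule exI[of _ "[]"]) simp
    then show "code_at ?P 0 (compile 0 (Code init_code))"
      "code_at ?P (length init_code) (compile (length init_code) (main_com D))"
      by (simp_all add: code_at_append)
    have "code_at ?P ?len [Halt 40]" using c unfolding code_at_append by simp
    then show "?len < length ?P" "?P ! ?len = Halt 40" by (simp_all add: code_at_Cons)
  qed
  obtain S V where SV: "sim (fst (effects init_code (nmem ?c, rmem ?c))) (snd (effects init_code (nmem ?c, rmem ?c))) S V"
    using input_sim[OF refl] by blast
  have plain: "list_all plain init_code" by (simp add: init_code_def pointers_def list_all_iff)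
  have len: "length init_code = 20" by (simp add: init_code_def pointers_def)
  have init: "triple A T (\<lambda>N R. sim (fst (effects init_code (N, R))) (snd (effects init_code (N, R))) S V) (Code init_code) (\<lambda>N R. sim N R S V) 20"
    using triple_code[OF plain, of A T "\<lambda>N R. sim N R S V"] len by simp
  show ?thesis
  proof (rule tripleD[OF init at(1)])
    fix c1 :: config
    assume c1: "pc c1 = 0 + com_len (Code init_code)" "result c1 = None" "sim (nmem c1) (rmem c1) S V"
    have w: "wp (main_com D) ?t S V (real phases * (real (Suc Lg) * fail) + 0) (\<lambda>S V. if \<forall>y. cost (V 0) \<le> (1 + \<epsilon>) * cost y then 0 else 1)"
      by (rule hoareD[OF main_correct]) auto
    have "reach A T ?P F c1 (?t + 1) (real phases * (real (Suc Lg) * fail) + 0)"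
    proof (rule wpD[OF w at(2)])
      fix c2 :: config and S2 V2
      assume c2: "pc c2 = length init_code + com_len (main_com D)" "result c2 = None" "sim (nmem c2) (rmem c2) S2 V2"
      show "reach A T ?P F c2 1 (if \<forall>y. cost (V2 0) \<le> (1 + \<epsilon>) * cost y then 0 else 1)"
      proof (cases "\<forall>y. cost (V2 0) \<le> (1 + \<epsilon>) * cost y")
        case True
        let ?y = "read_vec (rmem c2) (nmem c2 40) (dim_col A)"
        have yc: "?y \<in> carrier_vec d" using A by (simp add: read_vec_def)
        have "vec_index ?y j = V2 0 j" if "j < d" for j
          using that A simD(6)[OF c2(3), of 0] simD(8)[OF c2(3), of 0 j] d by (simp add: read_vec_def)
        then have "cost (vec_index ?y) = cost (V2 0)" by (rule cost_cong)
        then have Fy: "F ?y" using F[OF yc] True by simp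
        let ?c3 = "advance 1 (c2\<lparr>result := Some ?y\<rparr>)"
        have "reach A T ?P F ?c3 0 0" by (rule reach_done[where F = F and y = ?y, OF _ Fy]) (auto simp: advance_def)
        then have "reach A T ?P F c2 1 0"
          by (rule reach_step[rotated 4]) (use c2 at in \<open>auto simp: advance_def\<close>)
        then show ?thesis using True by simp
      qed (auto intro: reach_fail)
    qed (use c1 in auto)
    then show "reach A T ?P F c1 (?t + 1) \<delta>" by (rule reach_mono) (use \<delta> in auto)
  qed (use SV in \<open>auto simp: input_config_def\<close>)
qed

section \<open>From the cost to the norm, and from \<open>Lg\<close> to logarithms\<close>

lemma lq_norm_cost: "y \<in> carrier_vec d \<Longrightarrow> lq_norm q (A *\<^sub>v y - b) = cost (vec_index y) powr (1 / q)"
proof -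
  assume y: "y \<in> carrier_vec d"
  have "(\<Sum>i<dim_vec (A *\<^sub>v y - b). \<bar>vec_index (A *\<^sub>v y - b) i\<bar> powr q) = cost (vec_index y)"
    unfolding cost_def resid_def using b A mult_mat_vec_eq_mulA[OF y] by (intro sum.cong) auto
  then show ?thesis by (simp add: lq_norm_def)
qed

text \<open>Taking \<open>q\<close>-th roots only improves the factor \<open>1 + \<epsilon>\<close>.
  The infimum is handled as a greatest lower bound, without an optimal \<open>x\<close>.\<close>

lemma near_optimal:
  assumes y: "y \<in> carrier_vec d" and le: "\<And>x. cost (vec_index y) \<le> (1 + \<epsilon>) * cost x"
  shows "lq_norm q (A *\<^sub>v y - b) \<le> (1 + \<epsilon>) * (INF x\<in>carrier_vec d. lq_norm q (A *\<^sub>v x - b))"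
proof -
  have "lq_norm q (A *\<^sub>v y - b) / (1 + \<epsilon>) \<le> (INF x\<in>carrier_vec d. lq_norm q (A *\<^sub>v x - b))"
  proof (rule cINF_greatest)
    fix x :: "real vec" assume x: "x \<in> carrier_vec d"
    have c0: "0 \<le> cost z" for z by (simp add: cost_def sum_nonneg)
    have "cost (vec_index y) powr (1 / q) \<le> ((1 + \<epsilon>) * cost (vec_index x)) powr (1 / q)"
      using le c0 q by (intro powr_mono2) auto
    also have "\<dots> = (1 + \<epsilon>) powr (1 / q) * cost (vec_index x) powr (1 / q)" using eps c0 by (simp add: powr_mult)
    also have "\<dots> \<le> (1 + \<epsilon>) * cost (vec_index x) powr (1 / q)"
    proof (rule mult_right_mono)
      have "(1 + \<epsilon>) powr (1 / q) \<le> (1 + \<epsilon>) powr 1" using eps q by (intro powr_mono) auto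
      then show "(1 + \<epsilon>) powr (1 / q) \<le> 1 + \<epsilon>" using eps by simp
    qed simp
    finally show "lq_norm q (A *\<^sub>v y - b) / (1 + \<epsilon>) \<le> lq_norm q (A *\<^sub>v x - b)"
      using eps by (simp add: lq_norm_cost x y divide_le_eq mult.commute)
  qed (use zero_carrier_vec[of d] in blast)
  then show ?thesis using eps by (simp add: divide_le_eq mult.commute)
qed

text \<open>By minimality \<open>2 ^ (Lg - 1)\<close> is still below
  \<open>n * (1 + 1 / \<epsilon>)\<close>; with \<open>ln 2\<close> at least \<open>2 / 3\<close>,
  the sum of logarithms is then absorbed into the product.\<close>

lemma Lg_bound: "real Lg \<le> 3 * ((1 + ln (real n)) * (1 + ln (1 + 1 / \<epsilon>)))"
proof -
  have l0: "0 \<le> ln (real n)" "0 \<le> ln (1 + 1 / \<epsilon>)" using n_pos eps by auto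
  have np: "0 < real n" "0 < 1 + 1 / \<epsilon>" using n_pos eps by (auto intro: add_pos_pos)
  have "real (Lg - 1) * ln 2 \<le> ln (real n) + ln (1 + 1 / \<epsilon>)"
  proof -
    have "Lg - 1 < Lg" using Lg_props(2) by simp
    then have "\<not> real n * (1 + 1 / \<epsilon>) \<le> 2 ^ (Lg - 1)" unfolding Lg_def by (rule not_less_Least)
    then have "ln (2 ^ (Lg - 1)) \<le> ln (real n * (1 + 1 / \<epsilon>))"
      using mult_pos_pos[OF np] by (intro ln_le_cancel_iff[THEN iffD2]) auto
    also have "\<dots> = ln (real n) + ln (1 + 1 / \<epsilon>)" by (rule ln_mult_pos[OF np])
    finally show ?thesis by (simp add: ln_realpow)
  qed
  moreover have "real (Lg - 1) * (2 / 3) \<le> real (Lg - 1) * ln 2" using ln2_ge_two_thirds by (intro mult_left_mono) auto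
  ultimately have "real (Lg - 1) \<le> 3 / 2 * (ln (real n) + ln (1 + 1 / \<epsilon>))" by simp
  then have "real Lg \<le> 1 + 3 / 2 * (ln (real n) + ln (1 + 1 / \<epsilon>))"
    using Lg_props(2) of_nat_diff[of 1 Lg, where 'a = real] by linarith
  also have "\<dots> \<le> 3 * ((1 + ln (real n)) * (1 + ln (1 + 1 / \<epsilon>)))"
  proof -
    have "1 + 3 / 2 * (s + t) \<le> 3 * ((1 + s) * (1 + t))" if "0 \<le> s" "0 \<le> t" "0 \<le> s * t" for s t :: real
      using that unfolding distrib_left distrib_right by linarith
    then show ?thesis using l0 by simp
  qed
  finally show ?thesis .
qed

end

theorem theorem1p4:
  "\<forall>C::real. C > 0 \<longrightarrow>
    (\<exists>(P::program) (m::nat) (K::real \<Rightarrow> real).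
      \<forall>(n::nat) (d::nat) (A::real mat) (b::real vec) (q::real) (\<epsilon>::real) (T::real) (p::real).
        A \<in> carrier_mat n d \<longrightarrow> 1 \<le> d \<longrightarrow> d \<le> n \<longrightarrow> vec_space.rank n A = d \<longrightarrow>
        b \<in> carrier_vec n \<longrightarrow> 1 < q \<longrightarrow> q \<le> 2 \<longrightarrow> 0 < \<epsilon> \<longrightarrow>
        real (nnz A + n) \<le> T \<longrightarrow> p = q / (q - 1) \<longrightarrow>
        returns_within A T P (input_config A b q \<epsilon>)
          (K p * ((1 + ln (real n)) * (1 + ln (1 + 1 / \<epsilon>))) ^ m
             * (real d powr ((p - 2) / (2 * p - 2)) * T))
          (1 - real n powr (- C))
          (\<lambda>y. y \<in> carrier_vec d \<and>
               lq_norm q (A *\<^sub>v y - b)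
                 \<le> (1 + \<epsilon>) * (INF x\<in>carrier_vec d. lq_norm q (A *\<^sub>v x - b))))"
proof (intro allI impI)
  fix C :: real assume C: "C > 0"
  \<comment> \<open>\<open>2 * (C + 1)\<close> secures the exponent of \<open>n\<close>, and the
    million beats the polynomial factors in \<open>fail_bound\<close>.\<close>
  define D where "D = nat \<lceil>2 * (C + 1)\<rceil> + 1000000"
  have DC: "2 * (C + 1) \<le> real D" "1000000 \<le> D" unfolding D_def by linarith+
  \<comment> \<open>\<open>10 ^ 24\<close> covers \<open>500 * 10 ^ 21\<close> and the overhead, 16
    is the degree of the time bound in \<open>ZZ\<close>, and 3 comes from
    \<open>Lg_bound\<close>.\<close>
  define Kq where "Kq q = 10 ^ 24 * (real D * (3 * (1 / ((q - 1) / 20) powr (1 / (q - 1))))) ^ 16" for q :: real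
  show "\<exists>(P::program) (m::nat) (K::real \<Rightarrow> real).
      \<forall>(n::nat) (d::nat) (A::real mat) (b::real vec) (q::real) (\<epsilon>::real) (T::real) (p::real).
        A \<in> carrier_mat n d \<longrightarrow> 1 \<le> d \<longrightarrow> d \<le> n \<longrightarrow> vec_space.rank n A = d \<longrightarrow>
        b \<in> carrier_vec n \<longrightarrow> 1 < q \<longrightarrow> q \<le> 2 \<longrightarrow> 0 < \<epsilon> \<longrightarrow>
        real (nnz A + n) \<le> T \<longrightarrow> p = q / (q - 1) \<longrightarrow>
        returns_within A T P (input_config A b q \<epsilon>)
          (K p * ((1 + ln (real n)) * (1 + ln (1 + 1 / \<epsilon>))) ^ m
             * (real d powr ((p - 2) / (2 * p - 2)) * T))
          (1 - real n powr (- C))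
          (\<lambda>y. y \<in> carrier_vec d \<and>
               lq_norm q (A *\<^sub>v y - b)
                 \<le> (1 + \<epsilon>) * (INF x\<in>carrier_vec d. lq_norm q (A *\<^sub>v x - b)))"
  proof (rule exI[of _ "regression_program D"], rule exI[of _ 16], rule exI[of _ "\<lambda>p. Kq (p / (p - 1))"], intro allI impI)
    fix n d :: nat and A :: "real mat" and b :: "real vec" and q \<epsilon> T p :: real
    assume h: "A \<in> carrier_mat n d" "1 \<le> d" "d \<le> n" "vec_space.rank n A = d" "b \<in> carrier_vec n" "1 < q" "q \<le> 2" "0 < \<epsilon>"
      "real (nnz A + n) \<le> T" "p = q / (q - 1)"
    interpret algorithm A b q \<epsilon> T n d D by unfold_locales (use h DC in auto)
    \<comment> \<open>Conjugation of exponents is an involution, so a constant depending on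
      \<open>p\<close> can recover \<open>q\<close> as \<open>p / (p - 1)\<close>.\<close>
    have p1: "p - 1 = 1 / (q - 1)" using h(6) by (simp add: h(10) field_simps)
    have "p / (p - 1) = q / (q - 1) / (1 / (q - 1))" by (simp only: p1) (simp only: h(10))
    then have pq: "p / (p - 1) = q" using h(6) by simp
    have pe: "(p - 2) / (2 * p - 2) = 1 - q / 2"
    proof -
      have "p - 2 = (2 - q) / (q - 1)" "2 * p - 2 = 2 / (q - 1)" using h(6) by (simp_all add: h(10) field_simps)
      then have "(p - 2) / (2 * p - 2) = (2 - q) / 2" using h(6) by simp
      then show ?thesis by (simp add: diff_divide_distrib)
    qed
    let ?l = "(1 + ln (real n)) * (1 + ln (1 + 1 / \<epsilon>))"
    let ?t = "Kq (p / (p - 1)) * ?l ^ 16 * (real d powr ((p - 2) / (2 * p - 2)) * T)"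
    have "ZZ \<le> real D * ((3 * ?l) * (1 / sP))" unfolding ZZ_def
      using Lg_bound sP_props by (intro mult_left_mono mult_right_mono) auto
    also have "\<dots> = (real D * (3 * (1 / sP))) * ?l" by (simp add: mult_ac)
    finally have "ZZ ^ 16 \<le> ((real D * (3 * (1 / sP))) * ?l) ^ 16" using ZZ_props(1) by (intro power_mono) auto
    then have Z: "ZZ ^ 16 \<le> (real D * (3 * (1 / sP))) ^ 16 * ?l ^ 16" by (simp only: power_mult_distrib)
    define E where "E = real d powr (1 - q / 2)"
    have E: "1 \<le> E" unfolding E_def by (rule dexp)
    have "21 + (real Lg * 3 + real phases * (phase_time + 1) + 23) * (500 * T) \<le> 10 ^ 24 * ZZ ^ 16 * E * T"
    proof -
      have "(real Lg * 3 + real phases * (phase_time + 1) + 23) * (500 * T) \<le> (10 ^ 21 * ZZ ^ 16 * E) * (500 * T)"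
        using time_bound T_ge by (intro mult_right_mono) (auto simp: E_def)
      moreover have "21 \<le> 21 * (ZZ ^ 16 * E * T)"
      proof -
        have "1 * 1 * 1 \<le> ZZ ^ 16 * E * T" using ZZ_props(1) E T_ge by (intro mult_mono one_le_power) auto
        then show ?thesis by simp
      qed
      moreover have "(0::real) \<le> ZZ ^ 16 * E * T" using ZZ_props(1) E T_ge by simp
      ultimately show ?thesis by (simp add: algebra_simps)
    qed
    also have "\<dots> \<le> 10 ^ 24 * ((real D * (3 * (1 / sP))) ^ 16 * ?l ^ 16) * E * T"
      using Z E T_ge by (intro mult_right_mono mult_left_mono) auto
    also have "\<dots> = ?t" unfolding pq pe Kq_def E_def sP_def by (simp add: mult_ac)
    finally have time: "21 + (real Lg * 3 + real phases * (phase_time + 1) + 23) * (500 * T) \<le> ?t" .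
    have "reach A T (regression_program D) (\<lambda>y. y \<in> carrier_vec d \<and>
        lq_norm q (A *\<^sub>v y - b) \<le> (1 + \<epsilon>) * (INF x\<in>carrier_vec d. lq_norm q (A *\<^sub>v x - b)))
        (input_config A b q \<epsilon>) ?t (real n powr (- C))"
      by (rule reach_mono[OF program_reach time]) (use fail_bound[OF C DC] near_optimal in auto)
    then show "returns_within A T (regression_program D) (input_config A b q \<epsilon>) ?t (1 - real n powr (- C))
        (\<lambda>y. y \<in> carrier_vec d \<and>
           lq_norm q (A *\<^sub>v y - b) \<le> (1 + \<epsilon>) * (INF x\<in>carrier_vec d. lq_norm q (A *\<^sub>v x - b)))"
      by (rule reach_returns_within) (simp add: input_config_def)
  qed
qed

end
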